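(* Let $k\ge1$ and let $$V^{\mathrm{cor}}_k=e^{-\mathfrak{C}_k}(\partial_x^2+V)e^{\mathfrak{C}_k}-\partial_x^2 .$$ Then, for all $j\in\{1,\dots,k\}$, the operator $V^{\mathrm{cor}}_k$ is bounded on $H^{2j}$, and it satisfies $V^{\mathrm{cor}}_kH^{2j}_{\mathrm{Dir}}\subset H^{2j}_{\mathrm{Dir}}$.
   Context: $V\in C^\infty([0,1];\mathbb{R})$ is fixed. $H^m=H^m([0,1])$ is the usual Sobolev space of complex-valued functions on $[0,1]$. For integers $a\ge0$, $H^{2a}_V=\{u\in H^{2a}:\forall\,0\le\ell<a,\ (\partial_x^2+V)^\ell u(0)=(\partial_x^2+V)^\ell u(1)=0\}$, and $H^{2a}_{\mathrm{Dir}}=\{u\in H^{2a}:\forall\,0\le\ell<a,\ \partial_x^{2\ell}u(0)=\partial_x^{2\ell}u(1)=0\}$. Fix $\varphi_{n,y}\in C^\infty([0,1];\mathbb{R})$ ($n\ge0$, $y\in\{0,1\}$) such that for all $z\in\{0,1\}$, $i\ge0$: $\partial_x^i\varphi_{n,y}(z)=1$ if $z=y$ and $i=n$, and $=0$ otherwise. For $u\in L^1([0,1])$ and $n\ge1$, $\mathcal{I}_{n,y}u(x)=\frac1{(n-1)!}\int_y^x(x-z)^{n-1}u(z)\,dz$. Fix real coefficients $\alpha_{i,n,y}$ ($i\ge1$, $1\le n\le2i+1$, $y\in\{0,1\}$) such that for all $k\ge1$ the corrector $\mathfrak{C}_ku=\sum_{y\in\{0,1\}}\sum_{i=1}^{k-1}\sum_{n=1}^{2i+1}\alpha_{i,n,y}\varphi_{2i+1-n,y}\mathcal{I}_{n,y}u$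 satisfies $\exp(\mathfrak{C}_k)H^{2k+2}_{\mathrm{Dir}}\subset H^{2k+2}_V$ (such coefficients exist). Exponentials of $\mathfrak{C}_k$ are given by power series. *)

theory Defs
  imports "HOL-Analysis.Analysis"
begin

text \<open>Functions on \<open>[0,1]\<close> are total functions on \<open>real\<close>; only their restriction to \<open>[0,1]\<close> matters.
  Elements of \<open>L\<^sup>2\<close> and of the Sobolev spaces are represented by functions, not by classes modulo
  equality almost everywhere; these spaces are closed under equality
  almost everywhere on \<open>[0,1]\<close>, and the operators are determined up to such equality.\<close>

abbreviation leb01 :: "real measure" where
  "leb01 \<equiv> lebesgue_on {0..1}"

text \<open>The derivative is one-sided at 0 and 1.\<close>
definition deriv01 :: "(real \<Rightarrow> 'a::real_normed_vector) \<Rightarrow> real \<Rightarrow> 'a" where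
  "deriv01 f x = vector_derivative f (at x within {0..1})"

definition smooth01 :: "(real \<Rightarrow> 'a::real_normed_vector) \<Rightarrow> bool" where
  "smooth01 f \<longleftrightarrow> (\<forall>n. \<forall>x\<in>{0..1}. (deriv01 ^^ n) f differentiable (at x within {0..1}))"

definition test_function :: "(real \<Rightarrow> real) \<Rightarrow> bool" where
  "test_function \<psi> \<longleftrightarrow> smooth01 \<psi> \<and>
     (\<exists>a b. 0 < a \<and> a \<le> b \<and> b < 1 \<and> (\<forall>x\<in>{0..1} - {a..b}. \<psi> x = 0))"

definition L2 :: "(real \<Rightarrow> complex) set" where
  "L2 = {u \<in> borel_measurable leb01. integrable leb01 (\<lambda>x. (norm (u x))\<^sup>2)}"

definition L2_norm :: "(real \<Rightarrow> complex) \<Rightarrow> real" where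
  "L2_norm u = sqrt (LINT x|leb01. (norm (u x))\<^sup>2)"

definition has_weak_deriv :: "nat \<Rightarrow> (real \<Rightarrow> complex) \<Rightarrow> (real \<Rightarrow> complex) \<Rightarrow> bool" where
  "has_weak_deriv n u v \<longleftrightarrow> integrable leb01 u \<and> integrable leb01 v \<and>
     (\<forall>\<psi>. test_function \<psi> \<longrightarrow>
        (LINT x|leb01. (deriv01 ^^ n) \<psi> x *\<^sub>R u x) = (-1) ^ n * (LINT x|leb01. \<psi> x *\<^sub>R v x))"

text \<open>Some representative of the weak derivative, which is unique up to equality almost everywhere.\<close>
definition weak_deriv :: "nat \<Rightarrow> (real \<Rightarrow> complex) \<Rightarrow> (real \<Rightarrow> complex)" where
  "weak_deriv n u = (SOME v. has_weak_deriv n u v)"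

definition Sob :: "nat \<Rightarrow> (real \<Rightarrow> complex) set" where
  "Sob m = {u \<in> L2. \<forall>i\<le>m. \<exists>v\<in>L2. has_weak_deriv i u v}"

definition Sob_norm :: "nat \<Rightarrow> (real \<Rightarrow> complex) \<Rightarrow> real" where
  "Sob_norm m u = sqrt (\<Sum>i\<le>m. (L2_norm (weak_deriv i u))\<^sup>2)"

text \<open>Point values are those of the continuous representative.\<close>
definition has_value_at :: "(real \<Rightarrow> complex) \<Rightarrow> real \<Rightarrow> complex \<Rightarrow> bool" where
  "has_value_at u z c \<longleftrightarrow> (\<exists>g. continuous_on {0..1} g \<and> (AE x in leb01. u x = g x) \<and> g z = c)"

definition schr :: "(real \<Rightarrow> real) \<Rightarrow> (real \<Rightarrow> complex) \<Rightarrow> (real \<Rightarrow> complex)" where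
  "schr V u = (\<lambda>x. weak_deriv 2 u x + of_real (V x) * u x)"

text \<open>The argument \<open>a\<close> of \<open>Sob_V\<close> and \<open>Sob_Dir\<close> is half the Sobolev order.\<close>
definition Sob_V :: "(real \<Rightarrow> real) \<Rightarrow> nat \<Rightarrow> (real \<Rightarrow> complex) set" where
  "Sob_V V a = {u \<in> Sob (2 * a). \<forall>l<a. \<forall>z\<in>{0, 1}. has_value_at ((schr V ^^ l) u) z 0}"

definition Sob_Dir :: "nat \<Rightarrow> (real \<Rightarrow> complex) set" where
  "Sob_Dir a = {u \<in> Sob (2 * a). \<forall>l<a. \<forall>z\<in>{0, 1}. has_value_at (weak_deriv (2 * l) u) z 0}"

text \<open>The integral is oriented, i.e. it changes sign when \<open>x < y\<close>.\<close>
definition iter_int :: "nat \<Rightarrow> real \<Rightarrow> (real \<Rightarrow> complex) \<Rightarrow> (real \<Rightarrow> complex)" where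
  "iter_int n y u = (\<lambda>x. (1 / fact (n - 1)) *\<^sub>R (LINT z=y..x|lebesgue. ((x - z) ^ (n - 1) *\<^sub>R u z)))"

definition corrector ::
  "(nat \<Rightarrow> nat \<Rightarrow> real \<Rightarrow> real) \<Rightarrow> (nat \<Rightarrow> real \<Rightarrow> real \<Rightarrow> real) \<Rightarrow> nat
    \<Rightarrow> (real \<Rightarrow> complex) \<Rightarrow> (real \<Rightarrow> complex)" where
  "corrector \<alpha> \<phi> k u = (\<lambda>x. \<Sum>y\<in>{0, 1}. \<Sum>i\<in>{1..k-1}. \<Sum>n\<in>{1..2*i+1}.
     of_real (\<alpha> i n y) * of_real (\<phi> (2*i+1-n) y x) * iter_int n y u x)"

text \<open>The exponential power series of an operator applied to \<open>u\<close>, summed in \<open>L\<^sup>2\<close>.\<close>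
definition op_exp ::
  "((real \<Rightarrow> complex) \<Rightarrow> (real \<Rightarrow> complex)) \<Rightarrow> (real \<Rightarrow> complex) \<Rightarrow> (real \<Rightarrow> complex)" where
  "op_exp T u = (SOME v. v \<in> L2 \<and>
     (\<lambda>N. L2_norm (\<lambda>x. (\<Sum>n<N. (1 / fact n) *\<^sub>R (T ^^ n) u x) - v x)) \<longlonglongrightarrow> 0)"

definition V_cor ::
  "(real \<Rightarrow> real) \<Rightarrow> (nat \<Rightarrow> nat \<Rightarrow> real \<Rightarrow> real) \<Rightarrow> (nat \<Rightarrow> real \<Rightarrow> real \<Rightarrow> real) \<Rightarrow> nat
    \<Rightarrow> (real \<Rightarrow> complex) \<Rightarrow> (real \<Rightarrow> complex)" where
  "V_cor V \<alpha> \<phi> k u = (\<lambda>x.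
     op_exp (\<lambda>w x. - corrector \<alpha> \<phi> k w x) (schr V (op_exp (corrector \<alpha> \<phi> k) u)) x
     - weak_deriv 2 u x)"

text \<open>Linearity is required up to equality almost everywhere; together with the norm bound it
  makes the operator well defined on classes.\<close>
definition bounded_on_Sob :: "nat \<Rightarrow> ((real \<Rightarrow> complex) \<Rightarrow> (real \<Rightarrow> complex)) \<Rightarrow> bool" where
  "bounded_on_Sob m T \<longleftrightarrow>
     T ` Sob m \<subseteq> Sob m \<and>
     (\<forall>u\<in>Sob m. \<forall>v\<in>Sob m. \<forall>c d.
        AE x in leb01. T (\<lambda>x. c * u x + d * v x) x = c * T u x + d * T v x) \<and>
     (\<exists>B. \<forall>u\<in>Sob m. Sob_norm m (T u) \<le> B * Sob_norm m u)"

end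

theory Submission
  imports Defs
begin

text \<open>Write \<open>T\<close> for the corrector and \<open>E = e\<^sup>T\<close>.

  \<^bold>\<open>Boundedness.\<close> On the unit interval \<open>T\<close> is a finite sum of operators \<open>f J\<^sup>n\<close>, \<open>n \<ge> 1\<close>, where \<open>J\<close> integrates from one of
  the end points \<open>y\<close> and \<open>f\<close> is smooth. Such an operator gains a derivative, so its exponential series converges on
  \<open>L\<^sup>2\<close> and on every \<open>H\<^sup>m\<close>, and \<open>E\<close> is invertible there with inverse \<open>e\<^bsup>-T\<^esup>\<close> (\<open>exp_inverse\<close>). Integration by parts shows that
  \<open>[\<partial>\<^sup>2, f J\<^sup>n]\<close> consists of operators of the same kind, of multiplications, and of boundary values of \<open>u\<close> and \<open>u'\<close>
  times smooth functions (\<open>commuting_term\<close>); so it is bounded on \<open>H\<^sup>m\<close> for \<open>m \<ge> 2\<close>. By the Leibniz rule the same holds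
  for \<open>[\<partial>\<^sup>2, T\<^sup>n]\<close>, with bounds that grow geometrically in \<open>n\<close>, and hence for \<open>[\<partial>\<^sup>2, E]\<close> (\<open>exp_commutator_bounded\<close>). The
  operator of the theorem equals \<open>e\<^bsup>-T\<^esup> ([\<partial>\<^sup>2, E] + V E)\<close> (\<open>conj_op_AE_rep\<close>), which is therefore bounded on \<open>H\<^sup>m\<close>.

  \<^bold>\<open>Boundary conditions.\<close> Let a function be flat to order \<open>m\<close> if its derivatives of order below \<open>m\<close> vanish at both end
  points. Since the coefficient \<open>f\<close> of \<open>f J\<^sup>n\<close> is flat to all orders at the end point from which \<open>J\<close> does not integrate,
  all operators above preserve flatness, and \<open>T\<close> raises the order by one. So what they do to the jet of a function at the
  end points may be computed on smooth functions, for which the given \<open>\<phi> n y\<close> form a basis of jets.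
  The hypothesis says that \<open>E s\<close> satisfies the boundary conditions of \<open>\<partial>\<^sup>2 + V\<close> if \<open>s\<close> has odd jets only. As \<open>E - 1\<close>
  raises the order of flatness, the trace of \<open>(\<partial>\<^sup>2 + V)\<^sup>l E u\<close> is the jet of \<open>u\<close> of order \<open>2 l\<close> plus a combination of lower
  ones; this triangular structure yields the converse, that \<open>u\<close> satisfies the Dirichlet conditions if \<open>E u\<close>
  satisfies those of \<open>\<partial>\<^sup>2 + V\<close>, at every order (\<open>even_jets_zero\<close>). For smooth \<open>s\<close> with odd jets, \<open>(\<partial>\<^sup>2 + V) E s\<close> satisfies the
  boundary conditions of \<open>\<partial>\<^sup>2 + V\<close>, so \<open>e\<^bsup>-T\<^esup>\<close> of it satisfies the Dirichlet conditions, and so does \<open>\<partial>\<^sup>2 s\<close>. This proves the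
  inclusion for such \<open>s\<close>, and by flatness in general (\<open>conj_op_Dir\<close>).

  \<^bold>\<open>Representatives.\<close> Sobolev functions are handled through their continuous representatives (\<open>jet_ball\<close>), which exist
  by the lemma of du Bois-Reymond (\<open>Sob_imp_jet_ball\<close>).\<close>

section \<open>Square integrable functions on the unit interval\<close>

lemma emeasure_leb01: "emeasure leb01 {0..1} = 1"
  by (simp add: emeasure_restrict_space)

lemma finite_measure_leb01: "finite_measure leb01"
  by (simp add: finite_measure_lebesgue_on)

lemma measure_leb01: "measure leb01 {0..1} = 1"
  by (simp add: measure_def emeasure_leb01)

lemma integrable_const_leb01 [simp]: "integrable leb01 (\<lambda>x. c :: 'a::{banach,second_countable_topology})"
  using finite_measure.integrable_const[OF finite_measure_leb01] .

lemma AE_leb01_I: "(\<And>x. x \<in> {0..1} \<Longrightarrow> P x) \<Longrightarrow> AE x in leb01. P x"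
  by (rule AE_I2) simp

text \<open>Lebesgue measure is complete.\<close>
lemma borel_measurable_leb01_AE:
  fixes u v :: "real \<Rightarrow> 'a::euclidean_space"
  assumes u: "u \<in> borel_measurable leb01" and ae: "AE x in leb01. u x = v x"
  shows "v \<in> borel_measurable leb01"
proof -
  have "(\<lambda>x. if x \<in> {0..1} then u x else 0) \<in> borel_measurable lebesgue"
    by (rule borel_measurable_if_I[OF u]) simp
  moreover have "AE x in lebesgue. (if x \<in> {0..1} then u x else 0) = (if x \<in> {0..1} then v x else 0)"
    using ae by (subst (asm) AE_restrict_space_iff) (auto elim: eventually_mono)
  ultimately have "(\<lambda>x. if x \<in> {0..1} then v x else 0) \<in> borel_measurable lebesgue"
    by (rule borel_measurable_AE)
  then show ?thesis
    by (rule borel_measurable_if_D)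
qed

lemma continuous_measurable01:
  fixes u :: "real \<Rightarrow> 'a::euclidean_space"
  shows "continuous_on {0..1} u \<Longrightarrow> u \<in> borel_measurable leb01"
  by (simp add: continuous_imp_measurable_on_sets_lebesgue)

lemma L2_D: assumes "u \<in> L2" shows "u \<in> borel_measurable leb01"
    "integrable leb01 (\<lambda>x. (norm (u x))\<^sup>2)"
  using assms by (auto simp: L2_def)

lemma L2_norm_nonneg: "0 \<le> L2_norm u"
  by (simp add: L2_norm_def)

lemma L2_norm_square: "(L2_norm u)\<^sup>2 = (LINT x|leb01. (norm (u x))\<^sup>2)"
  by (simp add: L2_norm_def)

lemma L2_norm_leI:
  "0 \<le> M \<Longrightarrow> (LINT x|leb01. (norm (u x))\<^sup>2) \<le> M\<^sup>2 \<Longrightarrow> L2_norm u \<le> M"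
  unfolding L2_norm_def using real_le_lsqrt by blast

lemma L2_AE:
  assumes u: "u \<in> L2" and ae: "AE x in leb01. u x = v x"
  shows "v \<in> L2" "L2_norm v = L2_norm u"
proof -
  have v: "v \<in> borel_measurable leb01"
    using borel_measurable_leb01_AE[OF L2_D(1)[OF u] ae] .
  have ae2: "AE x in leb01. (norm (u x))\<^sup>2 = (norm (v x))\<^sup>2"
    using ae by (rule eventually_mono) simp
  have "integrable leb01 (\<lambda>x. (norm (v x))\<^sup>2)"
    by (rule integrable_cong_AE_imp[OF L2_D(2)[OF u]]) (use v ae2 in auto)
  with v show "v \<in> L2" by (simp add: L2_def)
  show "L2_norm v = L2_norm u"
    unfolding L2_norm_def using L2_D(1)[OF u] v ae2
    by (intro arg_cong[of _ _ sqrt] integral_cong_AE) auto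
qed

lemma L2_bounded:
  assumes u: "u \<in> borel_measurable leb01" and le: "AE x in leb01. norm (u x) \<le> M" and M: "0 \<le> M"
  shows "u \<in> L2" "L2_norm u \<le> M"
proof -
  have ae: "AE x in leb01. (norm (u x))\<^sup>2 \<le> M\<^sup>2"
    using le by (rule eventually_mono) (simp add: power_mono)
  have i: "integrable leb01 (\<lambda>x. (norm (u x))\<^sup>2)"
    by (rule Bochner_Integration.integrable_bound[OF integrable_const_leb01[of "M\<^sup>2"]])
      (use u ae in auto)
  then show "u \<in> L2" using u by (simp add: L2_def)
  have "(LINT x|leb01. (norm (u x))\<^sup>2) \<le> (LINT x|leb01. M\<^sup>2)"
    by (rule integral_mono_AE[OF i]) (use ae in auto)
  then show "L2_norm u \<le> M"
    using M by (intro L2_norm_leI) (auto simp: measure_leb01)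
qed

lemma L2_integrable:
  assumes "u \<in> L2" shows "integrable leb01 u"
proof (rule Bochner_Integration.integrable_bound)
  show "integrable leb01 (\<lambda>x. 1 + (norm (u x))\<^sup>2)"
    using L2_D(2)[OF assms] by simp
  have "norm (u x) \<le> 1 + (norm (u x))\<^sup>2" for x
    using zero_le_power2[of "norm (u x) - 1 / 2"] by (simp add: power2_diff power2_eq_square algebra_simps)
  then show "AE x in leb01. norm (u x) \<le> norm (1 + (norm (u x))\<^sup>2)"
    by auto
qed (use L2_D assms in auto)

text \<open>The unit interval has measure one, so the variance of \<^term>\<open>\<lambda>x. norm (u x)\<close> is its second
  moment minus the square of its mean.\<close>
lemma L1_le_L2:
  assumes "u \<in> L2" shows "(LINT x|leb01. norm (u x)) \<le> L2_norm u"
proof -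
  define a where "a = (LINT x|leb01. norm (u x))"
  have i: "integrable leb01 (\<lambda>x. norm (u x))" "integrable leb01 (\<lambda>x. (norm (u x))\<^sup>2)"
    using L2_integrable[OF assms] L2_D[OF assms] by auto
  have "0 \<le> (LINT x|leb01. (norm (u x) - a)\<^sup>2)" by simp
  also have "\<dots> = (LINT x|leb01. (norm (u x))\<^sup>2 - 2 * a * norm (u x) + a\<^sup>2)"
    by (intro Bochner_Integration.integral_cong) (auto simp: power2_eq_square algebra_simps)
  also have "\<dots> = (LINT x|leb01. (norm (u x))\<^sup>2) - 2 * a * a + a\<^sup>2"
    using i by (simp add: measure_leb01 flip: a_def)
  finally have "a\<^sup>2 \<le> (LINT x|leb01. (norm (u x))\<^sup>2)" by (simp add: power2_eq_square)
  then show ?thesis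
    unfolding L2_norm_def a_def using real_le_rsqrt by blast
qed

lemma L2_mult:
  assumes u: "u \<in> L2" and g: "g \<in> borel_measurable leb01"
    and le: "\<And>x. x \<in> {0..1} \<Longrightarrow> norm (g x :: complex) \<le> c" and c: "0 \<le> c"
  shows "(\<lambda>x. g x * u x) \<in> L2" "L2_norm (\<lambda>x. g x * u x) \<le> c * L2_norm u"
proof -
  have le2: "(norm (g x * u x))\<^sup>2 \<le> c\<^sup>2 * (norm (u x))\<^sup>2" if "x \<in> {0..1}" for x
    using le[OF that] c by (auto simp: norm_mult power_mult_distrib intro!: mult_right_mono power_mono)
  have i: "integrable leb01 (\<lambda>x. c\<^sup>2 * (norm (u x))\<^sup>2)" using L2_D(2)[OF u] by simp
  have i2: "integrable leb01 (\<lambda>x. (norm (g x * u x))\<^sup>2)"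
    by (rule Bochner_Integration.integrable_bound[OF i])
      (use le2 g L2_D(1)[OF u] in \<open>auto intro!: AE_leb01_I\<close>)
  then show "(\<lambda>x. g x * u x) \<in> L2"
    using g L2_D(1)[OF u] by (simp add: L2_def)
  have "(LINT x|leb01. (norm (g x * u x))\<^sup>2) \<le> (LINT x|leb01. c\<^sup>2 * (norm (u x))\<^sup>2)"
    by (rule integral_mono[OF i2 i]) (use le2 in auto)
  also have "\<dots> = (c * L2_norm u)\<^sup>2" by (simp add: power_mult_distrib L2_norm_square)
  finally show "L2_norm (\<lambda>x. g x * u x) \<le> c * L2_norm u"
    using c L2_norm_nonneg[of u] by (intro L2_norm_leI) auto
qed

lemma L2_scale:
  assumes u: "u \<in> L2"
  shows "(\<lambda>x. c * u x) \<in> L2" "L2_norm (\<lambda>x. c * u x) = norm c * L2_norm u"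
proof -
  show "(\<lambda>x. c * u x) \<in> L2" using L2_mult[OF u, of "\<lambda>_. c" "norm c"] by auto
  show "L2_norm (\<lambda>x. c * u x) = norm c * L2_norm u"
    by (simp add: L2_norm_def norm_mult power_mult_distrib real_sqrt_mult)
qed

text \<open>Minkowski's inequality, from \<open>2 p q \<le> (b / a) p\<^sup>2 + (a / b) q\<^sup>2\<close> with \<open>a\<close> and \<open>b\<close> slightly larger
  than the two norms, which avoids a division by zero.\<close>
lemma L2_add:
  assumes u: "u \<in> L2" and v: "v \<in> L2"
  shows "(\<lambda>x. u x + v x) \<in> L2" "L2_norm (\<lambda>x. u x + v x) \<le> L2_norm u + L2_norm v"
proof -
  have *: "(\<lambda>x. u x + v x) \<in> L2 \<and> L2_norm (\<lambda>x. u x + v x) \<le> a + b"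
    if ab: "L2_norm u \<le> a" "L2_norm v \<le> b" "0 < a" "0 < b" for a b
  proof -
    have le: "(norm (u x + v x))\<^sup>2 \<le> (1 + b / a) * (norm (u x))\<^sup>2 + (1 + a / b) * (norm (v x))\<^sup>2" for x
    proof -
      let ?p = "norm (u x)" and ?q = "norm (v x)"
      have "(norm (u x + v x))\<^sup>2 \<le> (?p + ?q)\<^sup>2" by (simp add: norm_triangle_ineq power_mono)
      moreover have "2 * ?p * ?q \<le> b / a * ?p\<^sup>2 + a / b * ?q\<^sup>2"
      proof -
        have "0 \<le> (b * ?p - a * ?q)\<^sup>2 / (a * b)" using ab by simp
        also have "\<dots> = b / a * ?p\<^sup>2 + a / b * ?q\<^sup>2 - 2 * ?p * ?q"
          using ab by (simp add: field_simps power2_eq_square)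
        finally show ?thesis by simp
      qed
      ultimately show ?thesis by (simp add: power2_sum algebra_simps)
    qed
    have i: "integrable leb01 (\<lambda>x. (1 + b / a) * (norm (u x))\<^sup>2 + (1 + a / b) * (norm (v x))\<^sup>2)"
      using L2_D(2)[OF u] L2_D(2)[OF v] by simp
    have i2: "integrable leb01 (\<lambda>x. (norm (u x + v x))\<^sup>2)"
      by (rule Bochner_Integration.integrable_bound[OF i])
        (use le L2_D(1)[OF u] L2_D(1)[OF v] in \<open>auto intro!: AE_leb01_I order_trans[OF _ abs_ge_self]\<close>)
    have "(LINT x|leb01. (norm (u x + v x))\<^sup>2)
        \<le> (LINT x|leb01. (1 + b / a) * (norm (u x))\<^sup>2 + (1 + a / b) * (norm (v x))\<^sup>2)"
      by (rule integral_mono[OF i2 i]) (use le in auto)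
    also have "\<dots> = (1 + b / a) * (L2_norm u)\<^sup>2 + (1 + a / b) * (L2_norm v)\<^sup>2"
      using L2_D(2)[OF u] L2_D(2)[OF v] by (simp add: L2_norm_square)
    also have "\<dots> \<le> (1 + b / a) * a\<^sup>2 + (1 + a / b) * b\<^sup>2"
      using ab L2_norm_nonneg[of u] L2_norm_nonneg[of v]
      by (intro add_mono mult_left_mono power_mono) auto
    also have "\<dots> = (a + b)\<^sup>2" using ab by (simp add: field_simps power2_eq_square)
    finally show ?thesis
      using ab i2 L2_D(1)[OF u] L2_D(1)[OF v] by (auto simp: L2_def intro!: L2_norm_leI)
  qed
  show "(\<lambda>x. u x + v x) \<in> L2"
    using *[of "L2_norm u + 1" "L2_norm v + 1"] L2_norm_nonneg[of u] L2_norm_nonneg[of v] by auto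
  show "L2_norm (\<lambda>x. u x + v x) \<le> L2_norm u + L2_norm v"
  proof (rule field_le_epsilon)
    fix e :: real assume "0 < e"
    then show "L2_norm (\<lambda>x. u x + v x) \<le> L2_norm u + L2_norm v + e"
      using *[of "L2_norm u + e / 2" "L2_norm v + e / 2"] L2_norm_nonneg[of u] L2_norm_nonneg[of v]
      by auto
  qed
qed

lemma L2_zero: "(\<lambda>x. 0) \<in> L2" "L2_norm (\<lambda>x. 0) = 0"
  by (auto simp: L2_def L2_norm_def)

lemma L2_lincomb:
  assumes "u \<in> L2" "v \<in> L2" shows "(\<lambda>x. c * u x + d * v x) \<in> L2"
  using assms L2_add(1) L2_scale(1) by blast

lemma L2_diff:
  assumes "u \<in> L2" "v \<in> L2" shows "(\<lambda>x. u x - v x) \<in> L2"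
  using L2_lincomb[OF assms, of 1 "-1"] by simp

lemma L2_sum:
  assumes "finite I" "\<And>i. i \<in> I \<Longrightarrow> u i \<in> L2"
  shows "(\<lambda>x. \<Sum>i\<in>I. u i x) \<in> L2" "L2_norm (\<lambda>x. \<Sum>i\<in>I. u i x) \<le> (\<Sum>i\<in>I. L2_norm (u i))"
  using assms
proof (induction I rule: finite_induct)
  case (insert i I)
  { case 1 then show ?case using insert L2_add(1) by simp }
  { case 2
    have "L2_norm (\<lambda>x. u i x + (\<Sum>i\<in>I. u i x)) \<le> L2_norm (u i) + L2_norm (\<lambda>x. \<Sum>i\<in>I. u i x)"
      using 2 insert by (intro L2_add(2)) auto
    then show ?case using insert 2 by (force) }
qed (auto simp: L2_zero)

text \<open>Summability of the norms gives almost everywhere absolute convergence, and Fatou's lemma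
  bounds the norm of the sum.\<close>
lemma L2_suminf:
  fixes u :: "nat \<Rightarrow> real \<Rightarrow> complex"
  assumes u: "\<And>n. u n \<in> L2" and le: "\<And>n. L2_norm (u n) \<le> a n" and a: "summable a"
  shows "AE x in leb01. summable (\<lambda>n. norm (u n x))" (is ?ae)
    and "(\<lambda>x. \<Sum>n. u n x) \<in> L2" and "L2_norm (\<lambda>x. \<Sum>n. u n x) \<le> suminf a"
proof -
  have [measurable]: "u n \<in> borel_measurable leb01" for n using L2_D(1)[OF u] .
  have a0: "0 \<le> a n" for n using le[of n] L2_norm_nonneg[of "u n"] by linarith
  have nn: "(\<integral>\<^sup>+x. ennreal (norm (u n x)) \<partial>leb01) \<le> ennreal (a n)" for n
  proof -
    have "(\<integral>\<^sup>+x. ennreal (norm (u n x)) \<partial>leb01) = ennreal (LINT x|leb01. norm (u n x))"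
      using L2_integrable[OF u] by (intro nn_integral_eq_integral) auto
    also have "\<dots> \<le> ennreal (a n)"
      using L1_le_L2[OF u, of n] le[of n] by (intro ennreal_leI) linarith
    finally show ?thesis .
  qed
  have "(\<integral>\<^sup>+x. (\<Sum>n. ennreal (norm (u n x))) \<partial>leb01) = (\<Sum>n. \<integral>\<^sup>+x. ennreal (norm (u n x)) \<partial>leb01)"
    by (rule nn_integral_suminf) simp
  also have "\<dots> \<le> (\<Sum>n. ennreal (a n))"
    by (intro suminf_le nn) auto
  also have "\<dots> = ennreal (suminf a)"
    using a a0 by (intro suminf_ennreal2) auto
  finally have "(\<integral>\<^sup>+x. (\<Sum>n. ennreal (norm (u n x))) \<partial>leb01) \<noteq> \<infinity>"
    by (auto simp: top_unique)
  then have "AE x in leb01. (\<Sum>n. ennreal (norm (u n x))) \<noteq> \<infinity>"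
    by (intro nn_integral_PInf_AE) auto
  then show ae: ?ae
    by (rule eventually_mono) (auto intro!: summable_suminf_not_top)
  define S where "S N x = (\<Sum>n<N. u n x)" for N x
  have [measurable]: "S N \<in> borel_measurable leb01" for N unfolding S_def by measurable
  have SL: "S N \<in> L2" "L2_norm (S N) \<le> suminf a" for N
  proof -
    show "S N \<in> L2" unfolding S_def using L2_sum(1)[of "{..<N}" u] u by simp
    have "L2_norm (S N) \<le> (\<Sum>n<N. L2_norm (u n))"
      unfolding S_def using L2_sum(2)[of "{..<N}" u] u by simp
    also have "\<dots> \<le> (\<Sum>n<N. a n)" by (intro sum_mono le)
    also have "\<dots> \<le> suminf a" by (intro sum_le_suminf a) (auto simp: a0)
    finally show "L2_norm (S N) \<le> suminf a" .
  qed
  have lim: "AE x in leb01. (\<lambda>N. S N x) \<longlonglongrightarrow> (\<Sum>n. u n x)"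
    using ae by (rule eventually_mono) (auto simp: S_def intro!: summable_LIMSEQ summable_norm_cancel)
  have m: "(\<lambda>x. \<Sum>n. u n x) \<in> borel_measurable leb01" by measurable
  have "(\<integral>\<^sup>+x. ennreal ((norm (\<Sum>n. u n x))\<^sup>2) \<partial>leb01)
      = (\<integral>\<^sup>+x. liminf (\<lambda>N. ennreal ((norm (S N x))\<^sup>2)) \<partial>leb01)"
  proof (rule nn_integral_cong_AE, rule eventually_mono[OF lim])
    fix x assume "(\<lambda>N. S N x) \<longlonglongrightarrow> (\<Sum>n. u n x)"
    then have "(\<lambda>N. ennreal ((norm (S N x))\<^sup>2)) \<longlonglongrightarrow> ennreal ((norm (\<Sum>n. u n x))\<^sup>2)"
      by (intro tendsto_intros) auto
    then show "ennreal ((norm (\<Sum>n. u n x))\<^sup>2) = liminf (\<lambda>N. ennreal ((norm (S N x))\<^sup>2))"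
      by (intro lim_imp_Liminf[symmetric]) auto
  qed
  also have "\<dots> \<le> liminf (\<lambda>N. \<integral>\<^sup>+x. ennreal ((norm (S N x))\<^sup>2) \<partial>leb01)"
    by (rule nn_integral_liminf) measurable
  also have "\<dots> \<le> liminf (\<lambda>N::nat. ennreal ((suminf a)\<^sup>2))"
  proof (rule Liminf_mono, rule always_eventually, rule allI)
    fix N
    have "(\<integral>\<^sup>+x. ennreal ((norm (S N x))\<^sup>2) \<partial>leb01) = ennreal ((L2_norm (S N))\<^sup>2)"
      unfolding L2_norm_square using L2_D(2)[OF SL(1)] by (intro nn_integral_eq_integral) auto
    also have "\<dots> \<le> ennreal ((suminf a)\<^sup>2)"
      using SL(2)[of N] L2_norm_nonneg by (intro ennreal_leI power_mono)
    finally show "(\<integral>\<^sup>+x. ennreal ((norm (S N x))\<^sup>2) \<partial>leb01) \<le> ennreal ((suminf a)\<^sup>2)" .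
  qed
  also have "\<dots> = ennreal ((suminf a)\<^sup>2)" by (simp add: Liminf_const)
  finally have fin: "(\<integral>\<^sup>+x. ennreal ((norm (\<Sum>n. u n x))\<^sup>2) \<partial>leb01) \<le> ennreal ((suminf a)\<^sup>2)" .
  have i: "integrable leb01 (\<lambda>x. (norm (\<Sum>n. u n x))\<^sup>2)"
    using fin m by (intro integrableI_bounded) (auto simp: less_top top_unique intro: le_less_trans)
  then show "(\<lambda>x. \<Sum>n. u n x) \<in> L2" using m by (simp add: L2_def)
  have "ennreal (LINT x|leb01. (norm (\<Sum>n. u n x))\<^sup>2) \<le> ennreal ((suminf a)\<^sup>2)"
    using fin nn_integral_eq_integral[OF i] by simp
  then have "(LINT x|leb01. (norm (\<Sum>n. u n x))\<^sup>2) \<le> (suminf a)\<^sup>2"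
    by (simp add: ennreal_le_iff)
  then show "L2_norm (\<lambda>x. \<Sum>n. u n x) \<le> suminf a"
    using suminf_nonneg[OF a a0] by (intro L2_norm_leI)
qed

section \<open>Smooth functions on the unit interval\<close>

lemma deriv01_eq:
  fixes f :: "real \<Rightarrow> 'a::euclidean_space"
  assumes "(f has_vector_derivative d) (at x within {0..1})" "x \<in> {0..1}"
  shows "deriv01 f x = d"
  unfolding deriv01_def by (rule vector_derivative_within_closed_interval) (use assms in auto)

lemma has_vector_derivative01_cong:
  assumes "\<And>t. t \<in> {0..1::real} \<Longrightarrow> f t = g t" "x \<in> {0..1}"
  shows "(f has_vector_derivative d) (at x within {0..1}) \<longleftrightarrow> (g has_vector_derivative d) (at x within {0..1})"
  using has_vector_derivative_transform[of x "{0..1}" f g d]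
    has_vector_derivative_transform[of x "{0..1}" g f d] assms by auto

lemma deriv01_cong:
  assumes "\<And>t. t \<in> {0..1} \<Longrightarrow> f t = g t" "x \<in> {0..1}"
  shows "deriv01 f x = deriv01 g x"
  unfolding deriv01_def vector_derivative_def using has_vector_derivative01_cong[OF assms] by presburger

lemma deriv01_iter_cong:
  assumes "\<And>t. t \<in> {0..1} \<Longrightarrow> f t = g t" "x \<in> {0..1}"
  shows "(deriv01 ^^ n) f x = (deriv01 ^^ n) g x"
  using assms(2)
proof (induction n arbitrary: x)
  case (Suc n)
  then show ?case using deriv01_cong[of "(deriv01 ^^ n) f" "(deriv01 ^^ n) g" x] by simp
qed (use assms in simp)

fun Ck :: "nat \<Rightarrow> (real \<Rightarrow> 'a::euclidean_space) \<Rightarrow> bool" where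
  "Ck 0 g \<longleftrightarrow> continuous_on {0..1} g"
| "Ck (Suc m) g \<longleftrightarrow>
    (\<exists>g'. (\<forall>x\<in>{0..1}. (g has_vector_derivative g' x) (at x within {0..1})) \<and> Ck m g')"

lemma Ck_cong:
  assumes eq: "\<And>t. t \<in> {0..1} \<Longrightarrow> f t = g t" and f: "Ck m f" shows "Ck m g"
proof (cases m)
  case 0 then show ?thesis
    using continuous_on_eq[of "{0..1}" f g] eq f by simp
next
  case (Suc n)
  then obtain f' where f': "\<forall>x\<in>{0..1}. (f has_vector_derivative f' x) (at x within {0..1})" "Ck n f'"
    using f by (auto simp only: Ck.simps)
  have "(g has_vector_derivative f' x) (at x within {0..1})" if "x \<in> {0..1}" for x
    using has_vector_derivative01_cong[of f g x "f' x"] eq f'(1) that by blast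
  then show ?thesis unfolding Suc Ck.simps using f'(2) by (intro exI[of _ f']) simp
qed

lemma Ck_continuous: "Ck m g \<Longrightarrow> continuous_on {0..1} g"
  by (cases m) (auto intro: continuous_on_vector_derivative)

lemma Ck_Suc: "Ck (Suc m) g \<Longrightarrow> Ck m g"
proof (induction m arbitrary: g)
  case 0 then show ?case using Ck_continuous[of "Suc 0" g] by (simp del: Ck.simps(2))
next
  case (Suc m)
  then obtain g' where "\<forall>x\<in>{0..1}. (g has_vector_derivative g' x) (at x within {0..1})" "Ck (Suc m) g'"
    by (auto simp only: Ck.simps)
  with Suc.IH[of g'] show ?case unfolding Ck.simps by (intro exI[of _ g']) simp
qed

lemma Ck_const: "Ck m (\<lambda>x. c)"
proof (induction m arbitrary: c)
  case (Suc m)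
  have "\<forall>x\<in>{0..1}. ((\<lambda>x. c) has_vector_derivative 0) (at x within {0..1})" by simp
  with Suc[of 0] show ?case unfolding Ck.simps by (intro exI[of _ "\<lambda>x. 0"]) simp
qed simp

lemma Ck_add: "Ck m f \<Longrightarrow> Ck m g \<Longrightarrow> Ck m (\<lambda>x. f x + g x)"
proof (induction m arbitrary: f g)
  case (Suc m)
  then obtain f' g' where *: "\<forall>x\<in>{0..1}. (f has_vector_derivative f' x) (at x within {0..1})" "Ck m f'"
      "\<forall>x\<in>{0..1}. (g has_vector_derivative g' x) (at x within {0..1})" "Ck m g'" by auto
  show ?case
    unfolding Ck.simps by (rule exI[of _ "\<lambda>x. f' x + g' x"]) (use * Suc.IH in \<open>auto intro!: has_vector_derivative_add\<close>)
qed (auto intro: continuous_intros)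

lemma Ck_scaleR:
  fixes f :: "real \<Rightarrow> real" and g :: "real \<Rightarrow> 'a::euclidean_space"
  shows "Ck m f \<Longrightarrow> Ck m g \<Longrightarrow> Ck m (\<lambda>x. f x *\<^sub>R g x)"
proof (induction m arbitrary: f g)
  case (Suc m)
  then obtain f' g' where *: "\<forall>x\<in>{0..1}. (f has_vector_derivative f' x) (at x within {0..1})" "Ck m f'"
      "\<forall>x\<in>{0..1}. (g has_vector_derivative g' x) (at x within {0..1})" "Ck m g'" by auto
  show ?case
    unfolding Ck.simps
  proof (intro exI conjI ballI)
    show "Ck m (\<lambda>x. f x *\<^sub>R g' x + f' x *\<^sub>R g x)"
      using * Suc.prems[THEN Ck_Suc] by (intro Ck_add Suc.IH)
    fix x :: real assume "x \<in> {0..1}"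
    then show "((\<lambda>x. f x *\<^sub>R g x) has_vector_derivative f x *\<^sub>R g' x + f' x *\<^sub>R g x) (at x within {0..1})"
      using * by (intro has_vector_derivative_scaleR) (auto simp: has_real_derivative_iff_has_vector_derivative)
  qed
qed (auto intro: continuous_intros)

text \<open>Smoothness is membership in every \<open>C\<^sup>m\<close>; there closure under products is a plain induction on
  \<open>m\<close>, whereas the iterated \<^const>\<open>deriv01\<close> would need the Leibniz formula.\<close>
lemma smooth01_iff_Ck: 
  fixes g :: "real \<Rightarrow> 'a::euclidean_space"
  shows "smooth01 g \<longleftrightarrow> (\<forall>m. Ck m g)"
proof
  assume g: "smooth01 g"
  have d: "((deriv01 ^^ n) g has_vector_derivative (deriv01 ^^ Suc n) g x) (at x within {0..1})"
    if "x \<in> {0..1}" for n x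
    using g that unfolding smooth01_def by (simp add: deriv01_def vector_derivative_works)
  have "Ck m ((deriv01 ^^ n) g)" for m n
  proof (induction m arbitrary: n)
    case 0
    show ?case using continuous_on_vector_derivative[OF d[of _ n]] by simp
  next
    case (Suc m) then show ?case using d[of _ n] unfolding Ck.simps
      by (intro exI[of _ "(deriv01 ^^ Suc n) g"]) blast
  qed
  from this[of _ 0] show "\<forall>m. Ck m g" by simp
next
  assume a: "\<forall>m. Ck m g"
  have "(\<forall>m. Ck m g) \<Longrightarrow> \<forall>m. Ck m ((deriv01 ^^ n) g)" for n
  proof (induction n)
    case (Suc n)
    let ?h = "(deriv01 ^^ n) g"
    show ?case
    proof
      fix m
      obtain g' where g': "\<forall>x\<in>{0..1}. (?h has_vector_derivative g' x) (at x within {0..1})" "Ck m g'"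
        using Suc(1)[OF Suc(2), rule_format, of "Suc m"] unfolding Ck.simps by blast
      have "g' t = (deriv01 ^^ Suc n) g t" if "t \<in> {0..1}" for t
        using deriv01_eq[of ?h "g' t" t] g'(1) that by simp
      then show "Ck m ((deriv01 ^^ Suc n) g)"
        using g'(2) by (rule Ck_cong)
    qed
  qed simp
  then have "Ck (Suc 0) ((deriv01 ^^ n) g)" for n using a by blast
  then show "smooth01 g"
    unfolding smooth01_def Ck.simps using differentiableI_vector by fast
qed

lemma smooth01_deriv:
  fixes g :: "real \<Rightarrow> 'a::euclidean_space"
  assumes "smooth01 g"
  shows "smooth01 (deriv01 g)"
    and "x \<in> {0..1} \<Longrightarrow> (g has_vector_derivative deriv01 g x) (at x within {0..1})"
proof -
  show "smooth01 (deriv01 g)"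
    unfolding smooth01_def
  proof (intro allI ballI)
    fix n and x :: real assume x: "x \<in> {0..1}"
    show "(deriv01 ^^ n) (deriv01 g) differentiable at x within {0..1}"
      using assms[unfolded smooth01_def, rule_format, OF x, of "Suc n"] by (simp add: funpow_swap1)
  qed
  show "x \<in> {0..1} \<Longrightarrow> (g has_vector_derivative deriv01 g x) (at x within {0..1})"
    using assms[unfolded smooth01_def, rule_format, of x 0]
    by (simp add: deriv01_def vector_derivative_works)
qed

lemma smooth01_continuous:
  fixes g :: "real \<Rightarrow> 'a::euclidean_space"
  shows "smooth01 g \<Longrightarrow> continuous_on {0..1} g"
  unfolding smooth01_iff_Ck using Ck_continuous by blast

lemma bounded_continuous01:
  fixes g :: "real \<Rightarrow> 'a::euclidean_space"
  assumes "continuous_on {0..1} g" obtains c where "0 \<le> c" "\<And>x. x \<in> {0..1} \<Longrightarrow> norm (g x) \<le> c"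
proof -
  have "bounded (g ` {0..1})"
    using compact_continuous_image[OF assms compact_Icc] compact_imp_bounded by blast
  then obtain c where "\<forall>y\<in>g ` {0..1}. norm y \<le> c" by (auto simp: bounded_iff)
  then show ?thesis using that[of "max 0 c"] by force
qed

lemma smooth01_bounded:
  fixes g :: "real \<Rightarrow> 'a::euclidean_space"
  assumes "smooth01 g" obtains c where "0 \<le> c" "\<And>x. x \<in> {0..1} \<Longrightarrow> norm (g x) \<le> c"
  by (rule bounded_continuous01[OF smooth01_continuous[OF assms]]) (rule that)

lemma smooth01_const [simp]: 
  fixes c :: "'a::euclidean_space" shows "smooth01 (\<lambda>x. c)"
  unfolding smooth01_iff_Ck using Ck_const by blast

lemma smooth01_add:
  fixes g :: "real \<Rightarrow> 'a::euclidean_space"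
  shows "smooth01 f \<Longrightarrow> smooth01 g \<Longrightarrow> smooth01 (\<lambda>x. f x + g x)"
  unfolding smooth01_iff_Ck using Ck_add by blast

lemma smooth01_scaleR:
  fixes g :: "real \<Rightarrow> 'a::euclidean_space"
  shows "smooth01 f \<Longrightarrow> smooth01 g \<Longrightarrow> smooth01 (\<lambda>x. f x *\<^sub>R g x)"
  unfolding smooth01_iff_Ck using Ck_scaleR by blast

lemma smooth01_mult:
  fixes g :: "real \<Rightarrow> real"
  shows "smooth01 f \<Longrightarrow> smooth01 g \<Longrightarrow> smooth01 (\<lambda>x. f x * g x)"
  using smooth01_scaleR[of f g] by simp

lemma smooth01_of_deriv:
  fixes g :: "real \<Rightarrow> 'a::euclidean_space"
  assumes "\<And>x. x \<in> {0..1} \<Longrightarrow> (g has_vector_derivative g' x) (at x within {0..1})" "smooth01 g'"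
  shows "smooth01 g"
  unfolding smooth01_iff_Ck
proof
  fix m show "Ck m g"
  proof (cases m)
    case (Suc n)
    then show ?thesis using assms unfolding smooth01_iff_Ck by (auto intro!: exI[of _ g'])
  qed (use assms(1) continuous_on_vector_derivative[of "{0..1}" g g'] in simp)
qed

lemma smooth01_power: "smooth01 (\<lambda>x. (x - y) ^ n :: real)"
proof (induction n)
  case (Suc n)
  have "smooth01 (\<lambda>x. x - y)"
    by (rule smooth01_of_deriv[of _ "\<lambda>x. 1"]) (auto intro!: derivative_eq_intros)
  then show ?case using smooth01_mult Suc by simp
qed simp

lemma deriv01_lincomb:
  fixes f g :: "real \<Rightarrow> 'a::euclidean_space"
  assumes "smooth01 f" "smooth01 g" "x \<in> {0..1}"
  shows "(deriv01 ^^ n) (\<lambda>x. c *\<^sub>R f x + d *\<^sub>R g x) x = c *\<^sub>R (deriv01 ^^ n) f x + d *\<^sub>R (deriv01 ^^ n) g x"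
  using assms
proof (induction n arbitrary: f g x)
  case (Suc n)
  have "deriv01 (\<lambda>x. c *\<^sub>R f x + d *\<^sub>R g x) t = c *\<^sub>R deriv01 f t + d *\<^sub>R deriv01 g t" if t: "t \<in> {0..1}" for t
  proof (rule deriv01_eq[OF _ t], rule has_vector_derivative_add)
    show "((\<lambda>x. c *\<^sub>R f x) has_vector_derivative c *\<^sub>R deriv01 f t) (at t within {0..1})"
      "((\<lambda>x. d *\<^sub>R g x) has_vector_derivative d *\<^sub>R deriv01 g t) (at t within {0..1})"
      using smooth01_deriv(2)[OF Suc.prems(1) t] smooth01_deriv(2)[OF Suc.prems(2) t]
      by (auto intro: bounded_linear.has_vector_derivative[OF bounded_linear_scaleR_right])
  qed
  then have "(deriv01 ^^ n) (deriv01 (\<lambda>x. c *\<^sub>R f x + d *\<^sub>R g x)) x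
      = (deriv01 ^^ n) (\<lambda>x. c *\<^sub>R deriv01 f x + d *\<^sub>R deriv01 g x) x"
    using Suc.prems(3) by (rule deriv01_iter_cong)
  also have "\<dots> = c *\<^sub>R (deriv01 ^^ n) (deriv01 f) x + d *\<^sub>R (deriv01 ^^ n) (deriv01 g) x"
    using Suc.prems by (intro Suc.IH smooth01_deriv(1))
  finally show ?case by (simp add: funpow_swap1)
qed simp

section \<open>Primitives of integrable functions\<close>

text \<open>Absolute continuity: \<open>v\<close> is the almost everywhere derivative of \<open>u\<close>. The values of \<open>u\<close> matter at every
  point of the interval, those of \<open>v\<close> only almost everywhere.\<close>
definition prim :: "(real \<Rightarrow> complex) \<Rightarrow> (real \<Rightarrow> complex) \<Rightarrow> bool" where
  "prim u v \<longleftrightarrow> integrable leb01 v \<and> (\<forall>x\<in>{0..1}. integral {0..x} v = u x - u 0)"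

lemma prim_integrable: "prim u v \<Longrightarrow> integrable leb01 v"
  by (simp add: prim_def)

lemma prim_eq: "prim u v \<Longrightarrow> x \<in> {0..1} \<Longrightarrow> u x = u 0 + integral {0..x} v"
  by (simp add: prim_def)

lemma integrable_leb01_iff:
  fixes v :: "real \<Rightarrow> 'a::euclidean_space"
  shows "integrable leb01 v \<longleftrightarrow> v absolutely_integrable_on {0..1}"
  by (simp add: set_integrable_def integrable_restrict_space)

lemma integrable_sub01:
  fixes v :: "real \<Rightarrow> 'a::euclidean_space"
  assumes "integrable leb01 v" "0 \<le> a" "b \<le> 1"
  shows "v integrable_on {a..b}" "(\<lambda>x. norm (v x)) integrable_on {a..b}"
proof -
  have "v absolutely_integrable_on {a..b}"
    using set_integrable_subset[of lebesgue "{0..1}" v "{a..b}"] assms integrable_leb01_iff by auto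
  then show "v integrable_on {a..b}" "(\<lambda>x. norm (v x)) integrable_on {a..b}"
    by (auto simp: absolutely_integrable_on_def)
qed

lemma integral_diff01:
  fixes v :: "real \<Rightarrow> 'a::euclidean_space"
  assumes "integrable leb01 v" "0 \<le> a" "a \<le> b" "b \<le> 1"
  shows "integral {0..b} v - integral {0..a} v = integral {a..b} v"
  using Henstock_Kurzweil_Integration.integral_combine[of 0 a b v] integrable_sub01[of v 0 b] assms
  by (simp add: algebra_simps)

lemma integral_norm_le01:
  fixes v :: "real \<Rightarrow> 'a::euclidean_space"
  assumes "integrable leb01 v" "0 \<le> a" "b \<le> 1"
  shows "norm (integral {a..b} v) \<le> integral {a..b} (\<lambda>x. norm (v x))"
  using integrable_sub01[OF assms] by (intro integral_norm_bound_integral) auto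

lemma integral_norm_le_L1:
  fixes v :: "real \<Rightarrow> 'a::euclidean_space"
  assumes "integrable leb01 v" "0 \<le> a" "b \<le> 1"
  shows "norm (integral {a..b} v) \<le> (LINT x|leb01. norm (v x))"
proof -
  have "integral {a..b} (\<lambda>x. norm (v x)) \<le> integral {0..1} (\<lambda>x. norm (v x))"
    using assms by (intro integral_subset_le integrable_sub01) auto
  also have "\<dots> = (LINT x|leb01. norm (v x))"
    using assms by (intro lebesgue_integral_eq_integral[symmetric]) auto
  finally show ?thesis using integral_norm_le01[OF assms] by simp
qed

lemma integral_AE01:
  fixes v :: "real \<Rightarrow> 'a::euclidean_space"
  assumes ae: "AE x in leb01. v x = w x" and "0 \<le> a" "b \<le> 1"
  shows "integral {a..b} v = integral {a..b} w"
proof -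
  have "AE x in lebesgue. x \<in> {0..1} \<longrightarrow> v x = w x"
    using ae by (simp add: AE_restrict_space_iff)
  then have "negligible {x. \<not> (x \<in> {0..1} \<longrightarrow> v x = w x)}"
    unfolding eventually_ae_filter negligible_iff_null_sets
    by (auto intro: completion.complete2)
  then show ?thesis
    by (rule integral_spike) (use assms in auto)
qed

lemma integrable_AE01:
  fixes v :: "real \<Rightarrow> 'a::euclidean_space"
  assumes "integrable leb01 v" "AE x in leb01. v x = w x" shows "integrable leb01 w"
  using borel_measurable_leb01_AE[of v w] assms
  by (intro integrable_cong_AE_imp[OF assms(1)]) auto

lemma prim_cong:
  assumes "prim u v" "\<And>x. x \<in> {0..1} \<Longrightarrow> u x = u' x" "AE x in leb01. v x = v' x"
  shows "prim u' v'"
  unfolding prim_def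
proof (intro conjI ballI)
  show "integrable leb01 v'" using integrable_AE01[OF prim_integrable[OF assms(1)] assms(3)] .
  fix x :: real assume x: "x \<in> {0..1}"
  show "integral {0..x} v' = u' x - u' 0"
    using prim_eq[OF assms(1) x] assms(2)[OF x] assms(2)[of 0] integral_AE01[OF assms(3), of 0 x] x by simp
qed

lemma prim_diff:
  assumes "prim u v" "0 \<le> a" "a \<le> b" "b \<le> 1"
  shows "u b - u a = integral {a..b} v"
proof -
  have "a \<in> {0..1}" "b \<in> {0..1}" using assms by auto
  from this[THEN prim_eq[OF assms(1)]] show ?thesis
    using integral_diff01[OF prim_integrable[OF assms(1)] assms(2-)] by (simp add: algebra_simps)
qed

lemma prim_continuous:
  assumes "prim u v" shows "continuous_on {0..1} u"
proof -
  have "continuous_on {0..1} (\<lambda>x. u 0 + integral {0..x} v)"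
    using integrable_sub01[OF prim_integrable[OF assms], of 0 1]
    by (intro continuous_intros indefinite_integral_continuous_1) auto
  then show ?thesis
    by (rule continuous_on_eq) (rule prim_eq[OF assms, symmetric])
qed

lemma prim_lincomb:
  assumes "prim u v" "prim u' v'"
  shows "prim (\<lambda>x. c * u x + d * u' x) (\<lambda>x. c * v x + d * v' x)"
proof -
  have *: "integral {0..x} (\<lambda>t. c * v t + d * v' t) = c * integral {0..x} v + d * integral {0..x} v'"
    if "x \<in> {0..1}" for x
    using that integrable_sub01(1)[OF prim_integrable[OF assms(1)], of 0 x]
      integrable_sub01(1)[OF prim_integrable[OF assms(2)], of 0 x]
    by (intro integral_unique has_integral_add has_integral_mult_right integrable_integral) simp_all
  show ?thesis
    unfolding prim_def
  proof (intro conjI ballI)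
    show "integrable leb01 (\<lambda>x. c * v x + d * v' x)"
      using prim_integrable[OF assms(1)] prim_integrable[OF assms(2)] by simp
    fix x :: real assume x: "x \<in> {0..1}"
    show "integral {0..x} (\<lambda>x. c * v x + d * v' x) = c * u x + d * u' x - (c * u 0 + d * u' 0)"
      unfolding *[OF x] prim_eq[OF assms(1) x] prim_eq[OF assms(2) x] by (simp add: distrib_left)
  qed
qed

lemma prim_add: "prim u v \<Longrightarrow> prim u' v' \<Longrightarrow> prim (\<lambda>x. u x + u' x) (\<lambda>x. v x + v' x)"
  using prim_lincomb[of u v u' v' 1 1] by simp

lemma prim_const: "prim (\<lambda>x. c) (\<lambda>x. 0)"
  by (simp add: prim_def)

lemma prim_FTC:
  assumes "\<And>x. x \<in> {0..1} \<Longrightarrow> (u has_vector_derivative v x) (at x within {0..1})" "continuous_on {0..1} v"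
  shows "prim u v"
  unfolding prim_def
proof (intro conjI ballI)
  show "integrable leb01 v"
    using assms(2) by (simp add: integrable_leb01_iff absolutely_integrable_continuous_real)
  fix x :: real assume x: "x \<in> {0..1}"
  have "(v has_integral u x - u 0) {0..x}"
    using x by (intro fundamental_theorem_of_calculus has_vector_derivative_within_subset[OF assms(1)]) auto
  then show "integral {0..x} v = u x - u 0" by (simp add: integral_unique)
qed

lemma prim_deriv:
  assumes "prim u v" "continuous_on {0..1} v" "x \<in> {0..1}"
  shows "(u has_vector_derivative v x) (at x within {0..1})" "deriv01 u x = v x"
proof -
  have "((\<lambda>x. u 0 + integral {0..x} v) has_vector_derivative 0 + v x) (at x within {0..1})"
    using assms by (intro has_vector_derivative_add integral_has_vector_derivative) auto
  then show d: "(u has_vector_derivative v x) (at x within {0..1})"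
    using has_vector_derivative01_cong[of u "\<lambda>x. u 0 + integral {0..x} v" x "v x", OF prim_eq[OF assms(1)] assms(3)]
    by (simp only: add_0_left)
  show "deriv01 u x = v x" using deriv01_eq[OF d assms(3)] .
qed

lemma integrable_continuous01:
  fixes v :: "real \<Rightarrow> 'a::euclidean_space"
  shows "continuous_on {0..1} v \<Longrightarrow> integrable leb01 v"
  by (simp add: integrable_leb01_iff absolutely_integrable_continuous_real)

lemma integrable_scaleR01:
  fixes g :: "real \<Rightarrow> real" and v :: "real \<Rightarrow> 'a::euclidean_space"
  assumes g: "continuous_on {0..1} g" and v: "integrable leb01 v"
  shows "integrable leb01 (\<lambda>x. g x *\<^sub>R v x)"
proof -
  obtain c where c: "0 \<le> c" "\<And>x. x \<in> {0..1} \<Longrightarrow> norm (g x) \<le> c"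
    by (rule bounded_continuous01[OF g]) blast
  have [measurable]: "g \<in> borel_measurable leb01" "v \<in> borel_measurable leb01"
    using continuous_measurable01[OF g] borel_measurable_integrable[OF v] .
  show ?thesis
  proof (rule Bochner_Integration.integrable_bound)
    show "integrable leb01 (\<lambda>x. c * norm (v x))" using v by simp
    show "AE x in leb01. norm (g x *\<^sub>R v x) \<le> norm (c * norm (v x))"
      using c by (intro AE_leb01_I) (auto simp: abs_mult intro!: mult_right_mono)
  qed measurable
qed

text \<open>The defect \<open>D\<close> of the product rule satisfies
  \<open>\<bar>D b - D a\<bar> \<le> C (b - a) (W b - W a)\<close> with \<open>W\<close> the primitive of \<open>\<bar>v\<bar>\<close>; as \<open>W\<close> is continuous,
  \<open>D\<close> has derivative zero at every point, although \<open>u\<close> is differentiable only almost everywhere.\<close>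
lemma prim_scaleR:
  assumes uv: "prim u v" and g: "smooth01 g"
  shows "prim (\<lambda>x. g x *\<^sub>R u x) (\<lambda>x. deriv01 g x *\<^sub>R u x + g x *\<^sub>R v x)" (is "prim ?p ?h")
proof -
  obtain L where L: "0 \<le> L" "\<And>x. x \<in> {0..1} \<Longrightarrow> norm (deriv01 g x) \<le> L"
    by (rule smooth01_bounded[OF smooth01_deriv(1)[OF g]]) blast
  note vi = prim_integrable[OF uv]
  have hi: "integrable leb01 ?h"
    by (intro Bochner_Integration.integrable_add integrable_scaleR01 smooth01_continuous g smooth01_deriv(1) vi
        integrable_continuous01[OF prim_continuous[OF uv]])
  define W where "W x = integral {0..x} (\<lambda>t. norm (v t))" for x
  define D where "D x = ?p x - integral {0..x} ?h" for x
  have W_cont: "continuous_on {0..1} W"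
    unfolding W_def using integrable_sub01(2)[OF vi, of 0 1]
    by (intro indefinite_integral_continuous_1) auto
  have W_diff: "W b - W a = integral {a..b} (\<lambda>t. norm (v t))" if "0 \<le> a" "a \<le> b" "b \<le> 1" for a b
    unfolding W_def using integral_diff01[of "\<lambda>t. norm (v t)" a b] vi that by simp
  have g_int: "(deriv01 g has_integral g b - g a) {a..b}" if "0 \<le> a" "a \<le> b" "b \<le> 1" for a b
    using that by (intro fundamental_theorem_of_calculus
        has_vector_derivative_within_subset[OF smooth01_deriv(2)[OF g]]) auto
  have key: "norm (D b - D a) \<le> 2 * L * (W b - W a) * (b - a)" if ab: "0 \<le> a" "a \<le> b" "b \<le> 1" for a b
  proof -
    have W_mono: "W b - W s \<le> W b - W a" "0 \<le> W b - W s" if "s \<in> {a..b}" for s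
    proof -
      have "0 \<le> W s - W a" using W_diff[of a s] that ab by (simp add: integral_nonneg integrable_sub01[OF vi])
      then show "W b - W s \<le> W b - W a" by simp
      show "0 \<le> W b - W s" using W_diff[of s b] that ab by (simp add: integral_nonneg integrable_sub01[OF vi])
    qed
    have "((\<lambda>s. deriv01 g s *\<^sub>R u b + g a *\<^sub>R v s - ?h s) has_integral
        (g b - g a) *\<^sub>R u b + g a *\<^sub>R (u b - u a) - integral {a..b} ?h) {a..b}"
      using integrable_sub01(1)[OF vi, of a b] integrable_sub01(1)[OF hi, of a b] ab prim_diff[OF uv ab]
      by (intro has_integral_diff has_integral_add has_integral_scaleR_left has_integral_cmul g_int)
        (auto simp: integrable_integral)
    moreover have "(g b - g a) *\<^sub>R u b + g a *\<^sub>R (u b - u a) - integral {a..b} ?h = D b - D a"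
      unfolding D_def using integral_diff01[OF hi ab] by (simp add: algebra_simps)
    moreover have "deriv01 g s *\<^sub>R u b + g a *\<^sub>R v s - ?h s
        = deriv01 g s *\<^sub>R (u b - u s) + (g a - g s) *\<^sub>R v s" for s
      by (simp add: algebra_simps)
    ultimately have i: "((\<lambda>s. deriv01 g s *\<^sub>R (u b - u s) + (g a - g s) *\<^sub>R v s) has_integral D b - D a) {a..b}"
      by (simp only:)
    have j: "((\<lambda>s. L * (W b - W a) + L * (b - a) * norm (v s)) has_integral
        L * (W b - W a) * (b - a) + L * (b - a) * (W b - W a)) {a..b}"
      using integrable_sub01(2)[OF vi, of a b] ab has_integral_const_real[of "L * (W b - W a)" a b]
      by (intro has_integral_add has_integral_mult_right) (auto simp: W_diff[OF ab] integrable_integral mult.commute)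
    have le: "norm (deriv01 g s *\<^sub>R (u b - u s) + (g a - g s) *\<^sub>R v s)
        \<le> L * (W b - W a) + L * (b - a) * norm (v s)" if s: "s \<in> {a..b}" for s
    proof -
      have s01: "s \<in> {0..1}" using s ab by auto
      have "norm (u b - u s) \<le> W b - W s"
        using prim_diff[OF uv, of s b] integral_norm_le01[OF vi, of s b] W_diff[of s b] s ab by auto
      then have 1: "norm (deriv01 g s *\<^sub>R (u b - u s)) \<le> L * (W b - W a)"
        using L(1) L(2)[OF s01] W_mono[OF s] by (auto intro!: mult_mono)
      have "norm (g s - g a) \<le> L * measure lborel {a..s}"
        using s ab by (intro has_integral_bound_real[OF L(1) finite.emptyI g_int] L(2)) auto
      then have "norm (g a - g s) \<le> L * (s - a)" using s by (simp add: norm_minus_commute)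
      also have "\<dots> \<le> L * (b - a)" using s L(1) by (intro mult_left_mono) auto
      finally have 2: "norm ((g a - g s) *\<^sub>R v s) \<le> L * (b - a) * norm (v s)"
        by (simp add: mult_right_mono)
      show ?thesis using 1 2 norm_triangle_le by (smt (verit) norm_triangle_ineq)
    qed
    have "norm (integral {a..b} (\<lambda>s. deriv01 g s *\<^sub>R (u b - u s) + (g a - g s) *\<^sub>R v s))
      \<le> integral {a..b} (\<lambda>s. L * (W b - W a) + L * (b - a) * norm (v s))"
      using i j le by (intro integral_norm_bound_integral) (auto simp: integrable_on_def)
    then show ?thesis
      unfolding integral_unique[OF i] integral_unique[OF j] by (simp add: algebra_simps)
  qed
  have key2: "norm (D y - D x) \<le> 2 * L * norm (W y - W x) * norm (y - x)" if "x \<in> {0..1}" "y \<in> {0..1}" for x y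
  proof -
    have *: "2 * L * (W y - W x) * (y - x) \<le> 2 * L * norm (W y - W x) * norm (y - x)"
      if "x \<le> y" for x y
      using that L(1) by (simp add: mult_left_mono mult_right_mono)
    show ?thesis
    proof (cases "x \<le> y")
      case True with key[of x y] *[of x y] that show ?thesis by auto
    next
      case False with key[of y x] *[of y x] that show ?thesis by (auto simp: norm_minus_commute abs_minus_commute)
    qed
  qed
  have "(D has_derivative (\<lambda>h. 0)) (at x within {0..1})" if x: "x \<in> {0..1}" for x
    unfolding has_derivative_within_alt
  proof (intro conjI allI impI)
    fix e :: real assume e: "0 < e"
    then have "0 < e / (2 * L + 1)" using L(1) by simp
    then obtain d where d: "0 < d" "\<And>y. y \<in> {0..1} \<Longrightarrow> dist y x < d \<Longrightarrow> dist (W y) (W x) < e / (2 * L + 1)"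
      using W_cont x unfolding continuous_on_iff by meson
    show "\<exists>d>0. \<forall>y\<in>{0..1}. norm (y - x) < d \<longrightarrow> norm (D y - D x - 0) \<le> e * norm (y - x)"
    proof (intro exI conjI ballI impI)
      fix y :: real assume y: "y \<in> {0..1}" "norm (y - x) < d"
      have "2 * L * norm (W y - W x) \<le> 2 * L * (e / (2 * L + 1))"
        using d(2)[OF y(1)] y(2) L(1) by (intro mult_left_mono) (auto simp: dist_norm)
      also have "\<dots> \<le> e" using L(1) e by (simp add: field_simps)
      finally have "2 * L * norm (W y - W x) * norm (y - x) \<le> e * norm (y - x)"
        by (rule mult_right_mono) simp
      with key2[OF x y(1)] show "norm (D y - D x - 0) \<le> e * norm (y - x)" by simp
    qed (use d in simp)
  qed simp
  then obtain c where c: "\<And>x. x \<in> {0..1} \<Longrightarrow> D x = c"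
    using has_derivative_zero_constant[of "{0..1}" D] by auto
  show ?thesis
    unfolding prim_def
  proof (intro conjI ballI hi)
    fix x :: real assume "x \<in> {0..1}"
    then have "D x = D 0" using c[of x] c[of 0] by simp
    then show "integral {0..x} ?h = ?p x - ?p 0" by (simp add: D_def algebra_simps)
  qed
qed

lemma integral_indicator01:
  fixes f :: "real \<Rightarrow> complex"
  assumes f: "integrable leb01 f" and S: "S \<in> sets lebesgue" "S \<subseteq> {0..1}"
  shows "(LINT t|leb01. (indicator S t :: real) *\<^sub>R f t) = integral S f"
proof -
  have "integrable leb01 (\<lambda>t. (indicator S t :: real) *\<^sub>R f t)"
    using f by (intro integrable_mult_indicator) (use S in \<open>auto simp: sets_restrict_space_iff\<close>)
  then have "(LINT t|leb01. (indicator S t :: real) *\<^sub>R f t)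
      = integral {0..1} (\<lambda>t. (indicator S t :: real) *\<^sub>R f t)"
    by (intro lebesgue_integral_eq_integral) auto
  also have "\<dots> = integral {0..1} (\<lambda>t. if t \<in> S then f t else 0)"
    by (intro Henstock_Kurzweil_Integration.integral_cong) (auto simp: indicator_def)
  also have "\<dots> = integral S f"
    using S Henstock_Kurzweil_Integration.integral_restrict_Int[of "{0..1}" S f]
    by (simp add: Int_absorb2)
  finally show ?thesis .
qed

lemma AE_leb01_negligible:
  assumes "negligible N" "\<And>x. x \<in> {0..1} - N \<Longrightarrow> P x" shows "AE x in leb01. P x"
proof -
  have "AE x in lebesgue. x \<notin> N"
    using assms(1) by (simp add: negligible_iff_null_sets AE_not_in)
  then have "AE x in lebesgue. x \<in> {0..1} \<longrightarrow> P x"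
    by (rule eventually_mono) (use assms(2) in auto)
  then show ?thesis by (simp add: AE_restrict_space_iff)
qed

text \<open>Almost every point is a Lebesgue point.\<close>
lemma zero_integrals_imp_AE_zero:
  fixes w :: "real \<Rightarrow> complex"
  assumes w: "integrable leb01 w"
    and zero: "\<And>a b. 0 < a \<Longrightarrow> a < b \<Longrightarrow> b < 1 \<Longrightarrow> integral {a..b} w = 0"
  shows "AE x in leb01. w x = 0"
proof -
  define f where "f x = (if x \<in> {0..1} then w x else 0)" for x
  have "f absolutely_integrable_on UNIV"
    unfolding f_def using w absolutely_integrable_restrict_UNIV integrable_leb01_iff by blast
  then have "f absolutely_integrable_on cbox a b" for a b
    by (rule set_integrable_subset) auto
  then have "f integrable_on cbox a b" for a b
    by (simp add: absolutely_integrable_on_def)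
  then obtain N where N: "negligible N" "\<And>x e. x \<notin> N \<Longrightarrow> 0 < e \<Longrightarrow>
      \<exists>d>0. \<forall>h. 0 < h \<and> h < d \<longrightarrow> norm (integral (cbox x (x + h *\<^sub>R One)) f /\<^sub>R h ^ DIM(real) - f x) < e"
    using integrable_ccontinuous_explicit by blast
  show ?thesis
  proof (rule AE_leb01_negligible)
    show "negligible (N \<union> {0, 1})" using N(1) by (simp add: negligible_Un)
    fix x assume x: "x \<in> {0..1} - (N \<union> {0, 1})"
    then have x01: "0 < x" "x < 1" "x \<notin> N" by auto
    have "norm (w x) < e" if e: "0 < e" for e
    proof -
      obtain d where d: "0 < d"
        "\<And>h. 0 < h \<Longrightarrow> h < d \<Longrightarrow> norm (integral (cbox x (x + h *\<^sub>R One)) f /\<^sub>R h ^ DIM(real) - f x) < e"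
        using N(2)[OF x01(3) e] by blast
      define h where "h = min d (1 - x) / 2"
      have h: "0 < h" "h < d" "x + h < 1" using d(1) x01 by (auto simp: h_def min_def field_simps)
      have "integral {x..x + h} f = integral {x..x + h} w"
        using x01 h by (intro Henstock_Kurzweil_Integration.integral_cong) (auto simp: f_def)
      also have "\<dots> = 0" using zero[of x "x + h"] x01 h by simp
      finally show ?thesis using d(2)[OF h(1,2)] x01 by (simp add: f_def)
    qed
    then show "w x = 0" by (metis less_irrefl zero_less_norm_iff)
  qed
qed

lemma prim_unique:
  assumes "prim u v" "prim u w" shows "AE x in leb01. v x = w x"
proof -
  have "AE x in leb01. v x - w x = 0"
  proof (rule zero_integrals_imp_AE_zero)
    show "integrable leb01 (\<lambda>x. v x - w x)"
      using assms[THEN prim_integrable] by simp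
    fix a b :: real assume ab: "0 < a" "a < b" "b < 1"
    then show "integral {a..b} (\<lambda>x. v x - w x) = 0"
      using prim_diff[OF assms(1), of a b] prim_diff[OF assms(2), of a b]
        integrable_sub01(1)[OF prim_integrable[OF assms(1)], of a b]
        integrable_sub01(1)[OF prim_integrable[OF assms(2)], of a b]
      by (simp add: Henstock_Kurzweil_Integration.integral_diff)
  qed
  then show ?thesis by simp
qed

text \<open>Point values of continuous representatives are well defined.\<close>
lemma AE_eq_continuous01:
  fixes u v :: "real \<Rightarrow> complex"
  assumes "continuous_on {0..1} u" "continuous_on {0..1} v" "AE x in leb01. u x = v x" "x \<in> {0..1}"
  shows "u x = v x"
proof -
  define w where "w x = u x - v x" for x
  have w: "continuous_on {0..1} w" unfolding w_def using assms by (intro continuous_intros)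
  have "AE x in leb01. w x = 0" using assms(3) by (simp add: w_def)
  then have z: "integral {0..x} w = 0" if "x \<in> {0..1}" for x
    using integral_AE01[of w "\<lambda>x. 0" 0 x] that by simp
  have "((\<lambda>x. integral {0..x} w) has_vector_derivative w x) (at x within {0..1})"
    using integral_has_vector_derivative[OF w assms(4)] .
  then have "((\<lambda>x. 0) has_vector_derivative w x) (at x within {0..1})"
    using has_vector_derivative01_cong[of "\<lambda>x. integral {0..x} w" "\<lambda>x. 0" x, OF z assms(4)] by blast
  then have "w x = 0"
    using deriv01_eq[of "\<lambda>x. 0 :: complex", OF _ assms(4)] deriv01_eq[of "\<lambda>x. 0 :: complex" 0 x, OF _ assms(4)]
    by (metis has_vector_derivative_const)
  then show ?thesis by (simp add: w_def)
qed

text \<open>The oriented integral from \<open>y\<close> to \<open>x\<close>, for two points of the unit interval.\<close>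
definition J :: "real \<Rightarrow> (real \<Rightarrow> complex) \<Rightarrow> real \<Rightarrow> complex" where
  "J y u x = integral {0..x} u - integral {0..y} u"

lemma J_base [simp]: "J y u y = 0"
  by (simp add: J_def)

lemma prim_J: "integrable leb01 u \<Longrightarrow> prim (J y u) u"
  by (simp add: prim_def J_def)

lemma J_prim:
  assumes "prim u v" "x \<in> {0..1}" "y \<in> {0..1}" shows "J y v x = u x - u y"
  unfolding J_def using prim_eq[OF assms(1) assms(2)] prim_eq[OF assms(1) assms(3)] by (simp only: add_diff_cancel_left)

lemma J_bound:
  assumes "integrable leb01 u" "x \<in> {0..1}" "y \<in> {0..1}"
  shows "norm (J y u x) \<le> (LINT t|leb01. norm (u t))"
proof (cases "y \<le> x")
  case True
  then have "J y u x = integral {y..x} u"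
    unfolding J_def using assms by (intro integral_diff01) auto
  then show ?thesis using integral_norm_le_L1[OF assms(1), of y x] assms by simp
next
  case False
  then have "J y u x = - integral {x..y} u"
    unfolding J_def using integral_diff01[OF assms(1), of x y] assms by (simp add: algebra_simps)
  then show ?thesis using integral_norm_le_L1[OF assms(1), of x y] assms by simp
qed

lemma J_lincomb:
  assumes "integrable leb01 u" "integrable leb01 v" "x \<in> {0..1}" "y \<in> {0..1}"
  shows "J y (\<lambda>x. c * u x + d * v x) x = c * J y u x + d * J y v x"
  using J_prim[OF prim_lincomb[OF prim_J[OF assms(1), of y] prim_J[OF assms(2), of y]] assms(3,4)]
  by simp

lemma J_cong:
  assumes "AE x in leb01. u x = v x" "x \<in> {0..1}" "y \<in> {0..1}"
  shows "J y u x = J y v x"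
  unfolding J_def using integral_AE01[OF assms(1)] assms by simp

section \<open>Sobolev balls with and without boundary conditions\<close>

text \<open>Balls of \<open>H\<^sup>m\<close>, made of continuous representatives if \<open>m > 0\<close>. The norm is the maximum of the suprema of the
  derivatives of order below \<open>m\<close> and of the \<open>L\<^sup>2\<close> norm of the one of order \<open>m\<close>; by the Sobolev
  embedding it is equivalent to the usual one, and it is inherited by the derivative, so that bounds follow
  by induction on \<open>m\<close>. The flag \<open>Z\<close> demands that the derivatives of order below \<open>m\<close> vanish at both end
  points: with it, every estimate is at the same time a statement about flat functions.\<close>
fun jet_ball :: "bool \<Rightarrow> nat \<Rightarrow> (real \<Rightarrow> complex) \<Rightarrow> real \<Rightarrow> bool" where
  "jet_ball Z 0 u M \<longleftrightarrow> u \<in> L2 \<and> L2_norm u \<le> M"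
| "jet_ball Z (Suc m) u M \<longleftrightarrow> (\<exists>v. prim u v \<and> jet_ball Z m v M) \<and>
     (\<forall>x\<in>{0..1}. norm (u x) \<le> M) \<and> (Z \<longrightarrow> u 0 = 0 \<and> u 1 = 0)"

lemma jet_ball_SucI:
  assumes "prim u v" "jet_ball Z m v M" "\<And>x. x \<in> {0..1} \<Longrightarrow> norm (u x) \<le> M"
    "Z \<Longrightarrow> u 0 = 0" "Z \<Longrightarrow> u 1 = 0"
  shows "jet_ball Z (Suc m) u M"
  using assms unfolding jet_ball.simps by blast

lemma jet_ball_SucE:
  assumes "jet_ball Z (Suc m) u M"
  obtains v where "prim u v" "jet_ball Z m v M" "\<And>x. x \<in> {0..1} \<Longrightarrow> norm (u x) \<le> M"
    "Z \<Longrightarrow> u 0 = 0" "Z \<Longrightarrow> u 1 = 0"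
  using assms unfolding jet_ball.simps by blast

lemma jet_ball_nonneg: "jet_ball Z m u M \<Longrightarrow> 0 \<le> M"
proof (induction m arbitrary: u)
  case 0 then show ?case using L2_norm_nonneg[of u] by simp
qed (blast elim: jet_ball_SucE)

lemma jet_ball_mono: "jet_ball Z m u M \<Longrightarrow> M \<le> M' \<Longrightarrow> jet_ball Z m u M'"
proof (induction m arbitrary: u)
  case (Suc m)
  from Suc.prems(1) show ?case
    by (rule jet_ball_SucE) (rule jet_ball_SucI, use Suc in \<open>auto intro: order_trans\<close>)
qed auto

lemma jet_ball_L2:
  "jet_ball Z m u M \<Longrightarrow> u \<in> L2 \<and> L2_norm u \<le> M"
proof (cases m)
  case (Suc n)
  assume "jet_ball Z m u M"
  then have u: "jet_ball Z (Suc n) u M" using Suc by simp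
  then obtain v where v: "prim u v" "\<And>x. x \<in> {0..1} \<Longrightarrow> norm (u x) \<le> M"
    by (rule jet_ball_SucE) blast
  have "u \<in> borel_measurable leb01" using continuous_measurable01[OF prim_continuous[OF v(1)]] .
  then show ?thesis
    using L2_bounded[of u M] v(2) jet_ball_nonneg[OF u] AE_leb01_I[of "\<lambda>x. norm (u x) \<le> M"] by blast
qed simp

lemma jet_ball_Suc: "jet_ball Z (Suc m) u M \<Longrightarrow> jet_ball Z m u M"
proof (induction m arbitrary: u)
  case 0 then show ?case using jet_ball_L2[of Z "Suc 0" u M] by simp
next
  case (Suc m)
  from Suc.prems show ?case
    by (rule jet_ball_SucE) (rule jet_ball_SucI, use Suc.IH in auto)
qed

lemma jet_ball_le: "jet_ball Z m u M \<Longrightarrow> n \<le> m \<Longrightarrow> jet_ball Z n u M"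
proof (induction m)
  case (Suc m) then show ?case using jet_ball_Suc by (cases "n = Suc m") auto
qed simp

lemma jet_ball_forget: "jet_ball Z m u M \<Longrightarrow> jet_ball False m u M"
proof (induction m arbitrary: u)
  case (Suc m)
  from Suc.prems show ?case
    by (rule jet_ball_SucE) (rule jet_ball_SucI, use Suc.IH in auto)
qed simp

lemma jet_ball_continuous: "jet_ball Z m u M \<Longrightarrow> 0 < m \<Longrightarrow> continuous_on {0..1} u"
  using prim_continuous by (cases m) (auto elim: jet_ball_SucE simp del: jet_ball.simps)

lemma jet_ball_bound: "jet_ball Z m u M \<Longrightarrow> 0 < m \<Longrightarrow> x \<in> {0..1} \<Longrightarrow> norm (u x) \<le> M"
  by (cases m) auto

lemma jet_ball_integrable: "jet_ball Z m u M \<Longrightarrow> integrable leb01 u"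
  using jet_ball_L2 L2_integrable by blast

lemma jet_ball_L1: "jet_ball Z m u M \<Longrightarrow> (LINT x|leb01. norm (u x)) \<le> M"
  using jet_ball_L2[of Z m u M] L1_le_L2[of u] by simp

lemma jet_ball_cong:
  assumes u: "jet_ball Z m u M" and eq: "\<And>x. x \<in> {0..1} \<Longrightarrow> u x = v x"
  shows "jet_ball Z m v M"
proof (cases m)
  case 0 then show ?thesis using u L2_AE[of u v] AE_leb01_I[of "\<lambda>x. u x = v x"] eq by auto
next
  case (Suc n)
  with u have "jet_ball Z (Suc n) u M" by simp
  then obtain u' where u': "prim u u'" "jet_ball Z n u' M" "\<And>x. x \<in> {0..1} \<Longrightarrow> norm (u x) \<le> M"
    "Z \<Longrightarrow> u 0 = 0" "Z \<Longrightarrow> u 1 = 0"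
    by (rule jet_ball_SucE) blast
  show ?thesis
    unfolding Suc using u' prim_cong[OF u'(1) eq, of u'] eq[symmetric]
    by (intro jet_ball_SucI[of v u']) auto
qed

lemma jet_ball_add:
  "jet_ball Z m u M \<Longrightarrow> jet_ball Z m v N \<Longrightarrow> jet_ball Z m (\<lambda>x. u x + v x) (M + N)"
proof (induction m arbitrary: u v)
  case 0 then show ?case using L2_add[of u v] by auto
next
  case (Suc m)
  obtain u' where u': "prim u u'" "jet_ball Z m u' M" "\<And>x. x \<in> {0..1} \<Longrightarrow> norm (u x) \<le> M"
      "Z \<Longrightarrow> u 0 = 0" "Z \<Longrightarrow> u 1 = 0"
    using Suc.prems(1) by (rule jet_ball_SucE) blast
  obtain v' where v': "prim v v'" "jet_ball Z m v' N" "\<And>x. x \<in> {0..1} \<Longrightarrow> norm (v x) \<le> N"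
      "Z \<Longrightarrow> v 0 = 0" "Z \<Longrightarrow> v 1 = 0"
    using Suc.prems(2) by (rule jet_ball_SucE) blast
  show ?case
    using u' v' Suc.IH[OF u'(2) v'(2)] prim_add[OF u'(1) v'(1)]
    by (intro jet_ball_SucI[of _ "\<lambda>x. u' x + v' x"]) (auto intro: norm_triangle_mono)
qed

lemma jet_ball_scale: "jet_ball Z m u M \<Longrightarrow> jet_ball Z m (\<lambda>x. c * u x) (norm c * M)"
proof (induction m arbitrary: u)
  case 0 then show ?case using L2_scale[of u c] by (auto intro: mult_left_mono)
next
  case (Suc m)
  obtain u' where u': "prim u u'" "jet_ball Z m u' M" "\<And>x. x \<in> {0..1} \<Longrightarrow> norm (u x) \<le> M"
      "Z \<Longrightarrow> u 0 = 0" "Z \<Longrightarrow> u 1 = 0"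
    using Suc.prems(1) by (rule jet_ball_SucE) blast
  show ?case
    using u' Suc.IH[OF u'(2)] prim_lincomb[OF u'(1) u'(1), of c 0]
    by (intro jet_ball_SucI[of _ "\<lambda>x. c * u' x"]) (auto simp: norm_mult intro: mult_left_mono)
qed

lemma jet_ball_zero: "jet_ball Z m (\<lambda>x. 0) 0"
  by (induction m) (auto simp: L2_zero prim_const intro!: exI[of _ "\<lambda>x. 0"])

lemma jet_ball_diff:
  "jet_ball Z m u M \<Longrightarrow> jet_ball Z m v N \<Longrightarrow> jet_ball Z m (\<lambda>x. u x - v x) (M + N)"
  using jet_ball_add[of Z m u M "\<lambda>x. -1 * v x" N] jet_ball_scale[of Z m v N "-1"] by simp

lemma jet_ball_sum:
  "finite I \<Longrightarrow> (\<And>i. i \<in> I \<Longrightarrow> jet_ball Z m (u i) (M i)) \<Longrightarrow> jet_ball Z m (\<lambda>x. \<Sum>i\<in>I. u i x) (\<Sum>i\<in>I. M i)"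
  by (induction I rule: finite_induct) (auto simp: jet_ball_zero intro!: jet_ball_add simp del: jet_ball.simps)

lemma jet_ball_const: "jet_ball False m (\<lambda>x. c) (norm c)"
proof (cases m)
  case 0 then show ?thesis
    using L2_bounded[of "\<lambda>x. c" "norm c"] AE_leb01_I[of "\<lambda>x. norm c \<le> norm c"] by auto
next
  case (Suc n)
  then show ?thesis using prim_const[of c] jet_ball_mono[OF jet_ball_zero[of False n], of "norm c"]
    by (auto intro!: jet_ball_SucI simp del: jet_ball.simps)
qed

text \<open>With \<open>Z\<close>, boundedness includes that flat functions are mapped to flat functions.\<close>
definition bounded_op :: "bool \<Rightarrow> nat \<Rightarrow> nat \<Rightarrow> ((real \<Rightarrow> complex) \<Rightarrow> (real \<Rightarrow> complex)) \<Rightarrow> bool" where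
  "bounded_op Z m n T \<longleftrightarrow> (\<exists>c\<ge>0. \<forall>u M. jet_ball Z m u M \<longrightarrow> jet_ball Z n (T u) (c * M))"

lemma bounded_opE:
  assumes "bounded_op Z m n T"
  obtains c where "0 \<le> c" "\<And>u M. jet_ball Z m u M \<Longrightarrow> jet_ball Z n (T u) (c * M)"
  using assms unfolding bounded_op_def by blast

lemma bounded_opI:
  "0 \<le> c \<Longrightarrow> (\<And>u M. jet_ball Z m u M \<Longrightarrow> jet_ball Z n (T u) (c * M)) \<Longrightarrow> bounded_op Z m n T"
  unfolding bounded_op_def by blast

lemma bounded_op_image: "bounded_op Z m n T \<Longrightarrow> jet_ball Z m u M \<Longrightarrow> \<exists>N. jet_ball Z n (T u) N"
  unfolding bounded_op_def by blast

lemma bounded_op_L2: "bounded_op Z m n T \<Longrightarrow> jet_ball Z m u M \<Longrightarrow> T u \<in> L2"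
  using bounded_op_image jet_ball_L2 by blast

lemma bounded_op_add:
  assumes "bounded_op Z m n S" "bounded_op Z m n T"
  shows "bounded_op Z m n (\<lambda>u x. S u x + T u x)"
proof -
  obtain c where c: "0 \<le> c" "\<And>u M. jet_ball Z m u M \<Longrightarrow> jet_ball Z n (S u) (c * M)"
    using assms(1) by (rule bounded_opE) blast
  obtain d where d: "0 \<le> d" "\<And>u M. jet_ball Z m u M \<Longrightarrow> jet_ball Z n (T u) (d * M)"
    using assms(2) by (rule bounded_opE) blast
  show ?thesis
  proof (rule bounded_opI[of "c + d"])
    fix u M assume u: "jet_ball Z m u M"
    show "jet_ball Z n (\<lambda>x. S u x + T u x) ((c + d) * M)"
      using jet_ball_add[OF c(2)[OF u] d(2)[OF u]] by (simp add: distrib_right)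
  qed (use c d in simp)
qed

lemma bounded_op_compose:
  assumes "bounded_op Z m n S" "bounded_op Z n l T" shows "bounded_op Z m l (\<lambda>u. T (S u))"
proof -
  obtain c where c: "0 \<le> c" "\<And>u M. jet_ball Z m u M \<Longrightarrow> jet_ball Z n (S u) (c * M)"
    using assms(1) by (rule bounded_opE) blast
  obtain d where d: "0 \<le> d" "\<And>u M. jet_ball Z n u M \<Longrightarrow> jet_ball Z l (T u) (d * M)"
    using assms(2) by (rule bounded_opE) blast
  show ?thesis
    using c(1) d(1) d(2)[OF c(2)] by (intro bounded_opI[of "d * c"]) (auto simp: mult.assoc)
qed

lemma bounded_op_mono:
  assumes "bounded_op Z m n T" "m \<le> m'" "n' \<le> n" shows "bounded_op Z m' n' T"
  using assms jet_ball_le unfolding bounded_op_def by blast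

lemma bounded_op_scaleR:
  assumes "smooth01 g" shows "bounded_op Z m m (\<lambda>u x. g x *\<^sub>R u x)"
  using assms
proof (induction m arbitrary: g)
  case 0
  obtain c where c: "0 \<le> c" "\<And>x. x \<in> {0..1} \<Longrightarrow> norm (g x) \<le> c"
    by (rule smooth01_bounded[OF 0]) blast
  have m: "(\<lambda>x. complex_of_real (g x)) \<in> borel_measurable leb01"
    using smooth01_continuous[OF 0] by (intro continuous_measurable01 continuous_intros)
  show ?case
  proof (rule bounded_opI[OF c(1)])
    fix u M assume "jet_ball Z 0 u M"
    then have u: "u \<in> L2" "L2_norm u \<le> M" by auto
    have "L2_norm (\<lambda>x. complex_of_real (g x) * u x) \<le> c * L2_norm u"
      "(\<lambda>x. complex_of_real (g x) * u x) \<in> L2"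
      using L2_mult[OF u(1) m _ c(1)] c(2) by auto
    moreover have "c * L2_norm u \<le> c * M" using u c by (intro mult_left_mono)
    ultimately show "jet_ball Z 0 (\<lambda>x. g x *\<^sub>R u x) (c * M)" by (simp add: scaleR_conv_of_real)
  qed
next
  case (Suc m)
  obtain b where b: "0 \<le> b" "\<And>x. x \<in> {0..1} \<Longrightarrow> norm (g x) \<le> b"
    by (rule smooth01_bounded[OF Suc.prems]) blast
  obtain c where c: "0 \<le> c" "\<And>u M. jet_ball Z m u M \<Longrightarrow> jet_ball Z m (\<lambda>x. g x *\<^sub>R u x) (c * M)"
    using Suc.IH[OF Suc.prems] by (rule bounded_opE) blast
  obtain d where d: "0 \<le> d" "\<And>u M. jet_ball Z m u M \<Longrightarrow> jet_ball Z m (\<lambda>x. deriv01 g x *\<^sub>R u x) (d * M)"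
    using Suc.IH[OF smooth01_deriv(1)[OF Suc.prems]] by (rule bounded_opE) blast
  show ?case
  proof (rule bounded_opI[of "b + c + d"])
    fix u M assume u0: "jet_ball Z (Suc m) u M"
    obtain v where v: "prim u v" "jet_ball Z m v M" "\<And>x. x \<in> {0..1} \<Longrightarrow> norm (u x) \<le> M"
        "Z \<Longrightarrow> u 0 = 0" "Z \<Longrightarrow> u 1 = 0"
      using u0 by (rule jet_ball_SucE) blast
    have M: "0 \<le> M" using jet_ball_nonneg[OF u0] .
    show "jet_ball Z (Suc m) (\<lambda>x. g x *\<^sub>R u x) ((b + c + d) * M)"
    proof (rule jet_ball_SucI[OF prim_scaleR[OF v(1) Suc.prems]])
      have "jet_ball Z m (\<lambda>x. deriv01 g x *\<^sub>R u x + g x *\<^sub>R v x) (d * M + c * M)"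
        using jet_ball_add[OF d(2)[OF jet_ball_Suc[OF u0]] c(2)[OF v(2)]] .
      then show "jet_ball Z m (\<lambda>x. deriv01 g x *\<^sub>R u x + g x *\<^sub>R v x) ((b + c + d) * M)"
        by (rule jet_ball_mono) (use b M in \<open>simp add: algebra_simps\<close>)
      fix x :: real assume x: "x \<in> {0..1}"
      have "norm (g x *\<^sub>R u x) \<le> b * M" using b(2)[OF x] v(3)[OF x] b(1) by (auto intro!: mult_mono)
      also have "\<dots> \<le> (b + c + d) * M" using c d M by (intro mult_right_mono) auto
      finally show "norm (g x *\<^sub>R u x) \<le> (b + c + d) * M" .
    qed (use v in auto)
  qed (use b c d in simp)
qed

lemma jet_ball_smooth:
  assumes "smooth01 g" shows "\<exists>M. jet_ball False m (\<lambda>x. complex_of_real (g x)) M"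
proof -
  obtain c where "\<And>u M. jet_ball False m u M \<Longrightarrow> jet_ball False m (\<lambda>x. g x *\<^sub>R u x) (c * M)"
    using bounded_op_scaleR[OF assms] by (rule bounded_opE) blast
  from this[OF jet_ball_const[of m 1]] show ?thesis by (auto simp: scaleR_conv_of_real)
qed

text \<open>Termwise integration of the series of derivatives, which converges in \<open>L\<^sup>1\<close>.\<close>
lemma prim_suminf:
  assumes p: "\<And>n. prim (u n) (v n)" and v: "\<And>n. v n \<in> L2" "\<And>n. L2_norm (v n) \<le> a n"
    and u: "\<And>n x. x \<in> {0..1} \<Longrightarrow> norm (u n x) \<le> a n" and a: "summable a"
  shows "prim (\<lambda>x. \<Sum>n. u n x) (\<lambda>x. \<Sum>n. v n x)"
proof -
  have su: "summable (\<lambda>n. u n x)" if "x \<in> {0..1}" for x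
    by (rule summable_comparison_test'[OF a, of 0]) (use u[OF that] in simp)
  have L1: "(LINT t|leb01. norm (v n t)) \<le> a n" for n using L1_le_L2[OF v(1)] v(2) by (rule order_trans)
  have ae: "AE x in leb01. summable (\<lambda>n. norm (v n x))"
    using L2_suminf(1)[OF v a] .
  have i: "integrable leb01 (v n)" for n using prim_integrable[OF p] .
  show ?thesis
    unfolding prim_def
  proof (intro conjI ballI)
    show vi: "integrable leb01 (\<lambda>x. \<Sum>n. v n x)"
      using L2_integrable[OF L2_suminf(2)[OF v a]] .
    fix x :: real assume x: "x \<in> {0..1}"
    define w where "w n t = (indicator {0..x} t :: real) *\<^sub>R v n t" for n t
    have int_eq: "integral {0..x} f = (LINT t|leb01. (indicator {0..x} t :: real) *\<^sub>R f t)"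
      if "integrable leb01 f" for f :: "real \<Rightarrow> complex"
      using integral_indicator01[OF that, of "{0..x}"] x by simp
    have wi: "integrable leb01 (w n)" for n
      unfolding w_def by (intro integrable_mult_indicator i) (use x in \<open>auto simp: sets_restrict_space_iff\<close>)
    have wL1: "(LINT t|leb01. norm (w n t)) \<le> a n" for n
    proof -
      have "(LINT t|leb01. norm (w n t)) \<le> (LINT t|leb01. norm (v n t))"
        by (rule integral_mono[OF integrable_norm[OF wi] integrable_norm[OF i]]) (auto simp: w_def indicator_def)
      then show ?thesis using L1[of n] by simp
    qed
    have "integral {0..x} (\<lambda>t. \<Sum>n. v n t) = (LINT t|leb01. (indicator {0..x} t :: real) *\<^sub>R (\<Sum>n. v n t))"
      using int_eq[OF vi] .
    also have "\<dots> = (LINT t|leb01. (\<Sum>n. w n t))"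
      by (intro Bochner_Integration.integral_cong) (auto simp: w_def indicator_def)
    also have "\<dots> = (\<Sum>n. LINT t|leb01. w n t)"
    proof (rule integral_suminf[OF wi])
      show "AE t in leb01. summable (\<lambda>n. norm (w n t))"
        using ae by (rule eventually_mono) (auto simp: w_def indicator_def)
      show "summable (\<lambda>n. LINT t|leb01. norm (w n t))"
        by (rule summable_comparison_test'[OF a, of 0]) (use wL1 in simp)
    qed
    also have "\<dots> = (\<Sum>n. u n x - u n 0)"
      using prim_eq[OF p x] int_eq[OF i] by (simp add: w_def)
    also have "\<dots> = (\<Sum>n. u n x) - (\<Sum>n. u n 0)"
      using su[OF x] su[of 0] by (simp add: suminf_diff)
    finally show "integral {0..x} (\<lambda>t. \<Sum>n. v n t) = (\<Sum>n. u n x) - (\<Sum>n. u n 0)" .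
  qed
qed

text \<open>This stands in for the completeness of \<open>H\<^sup>m\<close>, and of its subspace of flat functions.\<close>
lemma jet_ball_suminf:
  assumes "\<And>n. jet_ball Z m (u n) (a n)" "summable a"
  shows "jet_ball Z m (\<lambda>x. \<Sum>n. u n x) (suminf a)"
  using assms
proof (induction m arbitrary: u)
  case 0
  then show ?case using L2_suminf(2,3)[of u a] by auto
next
  case (Suc m)
  have "\<forall>n. \<exists>v. prim (u n) v \<and> jet_ball Z m v (a n)"
    using Suc.prems(1) by (meson jet_ball_SucE)
  then obtain v where v: "\<And>n. prim (u n) (v n)" "\<And>n. jet_ball Z m (v n) (a n)" by metis
  have le: "norm (u n x) \<le> a n" if "x \<in> {0..1}" for n x
    using jet_ball_bound[OF Suc.prems(1)] that by simp
  show ?case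
  proof (rule jet_ball_SucI)
    show "prim (\<lambda>x. \<Sum>n. u n x) (\<lambda>x. \<Sum>n. v n x)"
      using jet_ball_L2[OF v(2)] le Suc.prems(2) by (intro prim_suminf[OF v(1), where a = a]) auto
    show "jet_ball Z m (\<lambda>x. \<Sum>n. v n x) (suminf a)" using Suc.IH[OF v(2) Suc.prems(2)] .
    fix x :: real assume x: "x \<in> {0..1}"
    have s: "summable (\<lambda>n. norm (u n x))"
      by (rule summable_comparison_test'[OF Suc.prems(2), of 0]) (use le[OF x] in simp)
    have "norm (\<Sum>n. u n x) \<le> (\<Sum>n. norm (u n x))" by (rule summable_norm[OF s])
    also have "\<dots> \<le> suminf a" by (rule suminf_le[OF le[OF x] s Suc.prems(2)])
    finally show "norm (\<Sum>n. u n x) \<le> suminf a" .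
  qed (use Suc.prems(1) in auto)
qed

section \<open>Iterated integrals\<close>

lemma interval_integral_J:
  assumes f: "integrable leb01 f" and xy: "x \<in> {0..1}" "y \<in> {0..1}"
  shows "(LINT z=y..x|lebesgue. f z) = J y f x"
proof -
  have *: "(LINT z:einterval (ereal a) (ereal b)|lebesgue. f z) = J a f b"
    if ab: "0 \<le> a" "a \<le> b" "b \<le> 1" for a b
  proof -
    have "f absolutely_integrable_on {a..b}"
      using set_integrable_subset[of lebesgue "{0..1}" f "{a..b}"] f integrable_leb01_iff ab by auto
    then have "f absolutely_integrable_on {a<..<b}"
      by (rule set_integrable_subset) auto
    then have "(LINT z:{a<..<b}|lebesgue. f z) = integral {a<..<b} f"
      by (rule set_lebesgue_integral_eq_integral(2))
    also have "\<dots> = integral {a..b} f" by (simp add: integral_open_interval_real)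
    also have "\<dots> = J a f b" unfolding J_def using integral_diff01[OF f ab] by simp
    finally show ?thesis by simp
  qed
  show ?thesis
  proof (cases "y \<le> x")
    case True
    then show ?thesis using *[of y x] xy by (simp add: interval_lebesgue_integral_le_eq)
  next
    case False
    then have "(LINT z=y..x|lebesgue. f z) = - J x f y"
      using *[of x y] xy by (simp add: interval_lebesgue_integral_gt_eq)
    then show ?thesis by (simp add: J_def)
  qed
qed

text \<open>Integrating by parts moves one power of the kernel \<open>(x - z)\<^sup>n\<close> into one more integration.\<close>
lemma iter_int_Suc:
  assumes u: "integrable leb01 u" and xy: "x \<in> {0..1}" "y \<in> {0..1}"
  shows "iter_int (Suc (Suc n)) y u x = iter_int (Suc n) y (J y u) x"
proof -
  let ?g = "\<lambda>z. (x - z) ^ Suc n"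
  have d: "(?g has_vector_derivative - (real (Suc n) * (x - z) ^ n)) (at z within {0..1})" for z
    by (auto intro!: derivative_eq_intros simp del: power_Suc simp flip: has_real_derivative_iff_has_vector_derivative)
  have sm: "smooth01 (\<lambda>z. (x - z) ^ m)" for m
  proof -
    have "smooth01 (\<lambda>z. (-1) ^ m * (z - x) ^ m)" by (intro smooth01_mult smooth01_power smooth01_const)
    then show ?thesis by (simp flip: power_mult_distrib)
  qed
  have Ju: "continuous_on {0..1} (J y u)" using prim_continuous[OF prim_J[OF u]] .
  have i1: "integrable leb01 (\<lambda>z. (x - z) ^ m *\<^sub>R u z)" "integrable leb01 (\<lambda>z. (x - z) ^ m *\<^sub>R J y u z)" for m
    using smooth01_continuous[OF sm] u integrable_continuous01[OF Ju] by (auto intro: integrable_scaleR01)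
  have "prim (\<lambda>z. ?g z *\<^sub>R J y u z) (\<lambda>z. deriv01 ?g z *\<^sub>R J y u z + ?g z *\<^sub>R u z)"
    using prim_scaleR[OF prim_J[OF u] sm] .
  then have "prim (\<lambda>z. ?g z *\<^sub>R J y u z)
      (\<lambda>z. complex_of_real (- real (Suc n)) * ((x - z) ^ n *\<^sub>R J y u z) + 1 * (?g z *\<^sub>R u z))"
    by (rule prim_cong) (auto intro!: AE_leb01_I simp: deriv01_eq[OF d] scaleR_conv_of_real simp del: power_Suc of_nat_Suc)
  from J_prim[OF this xy]
  have "J y (\<lambda>z. complex_of_real (- real (Suc n)) * ((x - z) ^ n *\<^sub>R J y u z) + 1 * (?g z *\<^sub>R u z)) x = 0"
    by simp
  then have "J y (\<lambda>z. ?g z *\<^sub>R u z) x = of_real (real (Suc n)) * J y (\<lambda>z. (x - z) ^ n *\<^sub>R J y u z) x"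
    using J_lincomb[OF i1(2)[of n] i1(1)[of "Suc n"] xy, of "complex_of_real (- real (Suc n))" 1]
    by (simp add: algebra_simps)
  moreover have "complex_of_real (real (Suc n)) / of_real (fact (Suc n)) = 1 / of_real (fact n)"
    by (simp add: divide_simps del: of_nat_Suc)
  ultimately show ?thesis
    unfolding iter_int_def diff_Suc_1
      interval_integral_J[OF i1(1) xy] interval_integral_J[OF i1(2) xy]
    by (simp add: scaleR_conv_of_real del: of_nat_Suc power_Suc)
qed

lemma integrable_J_iter: "integrable leb01 u \<Longrightarrow> integrable leb01 ((J y ^^ n) u)"
  by (induction n) (auto intro: integrable_continuous01 prim_continuous prim_J)

text \<open>Cauchy's formula for repeated integration.\<close>
lemma iter_int_eq_J_iter:
  assumes "integrable leb01 u" "x \<in> {0..1}" "y \<in> {0..1}"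
  shows "iter_int (Suc n) y u x = (J y ^^ Suc n) u x"
  using assms
proof (induction n arbitrary: u)
  case 0
  then show ?case by (simp add: iter_int_def interval_integral_J)
next
  case (Suc n)
  have "iter_int (Suc (Suc n)) y u x = (J y ^^ Suc n) (J y u) x"
    using Suc.IH[of "J y u"] integrable_J_iter[OF Suc.prems(1), of 1 y] Suc.prems iter_int_Suc by simp
  then show ?case by (simp only: funpow_Suc_right comp_apply)
qed

lemma J_iter_lincomb:
  assumes "integrable leb01 u" "integrable leb01 v" "x \<in> {0..1}" "y \<in> {0..1}"
  shows "(J y ^^ n) (\<lambda>x. c * u x + d * v x) x = c * (J y ^^ n) u x + d * (J y ^^ n) v x"
  using assms(3)
proof (induction n arbitrary: x)
  case (Suc n)
  have "J y ((J y ^^ n) (\<lambda>x. c * u x + d * v x)) x = J y (\<lambda>x. c * (J y ^^ n) u x + d * (J y ^^ n) v x) x"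
    using Suc assms(4) by (intro J_cong AE_leb01_I) auto
  also have "\<dots> = c * J y ((J y ^^ n) u) x + d * J y ((J y ^^ n) v) x"
    using assms Suc.prems by (intro J_lincomb integrable_J_iter)
  finally show ?case by simp
qed simp

lemma bounded_op_J_iter:
  assumes y: "y \<in> {0..1}" shows "bounded_op Z 0 0 (J y ^^ n)"
proof (induction n)
  case 0 then show ?case by (intro bounded_opI[of 1]) (auto simp: id_def)
next
  case (Suc n)
  have "bounded_op Z 0 0 (J y)"
  proof (rule bounded_opI[of 1])
    fix u M assume u: "jet_ball Z 0 u M"
    have "norm (J y u x) \<le> M" if "x \<in> {0..1}" for x
      using J_bound[OF jet_ball_integrable[OF u] that y] jet_ball_L1[OF u] by simp
    then show "jet_ball Z 0 (J y u) (1 * M)"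
      using L2_bounded[OF continuous_measurable01[OF prim_continuous[OF prim_J[OF jet_ball_integrable[OF u]]]], of y M]
        jet_ball_nonneg[OF u] AE_leb01_I[of "\<lambda>x. norm (J y u x) \<le> M"] by simp
  qed simp
  from bounded_op_compose[OF Suc this] show ?case by (simp add: comp_def)
qed

text \<open>A coefficient attached to the base point \<open>y\<close> is flat at the other end point \<open>1 - y\<close>; so the product
  with an integral from \<open>y\<close> vanishes at both ends.\<close>
definition flat_coeff :: "real \<Rightarrow> (real \<Rightarrow> real) \<Rightarrow> bool" where
  "flat_coeff y f \<longleftrightarrow> smooth01 f \<and> (\<forall>i. (deriv01 ^^ i) f (1 - y) = 0)"

lemma flat_coeff_deriv: "flat_coeff y f \<Longrightarrow> flat_coeff y (deriv01 f)"
  unfolding flat_coeff_def using smooth01_deriv(1) by (metis comp_apply funpow_Suc_right)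

text \<open>The derivative of \<open>f J\<^bsup>n+1\<^esup> u\<close> is \<open>f' J\<^bsup>n+1\<^esup> u + f J\<^sup>n u\<close>, which has the same form; hence it suffices to bound all
  these operators without a gain, one order lower.\<close>
lemma J_iter_gain:
  assumes y: "y \<in> {0, 1}" and f: "flat_coeff y f"
    and b1: "bounded_op Z m m (\<lambda>u x. deriv01 f x *\<^sub>R (J y ^^ Suc n) u x)"
    and b2: "bounded_op Z m m (\<lambda>u x. f x *\<^sub>R (J y ^^ n) u x)"
  shows "bounded_op Z m (Suc m) (\<lambda>u x. f x *\<^sub>R (J y ^^ Suc n) u x)"
proof -
  have y01: "y \<in> {0..1}" using y by auto
  have sm: "smooth01 f" and f0: "f (1 - y) = 0"
    using f unfolding flat_coeff_def by (auto dest: spec[of _ 0])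
  obtain b where b: "0 \<le> b" "\<And>x. x \<in> {0..1} \<Longrightarrow> norm (f x) \<le> b"
    by (rule smooth01_bounded[OF sm]) blast
  obtain c where c: "0 \<le> c" "\<And>u M. jet_ball Z m u M \<Longrightarrow>
      jet_ball Z m (\<lambda>x. deriv01 f x *\<^sub>R (J y ^^ Suc n) u x + f x *\<^sub>R (J y ^^ n) u x) (c * M)"
    using bounded_op_add[OF b1 b2] by (rule bounded_opE) blast
  obtain d where d: "0 \<le> d" "\<And>u M. jet_ball Z 0 u M \<Longrightarrow> jet_ball Z 0 ((J y ^^ n) u) (d * M)"
    using bounded_op_J_iter[OF y01] by (rule bounded_opE) blast
  show ?thesis
  proof (rule bounded_opI[of "b * d + c"])
    fix u M assume u: "jet_ball Z m u M"
    have M: "0 \<le> M" using jet_ball_nonneg[OF u] .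
    have Jn: "jet_ball Z 0 ((J y ^^ n) u) (d * M)" using d(2)[OF jet_ball_le[OF u le0]] .
    have p: "prim ((J y ^^ Suc n) u) ((J y ^^ n) u)"
      using prim_J[OF jet_ball_integrable[OF Jn]] by simp
    show "jet_ball Z (Suc m) (\<lambda>x. f x *\<^sub>R (J y ^^ Suc n) u x) ((b * d + c) * M)"
    proof (rule jet_ball_SucI[OF prim_scaleR[OF p sm]])
      show "jet_ball Z m (\<lambda>x. deriv01 f x *\<^sub>R (J y ^^ Suc n) u x + f x *\<^sub>R (J y ^^ n) u x) ((b * d + c) * M)"
        by (rule jet_ball_mono[OF c(2)[OF u]]) (use b d M in \<open>simp add: distrib_right\<close>)
      fix x :: real assume x: "x \<in> {0..1}"
      have "norm ((J y ^^ Suc n) u x) \<le> d * M"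
        using J_bound[OF jet_ball_integrable[OF Jn] x y01] jet_ball_L1[OF Jn] by simp
      then have "norm (f x *\<^sub>R (J y ^^ Suc n) u x) \<le> b * (d * M)"
        unfolding norm_scaleR using b(1) b(2)[OF x] by (intro mult_mono) auto
      also have "\<dots> \<le> (b * d + c) * M" using c M by (simp add: distrib_right)
      finally show "norm (f x *\<^sub>R (J y ^^ Suc n) u x) \<le> (b * d + c) * M" .
    qed (use y f0 in auto)
  qed (use b c d in simp)
qed

lemma bounded_op_coeff_J_iter:
  assumes y: "y \<in> {0, 1}" and f: "flat_coeff y f"
  shows "bounded_op Z m m (\<lambda>u x. f x *\<^sub>R (J y ^^ n) u x)"
  using f
proof (induction m arbitrary: f n)
  case 0
  have "bounded_op Z 0 0 (J y ^^ n)" using bounded_op_J_iter y by auto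
  from bounded_op_compose[OF this bounded_op_scaleR[of f]] 0 show ?case by (simp add: flat_coeff_def)
next
  case (Suc m)
  show ?case
  proof (cases n)
    case 0 then show ?thesis using bounded_op_scaleR[of f] Suc.prems by (simp add: flat_coeff_def)
  next
    case (Suc k)
    have "bounded_op Z m (Suc m) (\<lambda>u x. f x *\<^sub>R (J y ^^ Suc k) u x)"
      using J_iter_gain[OF y Suc.prems Suc.IH[OF flat_coeff_deriv[OF Suc.prems]] Suc.IH[OF Suc.prems]] .
    then show ?thesis unfolding Suc using bounded_op_mono[of Z m "Suc m" _ "Suc m" "Suc m"] by simp
  qed
qed

lemma smoothing_coeff_J_iter:
  assumes y: "y \<in> {0, 1}" and f: "flat_coeff y f"
  shows "bounded_op Z m (Suc m) (\<lambda>u x. f x *\<^sub>R (J y ^^ Suc n) u x)"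
  using J_iter_gain[OF y f bounded_op_coeff_J_iter[OF y flat_coeff_deriv[OF f]] bounded_op_coeff_J_iter[OF y f]] .

section \<open>Exponentials of smoothing operators\<close>

text \<open>\<open>e\<^bsup>-T\<^esup> e\<^sup>T = 1\<close> for a single orbit \<open>a n = T\<^sup>n u (x)\<close>. Collecting the terms with the same \<open>n + m\<close> in the absolutely
  convergent double series leaves alternating sums of binomial coefficients.\<close>
lemma exp_minus_exp_series:
  fixes a :: "nat \<Rightarrow> complex"
  assumes a: "\<And>n. norm (a n) \<le> A * c ^ n" and c: "0 \<le> c"
  shows "(\<Sum>n. ((-1) ^ n / fact n) * (\<Sum>m. (1 / fact m) * a (n + m))) = a 0"
proof -
  have A: "0 \<le> A" using order_trans[OF norm_ge_zero a[of 0]] by simp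
  define f where "f = (\<lambda>(n, m). ((-1) ^ n / fact n) * ((1 / fact m) * a (n + m)))"
  define g where "g n = c ^ n / fact n" for n :: nat
  have g0: "0 \<le> g n" for n using c by (simp add: g_def)
  have "g = (\<lambda>n. inverse (fact n) * c ^ n)" by (auto simp: g_def field_simps)
  then have sg: "summable g" using summable_exp[of c] by simp
  then have sg': "g summable_on UNIV" using g0 by (intro norm_summable_imp_summable_on) simp
  have nf: "norm (f (n, m)) \<le> A * (g n * g m)" for n m
  proof -
    have "norm (f (n, m)) = norm (a (n + m)) / (fact n * fact m)"
      by (simp add: f_def norm_mult norm_divide norm_power)
    also have "\<dots> \<le> (A * c ^ (n + m)) / (fact n * fact m)" by (intro divide_right_mono a) simp
    also have "\<dots> = A * (g n * g m)" by (simp add: g_def power_add)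
    finally show ?thesis .
  qed
  have sp: "(\<lambda>p. A * (g (fst p) * g (snd p))) summable_on (UNIV \<times> UNIV)"
  proof (rule summable_on_SigmaI)
    show "((\<lambda>m. A * (g (fst (n, m)) * g (snd (n, m)))) has_sum (A * (g n * infsum g UNIV))) UNIV" for n
      using has_sum_cmult_right[OF has_sum_infsum[OF sg'], of "A * g n"] by (simp add: mult.assoc)
    show "(\<lambda>n. A * (g n * infsum g UNIV)) summable_on UNIV"
      using summable_on_cmult_right[OF summable_on_cmult_left[OF sg'], of A "infsum g UNIV"] .
  qed (use g0 A in auto)
  have fs: "f summable_on (UNIV \<times> UNIV)"
    by (rule Infinite_Sum.abs_summable_summable, rule Infinite_Sum.abs_summable_on_comparison_test'[OF sp]) (use nf in auto)
  have inner: "(\<lambda>m. f (n, m)) summable_on UNIV" for n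
    using summable_on_SigmaD1[of "\<lambda>n m. f (n, m)" UNIV "\<lambda>_. UNIV" n] fs by simp
  have inf_sum: "infsum h UNIV = suminf h" if "h summable_on UNIV" for h :: "nat \<Rightarrow> complex"
    using has_sum_imp_sums[OF has_sum_infsum[OF that]] by (simp add: sums_iff)
  have "(\<lambda>n. infsum (\<lambda>m. f (n, m)) UNIV) summable_on UNIV"
    using summable_on_Sigma_banach[of "\<lambda>n m. f (n, m)" UNIV "\<lambda>_. UNIV"] fs by simp
  then have "infsum f (UNIV \<times> UNIV) = (\<Sum>n. infsum (\<lambda>m. f (n, m)) UNIV)"
    using infsum_Sigma_banach[OF fs] inf_sum by simp
  also have "\<dots> = (\<Sum>n. \<Sum>m. f (n, m))" by (simp add: inf_sum[OF inner])
  also have "\<dots> = (\<Sum>n. ((-1) ^ n / fact n) * (\<Sum>m. (1 / fact m) * a (n + m)))"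
  proof (rule suminf_cong)
    fix n
    have "summable (\<lambda>m. (1 / fact m) * a (n + m))"
    proof (rule summable_comparison_test')
      show "summable (\<lambda>m. A * c ^ n * g m)" using sg by (rule summable_mult)
      show "norm (1 / fact m * a (n + m)) \<le> A * c ^ n * g m" if "0 \<le> m" for m
        using a[of "n + m"] by (simp add: g_def norm_mult norm_divide power_add divide_right_mono)
    qed
    then show "(\<Sum>m. f (n, m)) = ((-1) ^ n / fact n) * (\<Sum>m. (1 / fact m) * a (n + m))"
      using suminf_mult[of "\<lambda>m. (1 / fact m) * a (n + m)" "(-1) ^ n / fact n"] by (simp only: f_def split)
  qed
  finally have 1: "infsum f (UNIV \<times> UNIV) = (\<Sum>n. ((-1) ^ n / fact n) * (\<Sum>m. (1 / fact m) * a (n + m)))" .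
  \<comment> \<open>The same double series, indexed by \<open>N = n + m\<close> and \<open>n\<close>.\<close>
  define h where "h = (\<lambda>(N, n). ((-1) ^ n / fact n) * ((1 / fact (N - n)) * a N))"
  have "f summable_on (UNIV \<times> UNIV) \<longleftrightarrow> h summable_on (Sigma UNIV (\<lambda>N. {..N}))"
    by (rule summable_on_reindex_bij_witness[of _ "\<lambda>(N, n). (n, N - n)" "\<lambda>(n, m). (n + m, n)"])
      (auto simp: f_def h_def)
  with fs have hs: "h summable_on (Sigma UNIV (\<lambda>N. {..N}))" by simp
  have "infsum f (UNIV \<times> UNIV) = infsum h (Sigma UNIV (\<lambda>N. {..N}))"
    by (rule infsum_reindex_bij_witness[of _ "\<lambda>(N, n). (n, N - n)" "\<lambda>(n, m). (n + m, n)"])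
      (auto simp: f_def h_def)
  also have "\<dots> = infsum (\<lambda>N. infsum (\<lambda>n. h (N, n)) {..N}) UNIV"
    by (rule infsum_Sigma_banach[OF hs, symmetric])
  also have "(\<lambda>N. infsum (\<lambda>n. h (N, n)) {..N}) = (\<lambda>N. if N = 0 then a 0 else 0)"
  proof
    fix N
    have "infsum (\<lambda>n. h (N, n)) {..N} = (\<Sum>n\<le>N. ((-1) ^ n / fact n) * ((1 / fact (N - n)) * a N))"
      by (simp add: h_def)
    also have "\<dots> = (\<Sum>n\<le>N. (-1) ^ n * of_nat (N choose n)) * (a N / fact N)"
      unfolding sum_distrib_right
      by (rule sum.cong) (auto simp: binomial_fact field_simps)
    also have "\<dots> = (if N = 0 then a 0 else 0)"
      using choose_alternating_sum[of N, where 'a = complex] by auto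
    finally show "infsum (\<lambda>n. h (N, n)) {..N} = (if N = 0 then a 0 else 0)" .
  qed
  also have "infsum (\<lambda>N::nat. if N = 0 then a 0 else 0) UNIV = a 0"
    using infsum_cong_neutral[of "{0}" UNIV "\<lambda>N::nat. if N = 0 then a 0 else 0" "\<lambda>N::nat. if N = 0 then a 0 else 0"]
    by simp
  finally show ?thesis using 1 by simp
qed

text \<open>The series of \<^const>\<open>op_exp\<close>, summed pointwise instead of in \<open>L\<^sup>2\<close>.\<close>
definition exp_series :: "((real \<Rightarrow> complex) \<Rightarrow> (real \<Rightarrow> complex)) \<Rightarrow> (real \<Rightarrow> complex) \<Rightarrow> real \<Rightarrow> complex" where
  "exp_series T u x = (\<Sum>n. (1 / fact n) *\<^sub>R (T ^^ n) u x)"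

lemma exp_scaled_sums:
  fixes b d M :: real
  shows "summable (\<lambda>n. b * (inverse (fact n) * d ^ n) * M)"
    "(\<Sum>n. b * (inverse (fact n) * d ^ n) * M) = b * exp d * M"
proof -
  have "(\<lambda>n. inverse (fact n) * d ^ n) sums exp d"
    using exp_converges[of d] by (simp add: scaleR_conv_of_real)
  then have "(\<lambda>n. b * (inverse (fact n) * d ^ n) * M) sums (b * exp d * M)"
    by (intro sums_mult sums_mult2)
  then show "summable (\<lambda>n. b * (inverse (fact n) * d ^ n) * M)"
    "(\<Sum>n. b * (inverse (fact n) * d ^ n) * M) = b * exp d * M"
    by (auto simp: sums_iff)
qed

text \<open>Geometric growth of the terms before division by \<open>n!\<close> makes the sum converge at every level of the scale.\<close>
lemma bounded_op_exp_sum: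
  assumes "0 \<le> b" "\<And>n u M. jet_ball Z m u M \<Longrightarrow> jet_ball Z m' (A n u) (b * d ^ n * M)"
  shows "bounded_op Z m m' (\<lambda>u x. \<Sum>n. (1 / fact n) *\<^sub>R A n u x)"
proof (rule bounded_opI[of "b * exp d"])
  fix u M assume u: "jet_ball Z m u M"
  have "jet_ball Z m' (\<lambda>x. (1 / fact n) *\<^sub>R A n u x) (b * (inverse (fact n) * d ^ n) * M)" for n
    using jet_ball_scale[OF assms(2)[OF u], of "1 / fact n" n]
    by (simp add: scaleR_conv_of_real norm_divide field_simps del: jet_ball.simps)
  from jet_ball_suminf[OF this exp_scaled_sums(1)]
  show "jet_ball Z m' (\<lambda>x. \<Sum>n. (1 / fact n) *\<^sub>R A n u x) (b * exp d * M)"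
    unfolding exp_scaled_sums(2) .
qed (use assms in simp)

lemma L2_norm_AE_zero:
  assumes "u \<in> L2" "v \<in> L2" "AE x in leb01. u x = v x"
  shows "L2_norm (\<lambda>x. u x - v x) = 0"
proof -
  have "AE x in leb01. 0 = u x - v x" using assms(3) by (rule eventually_mono) simp
  from L2_AE(2)[OF L2_zero(1) this] show ?thesis by (simp add: L2_zero)
qed

lemma L2_norm_zero_AE:
  assumes "u \<in> L2" "L2_norm u = 0" shows "AE x in leb01. u x = 0"
proof -
  have "(LINT x|leb01. (norm (u x))\<^sup>2) = 0" using assms(2) by (simp flip: L2_norm_square)
  then have "AE x in leb01. (norm (u x))\<^sup>2 = 0"
    using integral_nonneg_eq_0_iff_AE[OF L2_D(2)[OF assms(1)]] by simp
  then show ?thesis by (rule eventually_mono) simp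
qed

text \<open>The gain of one derivative makes \<open>T\<^sup>n u\<close>, \<open>n \<ge> 1\<close>, continuous and independent of the representative of
  \<open>u \<in> L\<^sup>2\<close>, so that the exponential series converges at every point.\<close>
locale smoothing =
  fixes T :: "(real \<Rightarrow> complex) \<Rightarrow> real \<Rightarrow> complex"
  assumes lincomb: "u \<in> L2 \<Longrightarrow> v \<in> L2 \<Longrightarrow> x \<in> {0..1} \<Longrightarrow> T (\<lambda>x. c * u x + d * v x) x = c * T u x + d * T v x"
    and gain: "bounded_op Z m (Suc m) T"
begin

lemma gain_const:
  obtains c where "0 \<le> c" "\<And>u M. jet_ball Z m u M \<Longrightarrow> jet_ball Z (Suc m) (T u) (c * M)"
  using gain by (rule bounded_opE) blast

lemma T_L2: assumes "u \<in> L2" shows "T u \<in> L2"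
proof -
  obtain c where c: "\<And>u M. jet_ball False 0 u M \<Longrightarrow> jet_ball False (Suc 0) (T u) (c * M)"
    by (rule gain_const[of False 0]) blast
  have "jet_ball False 0 u (L2_norm u)" using assms by simp
  from jet_ball_L2[OF c[OF this]] show ?thesis by simp
qed

lemma T_cong:
  assumes u: "u \<in> L2" and ae: "AE x in leb01. u x = v x" and x: "x \<in> {0..1}"
  shows "T u x = T v x"
proof -
  obtain c where c: "\<And>u M. jet_ball False 0 u M \<Longrightarrow> jet_ball False (Suc 0) (T u) (c * M)"
    by (rule gain_const[of False 0]) blast
  have v: "v \<in> L2" using L2_AE(1)[OF u ae] .
  have "jet_ball False 0 (\<lambda>x. 1 * u x + (-1) * v x) 0"
    using L2_diff[OF u v] L2_norm_AE_zero[OF u v ae] by simp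
  from jet_ball_bound[OF c[OF this] _ x] have "norm (T (\<lambda>x. 1 * u x + (-1) * v x) x) \<le> 0" by auto
  then have "T (\<lambda>x. 1 * u x + (-1) * v x) x = 0" by simp
  then show ?thesis using lincomb[OF u v x, of 1 "-1"] by simp
qed

lemma pow_L2: "u \<in> L2 \<Longrightarrow> (T ^^ n) u \<in> L2"
  by (induction n) (auto intro: T_L2)

lemma pow_lincomb:
  assumes "u \<in> L2" "v \<in> L2" "x \<in> {0..1}"
  shows "(T ^^ n) (\<lambda>x. c * u x + d * v x) x = c * (T ^^ n) u x + d * (T ^^ n) v x"
  using assms(3)
proof (induction n arbitrary: x)
  case (Suc n)
  have "T ((T ^^ n) (\<lambda>x. c * u x + d * v x)) x = T (\<lambda>x. c * (T ^^ n) u x + d * (T ^^ n) v x) x"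
    using Suc assms by (intro T_cong AE_leb01_I pow_L2 L2_lincomb)
  also have "\<dots> = c * T ((T ^^ n) u) x + d * T ((T ^^ n) v) x"
    using Suc.prems assms by (intro lincomb pow_L2)
  finally show ?case by simp
qed simp

lemma pow_cong:
  assumes u: "u \<in> L2" and ae: "AE x in leb01. u x = v x" and x: "x \<in> {0..1}"
  shows "(T ^^ Suc n) u x = (T ^^ Suc n) v x"
  using x
proof (induction n arbitrary: x)
  case 0 then show ?case using T_cong[OF u ae] by simp
next
  case (Suc n)
  have "T ((T ^^ Suc n) u) x = T ((T ^^ Suc n) v) x"
    using Suc.IH Suc.prems by (intro T_cong pow_L2 u AE_leb01_I)
  then show ?case by simp
qed

lemma pow_ball:
  assumes "0 \<le> c" "\<And>u M. jet_ball Z m u M \<Longrightarrow> jet_ball Z (Suc m) (T u) (c * M)" "jet_ball Z m u M"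
  shows "jet_ball Z m ((T ^^ n) u) (c ^ n * M)" "jet_ball Z (Suc m) ((T ^^ Suc n) u) (c ^ Suc n * M)"
proof -
  show *: "jet_ball Z m ((T ^^ n) u) (c ^ n * M)" for n
  proof (induction n)
    case (Suc n)
    from jet_ball_Suc[OF assms(2)[OF Suc]] show ?case by (simp add: mult.assoc)
  qed (use assms in simp)
  from assms(2)[OF *[of n]] show "jet_ball Z (Suc m) ((T ^^ Suc n) u) (c ^ Suc n * M)"
    by (simp add: mult.assoc)
qed

lemma pow_pointwise:
  assumes u: "u \<in> L2" and x: "x \<in> {0..1}"
  obtains A c where "0 \<le> c" "\<And>n. norm ((T ^^ n) u x) \<le> A * c ^ n"
proof -
  obtain c where c: "0 \<le> c" "\<And>u M. jet_ball False 0 u M \<Longrightarrow> jet_ball False (Suc 0) (T u) (c * M)"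
    by (rule gain_const[of False 0]) blast
  have "jet_ball False 0 u (L2_norm u)" using u by simp
  note b = pow_ball(2)[OF c this]
  have "norm ((T ^^ n) u x) \<le> (L2_norm u + norm (u x)) * c ^ n" for n
  proof (cases n)
    case (Suc k)
    have "norm ((T ^^ Suc k) u x) \<le> c ^ Suc k * L2_norm u" using jet_ball_bound[OF b _ x] by simp
    also have "\<dots> \<le> (L2_norm u + norm (u x)) * c ^ Suc k" using c(1) by (simp add: algebra_simps)
    finally show ?thesis unfolding Suc .
  qed (use L2_norm_nonneg[of u] in simp)
  then show ?thesis using that c(1) by blast
qed

lemma summable_series:
  assumes u: "u \<in> L2" and x: "x \<in> {0..1}"
  shows "summable (\<lambda>n. (1 / fact n) *\<^sub>R (T ^^ n) u x)"
proof -
  obtain A c where A: "0 \<le> c" "\<And>n. norm ((T ^^ n) u x) \<le> A * c ^ n"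
    by (rule pow_pointwise[OF u x]) blast
  have s: "summable (\<lambda>n. A * (inverse (fact n) * c ^ n))" by (intro summable_mult summable_exp)
  show ?thesis
  proof (rule summable_comparison_test'[OF s, of 0])
    fix n :: nat
    have "norm ((1 / fact n) *\<^sub>R (T ^^ n) u x) = inverse (fact n) * norm ((T ^^ n) u x)"
      by (simp add: divide_inverse)
    also have "\<dots> \<le> inverse (fact n) * (A * c ^ n)" by (rule mult_left_mono[OF A(2)]) simp
    also have "\<dots> = A * (inverse (fact n) * c ^ n)" by (rule mult.left_commute)
    finally show "norm ((1 / fact n) *\<^sub>R (T ^^ n) u x) \<le> A * (inverse (fact n) * c ^ n)" .
  qed
qed

lemma partial_sum_L2:
  assumes "u \<in> L2" shows "(\<lambda>x. \<Sum>n<N. (1 / fact n) *\<^sub>R (T ^^ n) u x) \<in> L2"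
  unfolding scaleR_conv_of_real by (intro L2_sum(1) L2_scale(1) pow_L2 assms) auto

lemma jet_ball_term:
  assumes "jet_ball Z m ((T ^^ n) u) (c ^ n * M)"
  shows "jet_ball Z m (\<lambda>x. (1 / fact n) *\<^sub>R (T ^^ n) u x) ((inverse (fact n) * c ^ n) * M)"
  using jet_ball_scale[OF assms, of "1 / fact n"] by (simp add: scaleR_conv_of_real norm_divide field_simps)

lemma exp_bounded: "bounded_op Z m m (exp_series T)"
proof -
  obtain c where c: "0 \<le> c" "\<And>u M. jet_ball Z m u M \<Longrightarrow> jet_ball Z (Suc m) (T u) (c * M)"
    by (rule gain_const) blast
  show ?thesis
    unfolding exp_series_def[abs_def]
    using pow_ball(1)[OF c] by (intro bounded_op_exp_sum[of 1 Z m m _ c]) auto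
qed

text \<open>All terms of the series but the first gain a derivative. So \<open>e\<^sup>T\<close> does not change the leading jet of a function
  whose lower jets vanish.\<close>
lemma exp_minus_id_gain: "bounded_op Z m (Suc m) (\<lambda>u x. exp_series T u x - u x)"
proof -
  obtain c where c: "0 \<le> c" "\<And>u M. jet_ball Z m u M \<Longrightarrow> jet_ball Z (Suc m) (T u) (c * M)"
    by (rule gain_const) blast
  define A where "A n u = (if n = 0 then (\<lambda>x. 0) else (T ^^ n) u)" for n u
  have "jet_ball Z (Suc m) (A n u) (1 * c ^ n * M)" if u: "jet_ball Z m u M" for n u M
  proof (cases n)
    case 0
    then show ?thesis using jet_ball_mono[OF jet_ball_zero] jet_ball_nonneg[OF u] by (simp add: A_def del: jet_ball.simps)
  next
    case (Suc k)
    then show ?thesis using pow_ball(2)[OF c u, of k] by (simp add: A_def del: jet_ball.simps funpow.simps)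
  qed
  then have "bounded_op Z m (Suc m) (\<lambda>u x. \<Sum>n. (1 / fact n) *\<^sub>R A n u x)"
    by (intro bounded_op_exp_sum[of 1 Z m "Suc m" A c]) auto
  then obtain C where C: "0 \<le> C" "\<forall>u M. jet_ball Z m u M \<longrightarrow>
      jet_ball Z (Suc m) (\<lambda>x. \<Sum>n. (1 / fact n) *\<^sub>R A n u x) (C * M)"
    unfolding bounded_op_def by blast
  show ?thesis
  proof (rule bounded_opI[OF C(1)], rule jet_ball_cong[OF C(2)[rule_format]])
    fix u M and x :: real assume u: "jet_ball Z m u M" and x: "x \<in> {0..1}"
    have s: "summable (\<lambda>n. (1 / fact n) *\<^sub>R (T ^^ n) u x)"
      using summable_series[OF _ x] jet_ball_L2[OF u] by blast
    have "summable (\<lambda>n. (1 / fact n) *\<^sub>R A n u x)"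
      using s by (subst summable_Suc_iff[symmetric], subst (asm) summable_Suc_iff[symmetric]) (simp add: A_def)
    from suminf_split_head[OF this] suminf_split_head[OF s]
    show "(\<Sum>n. (1 / fact n) *\<^sub>R A n u x) = exp_series T u x - u x"
      by (simp add: A_def exp_series_def)
  qed
qed

lemma exp_L2: assumes "u \<in> L2" shows "exp_series T u \<in> L2"
proof -
  obtain c where c: "\<And>u M. jet_ball False 0 u M \<Longrightarrow> jet_ball False 0 (exp_series T u) (c * M)"
    using exp_bounded by (rule bounded_opE) blast
  have "jet_ball False 0 u (L2_norm u)" using assms by simp
  from jet_ball_L2[OF c[OF this]] show ?thesis by simp
qed

lemma exp_lincomb:
  assumes u: "u \<in> L2" and v: "v \<in> L2" and x: "x \<in> {0..1}"
  shows "exp_series T (\<lambda>x. c * u x + d * v x) x = c * exp_series T u x + d * exp_series T v x"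
proof -
  have "(\<lambda>n. c * ((1 / fact n) *\<^sub>R (T ^^ n) u x) + d * ((1 / fact n) *\<^sub>R (T ^^ n) v x)) sums
      (c * exp_series T u x + d * exp_series T v x)"
    unfolding exp_series_def
    using summable_series[OF u x] summable_series[OF v x] by (intro sums_add sums_mult summable_sums)
  moreover have "c * ((1 / fact n) *\<^sub>R (T ^^ n) u x) + d * ((1 / fact n) *\<^sub>R (T ^^ n) v x)
      = (1 / fact n) *\<^sub>R (T ^^ n) (\<lambda>x. c * u x + d * v x) x" for n
    by (simp add: pow_lincomb[OF u v x] scaleR_add_right)
  ultimately show ?thesis by (simp add: exp_series_def sums_iff)
qed

lemma exp_cong:
  assumes u: "u \<in> L2" and ae: "AE x in leb01. u x = v x"
  shows "AE x in leb01. exp_series T u x = exp_series T v x"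
proof -
  have "AE x in leb01. x \<in> {0..1}" by (rule AE_leb01_I)
  with ae show ?thesis
  proof eventually_elim
    fix x assume x: "u x = v x" "x \<in> {0..1}"
    have "(T ^^ n) u x = (T ^^ n) v x" for n using pow_cong[OF u ae x(2)] x(1) by (cases n) auto
    then show "exp_series T u x = exp_series T v x" by (simp add: exp_series_def)
  qed
qed

text \<open>Convergence in \<open>L\<^sup>2\<close>: the tail of the series is again such a series.\<close>
lemma exp_partial_sums:
  assumes u: "u \<in> L2"
  shows "(\<lambda>N. L2_norm (\<lambda>x. (\<Sum>n<N. (1 / fact n) *\<^sub>R (T ^^ n) u x) - exp_series T u x)) \<longlonglongrightarrow> 0"
proof -
  obtain c where c: "0 \<le> c" "\<And>u M. jet_ball False 0 u M \<Longrightarrow> jet_ball False (Suc 0) (T u) (c * M)"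
    by (rule gain_const[of False 0]) blast
  define a where "a n = inverse (fact n) * c ^ n * L2_norm u" for n :: nat
  have a: "summable a" unfolding a_def by (intro summable_mult2 summable_exp)
  have u0: "jet_ball False 0 u (L2_norm u)" using u by simp
  have t: "jet_ball False 0 (\<lambda>x. (1 / fact n) *\<^sub>R (T ^^ n) u x) (a n)" for n
    unfolding a_def by (intro jet_ball_term pow_ball(1)[OF c u0])
  have le: "L2_norm (\<lambda>x. (\<Sum>n<N. (1 / fact n) *\<^sub>R (T ^^ n) u x) - exp_series T u x) \<le> (\<Sum>n. a (n + N))" for N
  proof -
    have "jet_ball False 0 (\<lambda>x. \<Sum>n. (1 / fact (n + N)) *\<^sub>R (T ^^ (n + N)) u x) (\<Sum>n. a (n + N))"
      by (rule jet_ball_suminf[OF t]) (use a in \<open>simp add: summable_iff_shift\<close>)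
    from jet_ball_scale[OF this, of "-1"]
    have "jet_ball False 0 (\<lambda>x. - (\<Sum>n. (1 / fact (n + N)) *\<^sub>R (T ^^ (n + N)) u x)) (\<Sum>n. a (n + N))"
      by simp
    then have "jet_ball False 0 (\<lambda>x. (\<Sum>n<N. (1 / fact n) *\<^sub>R (T ^^ n) u x) - exp_series T u x) (\<Sum>n. a (n + N))"
    proof (rule jet_ball_cong)
      fix x :: real assume x: "x \<in> {0..1}"
      show "- (\<Sum>n. (1 / fact (n + N)) *\<^sub>R (T ^^ (n + N)) u x)
        = (\<Sum>n<N. (1 / fact n) *\<^sub>R (T ^^ n) u x) - exp_series T u x"
        using suminf_minus_initial_segment[OF summable_series[OF u x], of N] by (simp add: exp_series_def)
    qed
    then show ?thesis by simp
  qed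
  have "(\<lambda>N. suminf a - (\<Sum>n<N. a n)) \<longlonglongrightarrow> suminf a - suminf a"
    by (intro tendsto_intros summable_LIMSEQ a)
  then have "(\<lambda>N. \<Sum>n. a (n + N)) \<longlonglongrightarrow> 0"
    using suminf_minus_initial_segment[OF a] by simp
  then show ?thesis
    by (rule tendsto_sandwich[OF _ _ tendsto_const, rotated 2])
      (auto simp: le L2_norm_nonneg)
qed

lemma op_exp_eq:
  assumes u: "u \<in> L2"
  shows "op_exp T u \<in> L2" "AE x in leb01. op_exp T u x = exp_series T u x"
proof -
  let ?S = "\<lambda>N x. \<Sum>n<N. (1 / fact n) *\<^sub>R (T ^^ n) u x"
  let ?P = "\<lambda>v. v \<in> L2 \<and> (\<lambda>N. L2_norm (\<lambda>x. ?S N x - v x)) \<longlonglongrightarrow> 0"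
  have e: "?P (exp_series T u)" using exp_L2[OF u] exp_partial_sums[OF u] by simp
  then have o: "?P (op_exp T u)" unfolding op_exp_def by (rule someI[of ?P])
  then show oL: "op_exp T u \<in> L2" by simp
  have eL: "exp_series T u \<in> L2" using exp_L2[OF u] .
  have SL: "?S N \<in> L2" for N
    by (rule partial_sum_L2[OF u])
  have "L2_norm (\<lambda>x. op_exp T u x - exp_series T u x)
    \<le> L2_norm (\<lambda>x. ?S N x - op_exp T u x) + L2_norm (\<lambda>x. ?S N x - exp_series T u x)" for N
  proof -
    have "L2_norm (\<lambda>x. (- 1) * (?S N x - op_exp T u x) + (?S N x - exp_series T u x))
      \<le> L2_norm (\<lambda>x. (- 1) * (?S N x - op_exp T u x)) + L2_norm (\<lambda>x. ?S N x - exp_series T u x)"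
      by (intro L2_add L2_scale L2_diff SL oL eL)
    also have "L2_norm (\<lambda>x. (- 1) * (?S N x - op_exp T u x)) = L2_norm (\<lambda>x. ?S N x - op_exp T u x)"
      using L2_scale(2)[OF L2_diff[OF SL oL], of "-1"] by simp
    finally show ?thesis by simp
  qed
  moreover have "(\<lambda>N. L2_norm (\<lambda>x. ?S N x - op_exp T u x) + L2_norm (\<lambda>x. ?S N x - exp_series T u x)) \<longlonglongrightarrow> 0 + 0"
    using e o by (intro tendsto_add) auto
  ultimately have "L2_norm (\<lambda>x. op_exp T u x - exp_series T u x) \<le> 0"
    by (intro tendsto_lowerbound[of _ 0 sequentially]) auto
  then have "L2_norm (\<lambda>x. op_exp T u x - exp_series T u x) = 0"
    using L2_norm_nonneg by (intro antisym)
  from L2_norm_zero_AE[OF L2_diff[OF oL eL] this]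
  show "AE x in leb01. op_exp T u x = exp_series T u x" by (rule eventually_mono) simp
qed

lemma pow_zero: "x \<in> {0..1} \<Longrightarrow> (T ^^ n) (\<lambda>x. 0) x = 0"
  using pow_lincomb[OF L2_zero(1) L2_zero(1), of x n 0 0] by simp

lemma pow_partial_sum:
  assumes u: "u \<in> L2" and x: "x \<in> {0..1}"
  shows "(T ^^ n) (\<lambda>x. \<Sum>m<N. (1 / fact m) *\<^sub>R (T ^^ m) u x) x = (\<Sum>m<N. (1 / fact m) *\<^sub>R (T ^^ (n + m)) u x)"
proof (induction N)
  case 0 then show ?case using pow_zero[OF x] by simp
next
  case (Suc N)
  have SL: "(\<lambda>x. \<Sum>m<N. (1 / fact m) *\<^sub>R (T ^^ m) u x) \<in> L2"
    by (rule partial_sum_L2[OF u])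
  have "(T ^^ n) (\<lambda>x. 1 * (\<Sum>m<N. (1 / fact m) *\<^sub>R (T ^^ m) u x) + (1 / fact N) * (T ^^ N) u x) x
    = 1 * (T ^^ n) (\<lambda>x. \<Sum>m<N. (1 / fact m) *\<^sub>R (T ^^ m) u x) x + (1 / fact N) * (T ^^ n) ((T ^^ N) u) x"
    by (rule pow_lincomb[OF SL pow_L2[OF u] x])
  then show ?case using Suc.IH by (simp add: scaleR_conv_of_real funpow_add)
qed

lemma pow_exp:
  assumes u: "u \<in> L2" and x: "x \<in> {0..1}"
  shows "(T ^^ n) (exp_series T u) x = (\<Sum>m. (1 / fact m) *\<^sub>R (T ^^ (n + m)) u x)"
proof (cases n)
  case 0 then show ?thesis by (simp add: exp_series_def)
next
  case (Suc k)
  let ?S = "\<lambda>N x. \<Sum>m<N. (1 / fact m) *\<^sub>R (T ^^ m) u x"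
  obtain c where c: "0 \<le> c" "\<And>u M. jet_ball False 0 u M \<Longrightarrow> jet_ball False (Suc 0) (T u) (c * M)"
    by (rule gain_const[of False 0]) blast
  have SL: "?S N \<in> L2" for N
    by (rule partial_sum_L2[OF u])
  have "norm ((T ^^ n) (?S N) x - (T ^^ n) (exp_series T u) x) \<le> c ^ n * L2_norm (\<lambda>x. ?S N x - exp_series T u x)" for N
  proof -
    have "jet_ball False 0 (\<lambda>x. 1 * ?S N x + (-1) * exp_series T u x) (L2_norm (\<lambda>x. ?S N x - exp_series T u x))"
      using L2_diff[OF SL exp_L2[OF u]] by simp
    from jet_ball_bound[OF pow_ball(2)[OF c this, of k] _ x]
    show ?thesis unfolding Suc using pow_lincomb[OF SL exp_L2[OF u] x, of "Suc k" 1 N "-1"] by simp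
  qed
  then have le: "\<forall>\<^sub>F N in sequentially. norm ((T ^^ n) (?S N) x - (T ^^ n) (exp_series T u) x)
      \<le> c ^ n * L2_norm (\<lambda>x. ?S N x - exp_series T u x)"
    by (intro always_eventually allI)
  have "(\<lambda>N. c ^ n * L2_norm (\<lambda>x. ?S N x - exp_series T u x)) \<longlonglongrightarrow> 0"
    using tendsto_mult[OF tendsto_const exp_partial_sums[OF u], of "c ^ n"] by (simp only: mult_zero_right)
  from Lim_null_comparison[OF le this]
  have "(\<lambda>N. (T ^^ n) (?S N) x - (T ^^ n) (exp_series T u) x) \<longlonglongrightarrow> 0" .
  then have "(\<lambda>N. (T ^^ n) (?S N) x) \<longlonglongrightarrow> (T ^^ n) (exp_series T u) x"
    by (simp add: LIM_zero_iff)
  then have "(\<lambda>m. (1 / fact m) *\<^sub>R (T ^^ (n + m)) u x) sums (T ^^ n) (exp_series T u) x"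
    unfolding sums_def pow_partial_sum[OF u x] .
  then show ?thesis by (simp add: sums_iff)
qed

lemma pow_uminus:
  assumes u: "u \<in> L2" and x: "x \<in> {0..1}"
  shows "((\<lambda>u x. - T u x) ^^ n) u x = (-1) ^ n * (T ^^ n) u x"
  using x
proof (induction n arbitrary: x)
  case (Suc n)
  have s: "(\<lambda>x. (-1) ^ n * (T ^^ n) u x + 0 * u x) \<in> L2" by (intro L2_lincomb pow_L2 u)
  have "T (\<lambda>x. (-1) ^ n * (T ^^ n) u x + 0 * u x) x = T (((\<lambda>u x. - T u x) ^^ n) u) x"
  proof (rule T_cong[OF s _ Suc.prems], rule AE_leb01_I)
    fix t :: real assume "t \<in> {0..1}"
    from Suc.IH[OF this] show "(-1) ^ n * (T ^^ n) u t + 0 * u t = ((\<lambda>u x. - T u x) ^^ n) u t" by simp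
  qed
  then have "T (((\<lambda>u x. - T u x) ^^ n) u) x = T (\<lambda>x. (-1) ^ n * (T ^^ n) u x + 0 * u x) x" by (rule sym)
  also have "\<dots> = (-1) ^ n * T ((T ^^ n) u) x + 0 * T u x"
    by (rule lincomb[OF pow_L2[OF u] u Suc.prems])
  finally show ?case by simp
qed simp

lemma uminus: "smoothing (\<lambda>u x. - T u x)"
proof
  show "bounded_op Z m (Suc m) (\<lambda>u x. - T u x)" for Z m
  proof -
    obtain c where c: "0 \<le> c" "\<And>u M. jet_ball Z m u M \<Longrightarrow> jet_ball Z (Suc m) (T u) (c * M)"
      by (rule gain_const) blast
    show ?thesis
    proof (rule bounded_opI[OF c(1)])
      fix u M assume "jet_ball Z m u M"
      from jet_ball_scale[OF c(2)[OF this], of "-1"]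
      show "jet_ball Z (Suc m) (\<lambda>x. - T u x) (c * M)" by (simp del: jet_ball.simps)
    qed
  qed
qed (simp add: lincomb)

lemma exp_inverse:
  assumes u: "u \<in> L2" and x: "x \<in> {0..1}"
  shows "exp_series (\<lambda>u x. - T u x) (exp_series T u) x = u x"
proof -
  obtain A c where A: "0 \<le> c" "\<And>n. norm ((T ^^ n) u x) \<le> A * c ^ n"
    by (rule pow_pointwise[OF u x]) blast
  have "exp_series (\<lambda>u x. - T u x) (exp_series T u) x
    = (\<Sum>n. ((-1) ^ n / fact n) * (\<Sum>m. (1 / fact m) * (T ^^ (n + m)) u x))"
    unfolding exp_series_def[of "\<lambda>u x. - T u x"]
    by (simp add: pow_uminus[OF exp_L2[OF u] x] pow_exp[OF u x] scaleR_conv_of_real)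
  also have "\<dots> = (T ^^ 0) u x" by (rule exp_minus_exp_series[OF A(2,1)])
  finally show ?thesis by simp
qed

lemma exp_inverse':
  assumes "u \<in> L2" "x \<in> {0..1}"
  shows "exp_series T (exp_series (\<lambda>u x. - T u x) u) x = u x"
  using smoothing.exp_inverse[OF uminus assms] by simp

end

section \<open>Commuting an exponential with the second derivative\<close>

text \<open>\<open>w\<close> is the second derivative of \<open>u\<close>.\<close>
definition prim2 :: "(real \<Rightarrow> complex) \<Rightarrow> (real \<Rightarrow> complex) \<Rightarrow> bool" where
  "prim2 u w \<longleftrightarrow> (\<exists>v. prim u v \<and> prim v w)"

lemma prim2_add: "prim2 u w \<Longrightarrow> prim2 u' w' \<Longrightarrow> prim2 (\<lambda>x. u x + u' x) (\<lambda>x. w x + w' x)"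
  unfolding prim2_def using prim_add by blast

lemma prim2_lincomb:
  "prim2 u w \<Longrightarrow> prim2 u' w' \<Longrightarrow> prim2 (\<lambda>x. c * u x + d * u' x) (\<lambda>x. c * w x + d * w' x)"
  unfolding prim2_def using prim_lincomb by blast

lemma prim2_cong:
  assumes "prim2 u w" "\<And>x. x \<in> {0..1} \<Longrightarrow> u x = u' x" "AE x in leb01. w x = w' x"
  shows "prim2 u' w'"
proof -
  obtain v where v: "prim u v" "prim v w" using assms(1) by (auto simp: prim2_def)
  have "prim u' v" using v(1) assms(2) AE_leb01_I[of "\<lambda>x. v x = v x"] by (auto intro: prim_cong)
  moreover have "prim v w'" using prim_cong[OF v(2) _ assms(3), of v] by simp
  ultimately show ?thesis by (auto simp: prim2_def)
qed

lemma jet_ball_prim: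
  assumes "jet_ball Z (Suc m) u M" "prim u v" "0 < m \<Longrightarrow> continuous_on {0..1} v"
  shows "jet_ball Z m v M"
proof -
  obtain v' where v': "prim u v'" "jet_ball Z m v' M" using assms(1) by (rule jet_ball_SucE) blast
  have ae: "AE x in leb01. v' x = v x" using prim_unique[OF v'(1) assms(2)] .
  show ?thesis
  proof (cases "m = 0")
    case True then show ?thesis using v'(2) L2_AE[OF _ ae] by auto
  next
    case False
    then have "v' x = v x" if "x \<in> {0..1}" for x
      using AE_eq_continuous01[OF jet_ball_continuous[OF v'(2)] assms(3) ae that] by simp
    with v'(2) show ?thesis by (rule jet_ball_cong)
  qed
qed

lemma jet_ball_prim2:
  assumes u: "jet_ball Z (Suc (Suc m)) u M" and p: "prim2 u w" and c: "0 < m \<Longrightarrow> continuous_on {0..1} w"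
  obtains v where "prim u v" "prim v w" "jet_ball Z (Suc m) v M" "jet_ball Z m w M"
proof -
  obtain v where v: "prim u v" "prim v w" using p by (auto simp: prim2_def)
  have "jet_ball Z (Suc m) v M" using jet_ball_prim[OF u v(1)] prim_continuous[OF v(2)] by simp
  from that[OF v this] jet_ball_prim[OF this v(2) c] show ?thesis by blast
qed

lemma jet_ball_deriv:
  assumes "jet_ball Z (Suc (Suc m)) u M"
  shows "prim u (deriv01 u)" "jet_ball Z (Suc m) (deriv01 u) M"
proof -
  obtain v where v: "prim u v" "jet_ball Z (Suc m) v M" using assms by (rule jet_ball_SucE) blast
  have eq: "v x = deriv01 u x" if "x \<in> {0..1}" for x
    using prim_deriv(2)[OF v(1) jet_ball_continuous[OF v(2)] that] by simp
  show "jet_ball Z (Suc m) (deriv01 u) M" using jet_ball_cong[OF v(2) eq] .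
  show "prim u (deriv01 u)" using prim_cong[OF v(1), of u "deriv01 u"] AE_leb01_I[OF eq] by simp
qed

text \<open>\<open>K\<close> is the commutator \<open>[\<partial>\<^sup>2, T]\<close>, and loses no derivative; on \<open>H\<^sup>2\<close> it may contain boundary values of \<open>u\<close> and \<open>u'\<close>.\<close>
locale commuting = smoothing T for T :: "(real \<Rightarrow> complex) \<Rightarrow> real \<Rightarrow> complex" +
  fixes K :: "(real \<Rightarrow> complex) \<Rightarrow> real \<Rightarrow> complex"
  assumes commutator: "jet_ball False 2 u M \<Longrightarrow> w \<in> L2 \<Longrightarrow> prim2 u w \<Longrightarrow> prim2 (T u) (\<lambda>x. T w x + K u x)"
    and K_bounded: "2 \<le> m \<Longrightarrow> bounded_op Z m m K"
begin

text \<open>\<open>[\<partial>\<^sup>2, T\<^bsup>n+1\<^esup>] = T [\<partial>\<^sup>2, T\<^sup>n] + [\<partial>\<^sup>2, T] T\<^sup>n\<close>.\<close>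
fun pow_commutator :: "nat \<Rightarrow> (real \<Rightarrow> complex) \<Rightarrow> real \<Rightarrow> complex" where
  "pow_commutator 0 u = (\<lambda>x. 0)"
| "pow_commutator (Suc n) u = (\<lambda>x. T (pow_commutator n u) x + K ((T ^^ n) u) x)"

definition exp_commutator :: "(real \<Rightarrow> complex) \<Rightarrow> real \<Rightarrow> complex" where
  "exp_commutator u x = (\<Sum>n. (1 / fact n) *\<^sub>R pow_commutator n u x)"

lemma pow_commutator_bound:
  assumes m: "2 \<le> m"
  obtains b d where "0 \<le> b" "0 \<le> d" "\<And>n u M. jet_ball Z m u M \<Longrightarrow> jet_ball Z m ((T ^^ n) u) (d ^ n * M)"
    "\<And>n u M. jet_ball Z m u M \<Longrightarrow> jet_ball Z m (pow_commutator n u) (b * d ^ n * M)"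
proof -
  obtain c where c: "0 \<le> c" "\<And>u M. jet_ball Z m u M \<Longrightarrow> jet_ball Z (Suc m) (T u) (c * M)"
    by (rule gain_const) blast
  obtain b where b: "0 \<le> b" "\<And>u M. jet_ball Z m u M \<Longrightarrow> jet_ball Z m (K u) (b * M)"
    using K_bounded[OF m] by (rule bounded_opE) blast
  have pow: "jet_ball Z m ((T ^^ n) u) ((c + 1) ^ n * M)" if u: "jet_ball Z m u M" for n u M
    using jet_ball_mono[OF pow_ball(1)[OF c u]] c(1) jet_ball_nonneg[OF u]
    by (simp add: mult_right_mono power_mono del: jet_ball.simps)
  have "jet_ball Z m (pow_commutator n u) (b * (c + 1) ^ n * M)" if u: "jet_ball Z m u M" for n u M
  proof (induction n)
    case 0
    show ?case using jet_ball_mono[OF jet_ball_zero] b(1) jet_ball_nonneg[OF u] by simp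
  next
    case (Suc n)
    have "jet_ball Z m (\<lambda>x. T (pow_commutator n u) x + K ((T ^^ n) u) x)
        (c * (b * (c + 1) ^ n * M) + b * ((c + 1) ^ n * M))"
      by (intro jet_ball_add jet_ball_Suc[OF c(2)] b(2) Suc pow u)
    then show ?case by (simp add: algebra_simps del: jet_ball.simps)
  qed
  with that[of b "c + 1"] b(1) c(1) pow show ?thesis by simp
qed

lemma exp_commutator_bounded:
  assumes m: "2 \<le> m" shows "bounded_op Z m m exp_commutator"
proof -
  obtain b d where "0 \<le> b" "0 \<le> d"
      "\<And>n u M. jet_ball Z m u M \<Longrightarrow> jet_ball Z m (pow_commutator n u) (b * d ^ n * M)"
    by (rule pow_commutator_bound[OF m]) blast
  then show ?thesis
    unfolding exp_commutator_def[abs_def] by (intro bounded_op_exp_sum)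
qed

lemma prim2_pow:
  assumes u: "jet_ball False 2 u M" and w: "w \<in> L2" and p: "prim2 u w"
  shows "prim2 ((T ^^ n) u) (\<lambda>x. (T ^^ n) w x + pow_commutator n u x)"
proof (induction n)
  case 0 then show ?case using p by simp
next
  case (Suc n)
  obtain b d where b: "\<And>n u M. jet_ball False 2 u M \<Longrightarrow> jet_ball False 2 ((T ^^ n) u) (d ^ n * M)"
      "\<And>n u M. jet_ball False 2 u M \<Longrightarrow> jet_ball False 2 (pow_commutator n u) (b * d ^ n * M)"
    by (rule pow_commutator_bound[of 2 False]) auto
  have r: "pow_commutator n u \<in> L2" using jet_ball_L2[OF b(2)[OF u]] by simp
  have w': "(\<lambda>x. (T ^^ n) w x + pow_commutator n u x) \<in> L2"
    using L2_add(1)[OF pow_L2[OF w] r] .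
  have p: "prim2 (T ((T ^^ n) u)) (\<lambda>x. T (\<lambda>x. (T ^^ n) w x + pow_commutator n u x) x + K ((T ^^ n) u) x)"
    by (rule commutator[OF b(1)[OF u] w' Suc])
  have e: "T (\<lambda>x. (T ^^ n) w x + pow_commutator n u x) x = T ((T ^^ n) w) x + T (pow_commutator n u) x"
    if "x \<in> {0..1}" for x
    using lincomb[OF pow_L2[OF w, of n] r that, of 1 1] by simp
  show ?case
    by (rule prim2_cong[OF p]) (auto intro!: AE_leb01_I simp: e add.assoc)
qed

text \<open>The series is differentiated twice termwise, and the commutators with the powers of \<open>T\<close> are summed up.\<close>
lemma prim2_exp:
  assumes u: "jet_ball False 2 u M" and w: "w \<in> L2" and p: "prim2 u w"
  shows "prim2 (exp_series T u) (\<lambda>x. exp_series T w x + exp_commutator u x)"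
proof -
  obtain b d where b: "0 \<le> b" "0 \<le> d"
      "\<And>n u M. jet_ball False 2 u M \<Longrightarrow> jet_ball False 2 ((T ^^ n) u) (d ^ n * M)"
      "\<And>n u M. jet_ball False 2 u M \<Longrightarrow> jet_ball False 2 (pow_commutator n u) (b * d ^ n * M)"
    by (rule pow_commutator_bound[of 2 False]) auto
  obtain c where c: "0 \<le> c" "\<And>u M. jet_ball False 0 u M \<Longrightarrow> jet_ball False (Suc 0) (T u) (c * M)"
    by (rule gain_const[of False 0]) blast
  define N where "N = L2_norm w"
  have M: "0 \<le> M" "0 \<le> N" using jet_ball_nonneg[OF u] L2_norm_nonneg by (auto simp: N_def)
  define W where "W n = (\<lambda>x. (T ^^ n) w x + pow_commutator n u x)" for n
  define a where "a n = 1 * (inverse (fact n) * d ^ n) * M +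
    (1 * (inverse (fact n) * c ^ n) * N + b * (inverse (fact n) * d ^ n) * M)" for n :: nat
  have a: "summable a" unfolding a_def by (intro summable_add exp_scaled_sums(1))
  have "\<forall>n. \<exists>v. prim ((T ^^ n) u) v \<and> prim v (W n) \<and> jet_ball False 1 v (d ^ n * M)"
  proof
    fix n
    have "jet_ball False (Suc (Suc 0)) ((T ^^ n) u) (d ^ n * M)" using b(3)[OF u, of n] by (simp only: numeral_2_eq_2)
    from jet_ball_prim2[OF this prim2_pow[OF u w p, of n]] show
      "\<exists>v. prim ((T ^^ n) u) v \<and> prim v (W n) \<and> jet_ball False 1 v (d ^ n * M)"
      unfolding W_def by (metis One_nat_def less_irrefl)
  qed
  then obtain v where v: "\<And>n. prim ((T ^^ n) u) (v n)" "\<And>n. prim (v n) (W n)" "\<And>n. jet_ball False 1 (v n) (d ^ n * M)"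
    by metis
  have sc: "prim (\<lambda>x. (1 / fact n) *\<^sub>R f x) (\<lambda>x. (1 / fact n) *\<^sub>R g x)" if "prim f g" for f g and n :: nat
    using prim_lincomb[OF that that, of "of_real (1 / fact n)" 0] by (simp add: scaleR_conv_of_real)
  have dn: "inverse (fact n) * (d ^ n * M) \<le> a n" for n :: nat
    using b c M by (simp add: a_def)
  have le: "(1 / fact n) * t \<le> a n" if "t \<le> d ^ n * M" for t and n :: nat
    using order_trans[OF mult_left_mono[OF that, of "inverse (fact n)"] dn] by (simp add: divide_inverse)
  have vL: "(\<lambda>x. (1 / fact n) *\<^sub>R v n x) \<in> L2" "L2_norm (\<lambda>x. (1 / fact n) *\<^sub>R v n x) \<le> a n" for n
    using L2_scale[of "v n" "of_real (1 / fact n)"] jet_ball_L2[OF v(3), of n] le[of "L2_norm (v n)" n]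
    by (auto simp: scaleR_conv_of_real norm_divide)
  have uL: "norm ((1 / fact n) *\<^sub>R (T ^^ n) u x) \<le> a n" if "x \<in> {0..1}" for n x
    using le[OF jet_ball_bound[OF b(3)[OF u] _ that]] by simp
  have vL': "norm ((1 / fact n) *\<^sub>R v n x) \<le> a n" if "x \<in> {0..1}" for n x
    using le[OF jet_ball_bound[OF v(3) _ that]] by simp
  have WL: "(\<lambda>x. (1 / fact n) *\<^sub>R W n x) \<in> L2" "L2_norm (\<lambda>x. (1 / fact n) *\<^sub>R W n x) \<le> a n" for n
  proof -
    have "jet_ball False 0 w N" using w by (simp add: N_def)
    from pow_ball(1)[OF c this, of n] have 1: "jet_ball False 0 ((T ^^ n) w) (c ^ n * N)" .
    have 2: "jet_ball False 0 (pow_commutator n u) (b * d ^ n * M)"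
      using jet_ball_le[OF b(4)[OF u], of 0] by simp
    have "jet_ball False 0 (\<lambda>x. of_real (1 / fact n) * W n x) (norm (complex_of_real (1 / fact n)) * (c ^ n * N + b * d ^ n * M))"
      unfolding W_def by (rule jet_ball_scale[OF jet_ball_add[OF 1 2]])
    then have "jet_ball False 0 (\<lambda>x. (1 / fact n) *\<^sub>R W n x) (inverse (fact n) * (c ^ n * N + b * d ^ n * M))"
      by (simp only: scaleR_conv_of_real norm_of_real) (simp add: divide_inverse del: of_real_divide)
    then have "jet_ball False 0 (\<lambda>x. (1 / fact n) *\<^sub>R W n x) (a n)"
      by (rule jet_ball_mono) (use b M in \<open>simp add: a_def algebra_simps\<close>)
    then show "(\<lambda>x. (1 / fact n) *\<^sub>R W n x) \<in> L2" "L2_norm (\<lambda>x. (1 / fact n) *\<^sub>R W n x) \<le> a n" by simp_all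
  qed
  have "prim (\<lambda>x. \<Sum>n. (1 / fact n) *\<^sub>R (T ^^ n) u x) (\<lambda>x. \<Sum>n. (1 / fact n) *\<^sub>R v n x)"
    by (rule prim_suminf[OF sc[OF v(1)] vL uL a])
  moreover have "prim (\<lambda>x. \<Sum>n. (1 / fact n) *\<^sub>R v n x) (\<lambda>x. \<Sum>n. (1 / fact n) *\<^sub>R W n x)"
    by (rule prim_suminf[OF sc[OF v(2)] WL vL' a])
  ultimately have p2: "prim2 (exp_series T u) (\<lambda>x. \<Sum>n. (1 / fact n) *\<^sub>R W n x)"
    unfolding prim2_def exp_series_def[abs_def] by blast
  have "(\<Sum>n. (1 / fact n) *\<^sub>R W n x) = exp_series T w x + exp_commutator u x" if x: "x \<in> {0..1}" for x
  proof -
    have "summable (\<lambda>n. (1 / fact n) *\<^sub>R pow_commutator n u x)"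
    proof (rule summable_comparison_test'[OF a, of 0])
      fix n :: nat
      have "norm (pow_commutator n u x) \<le> b * d ^ n * M" using jet_ball_bound[OF b(4)[OF u] _ x] by simp
      then have "inverse (fact n) * norm (pow_commutator n u x) \<le> inverse (fact n) * (b * d ^ n * M)"
        by (rule mult_left_mono) simp
      also have "\<dots> \<le> a n" using b c M by (simp add: a_def algebra_simps)
      finally show "norm ((1 / fact n) *\<^sub>R pow_commutator n u x) \<le> a n" by (simp add: divide_inverse)
    qed
    from suminf_add[OF summable_series[OF w x] this]
    show ?thesis by (simp add: exp_series_def exp_commutator_def W_def scaleR_add_right)
  qed
  then show ?thesis
    by (intro prim2_cong[OF p2] AE_leb01_I) auto
qed

end

section \<open>The corrector\<close>

lemma smoothing_commuting_cong:
  assumes S: "commuting S K" and eq: "\<And>u x. u \<in> L2 \<Longrightarrow> x \<in> {0..1} \<Longrightarrow> T u x = S u x"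
  shows "commuting T K"
proof -
  interpret commuting S K by (rule S)
  show ?thesis
  proof
    show "T (\<lambda>x. c * u x + d * v x) x = c * T u x + d * T v x"
      if "u \<in> L2" "v \<in> L2" "x \<in> {0..1}" for u v x c d
      using lincomb[OF that] eq L2_lincomb[OF that(1,2)] that by simp
    show "bounded_op Z m (Suc m) T" for Z m
    proof -
      obtain c where c: "0 \<le> c" "\<And>u M. jet_ball Z m u M \<Longrightarrow> jet_ball Z (Suc m) (S u) (c * M)"
        by (rule gain_const) blast
      show ?thesis
      proof (rule bounded_opI[OF c(1)])
        fix u M assume u: "jet_ball Z m u M"
        show "jet_ball Z (Suc m) (T u) (c * M)"
          using jet_ball_cong[OF c(2)[OF u]] eq[of u] jet_ball_L2[OF u] by simp
      qed
    qed
    show "prim2 (T u) (\<lambda>x. T w x + K u x)" if "jet_ball False 2 u M" "w \<in> L2" "prim2 u w" for u w M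
      using commutator[OF that] eq[of u] eq[of w] jet_ball_L2[OF that(1)] that(2)
      by (elim prim2_cong) (auto intro!: AE_leb01_I)
  qed (rule K_bounded)
qed

lemma commuting_zero: "commuting (\<lambda>u x. 0) (\<lambda>u x. 0)"
proof
  show "bounded_op Z m n (\<lambda>u x. 0)" for Z m n
    using jet_ball_zero by (intro bounded_opI[of 0]) auto
  then show "bounded_op Z m m (\<lambda>u x. 0)" for Z m .
qed (auto simp: prim2_def intro: prim_const)

lemma commuting_add:
  assumes "commuting S K" "commuting T L"
  shows "commuting (\<lambda>u x. S u x + T u x) (\<lambda>u x. K u x + L u x)"
proof -
  interpret S: commuting S K by (rule assms(1))
  interpret T: commuting T L by (rule assms(2))
  show ?thesis
  proof
    show "prim2 (\<lambda>x. S u x + T u x) (\<lambda>x. S w x + T w x + (K u x + L u x))"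
      if "jet_ball False 2 u M" "w \<in> L2" "prim2 u w" for u w M
      using prim2_add[OF S.commutator[OF that] T.commutator[OF that]] by (simp add: algebra_simps)
  qed (auto simp: S.lincomb T.lincomb algebra_simps intro: bounded_op_add S.gain T.gain S.K_bounded T.K_bounded)
qed

lemma commuting_sum:
  assumes "finite I" "\<And>i. i \<in> I \<Longrightarrow> commuting (T i) (K i)"
  shows "commuting (\<lambda>u x. \<Sum>i\<in>I. T i u x) (\<lambda>u x. \<Sum>i\<in>I. K i u x)"
  using assms
proof (induction I rule: finite_induct)
  case (insert i I)
  then show ?case using commuting_add[of "T i" "K i" "\<lambda>u x. \<Sum>i\<in>I. T i u x" "\<lambda>u x. \<Sum>i\<in>I. K i u x"] by simp
qed (simp add: commuting_zero)

lemma flat_coeff_smooth: "flat_coeff y f \<Longrightarrow> smooth01 f"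
  by (simp add: flat_coeff_def)

text \<open>Boundary values times a fixed smooth function; on flat functions such an operator is zero.\<close>
lemma bounded_op_boundary:
  assumes q: "smooth01 q" and l: "\<And>u M. jet_ball Z m u M \<Longrightarrow> norm (l u) \<le> M"
    and l0: "\<And>u M. jet_ball Z m u M \<Longrightarrow> Z \<Longrightarrow> l u = 0"
  shows "bounded_op Z m m (\<lambda>u x. q x *\<^sub>R l u)"
proof -
  obtain C where C: "jet_ball False m (\<lambda>x. complex_of_real (q x)) C" using jet_ball_smooth[OF q] by blast
  have C0: "0 \<le> C" using jet_ball_nonneg[OF C] .
  show ?thesis
  proof (rule bounded_opI[OF C0])
    fix u M assume u: "jet_ball Z m u M"
    show "jet_ball Z m (\<lambda>x. q x *\<^sub>R l u) (C * M)"
    proof (cases Z)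
      case True
      then show ?thesis
        using l0[OF u] jet_ball_mono[OF jet_ball_zero[of Z m], of "C * M"] C0 jet_ball_nonneg[OF u] by simp
    next
      case False
      have "jet_ball False m (\<lambda>x. l u * complex_of_real (q x)) (C * M)"
        by (rule jet_ball_mono[OF jet_ball_scale[OF C]])
          (use mult_right_mono[OF l[OF u] C0] in \<open>simp add: mult.commute\<close>)
      then show ?thesis using False by (simp add: scaleR_conv_of_real mult.commute)
    qed
  qed
qed

text \<open>The \<open>n\<close>-fold integral of the constant function \<open>1\<close>.\<close>
definition taylor_monomial :: "real \<Rightarrow> nat \<Rightarrow> real \<Rightarrow> real" where
  "taylor_monomial y n x = (x - y) ^ n / fact n"

lemma smooth01_taylor_monomial: "smooth01 (taylor_monomial y n)"
proof -
  have "smooth01 (\<lambda>x. (1 / fact n) * (x - y) ^ n)" by (intro smooth01_mult smooth01_const smooth01_power)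
  then show ?thesis by (simp add: taylor_monomial_def[abs_def])
qed

lemma J_iter_const:
  assumes "y \<in> {0..1}" "x \<in> {0..1}"
  shows "(J y ^^ n) (\<lambda>x. c) x = taylor_monomial y n x *\<^sub>R c"
  using assms(2)
proof (induction n arbitrary: x)
  case 0 then show ?case by (simp add: taylor_monomial_def)
next
  case (Suc n)
  have d: "((\<lambda>x. complex_of_real (taylor_monomial y (Suc n) x)) has_vector_derivative
      complex_of_real (taylor_monomial y n t)) (at t within {0..1})" for t
  proof -
    have "(taylor_monomial y (Suc n) has_real_derivative real (Suc n) * (t - y) ^ n / fact (Suc n)) (at t within {0..1})"
      unfolding taylor_monomial_def[abs_def]
      by (auto intro!: derivative_eq_intros simp del: power_Suc fact_Suc of_nat_Suc)
    moreover have "real (Suc n) * (t - y) ^ n / fact (Suc n) = taylor_monomial y n t"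
      by (simp add: taylor_monomial_def del: of_nat_Suc)
    ultimately have "(taylor_monomial y (Suc n) has_real_derivative taylor_monomial y n t) (at t within {0..1})"
      by simp
    then show ?thesis
      by (simp add: has_real_derivative_iff_has_vector_derivative has_vector_derivative_of_real)
  qed
  have "prim (\<lambda>x. complex_of_real (taylor_monomial y (Suc n) x)) (\<lambda>x. complex_of_real (taylor_monomial y n x))"
    using d smooth01_continuous[OF smooth01_taylor_monomial]
    by (intro prim_FTC) (auto intro!: continuous_intros)
  from prim_lincomb[OF this this, of c 0]
  have "prim (\<lambda>x. c * taylor_monomial y (Suc n) x) (\<lambda>x. c * taylor_monomial y n x)" by simp
  from J_prim[OF this Suc.prems assms(1)]
  have "J y (\<lambda>x. c * taylor_monomial y n x) x = c * taylor_monomial y (Suc n) x"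
    by (simp add: taylor_monomial_def)
  moreover have "J y ((J y ^^ n) (\<lambda>x. c)) x = J y (\<lambda>x. c * taylor_monomial y n x) x"
    using Suc assms by (intro J_cong AE_leb01_I) (auto simp: scaleR_conv_of_real)
  ultimately show ?case by (simp add: scaleR_conv_of_real)
qed

lemma J_iter_cong:
  assumes "AE x in leb01. u x = v x" "x \<in> {0..1}" "y \<in> {0..1}"
  shows "(J y ^^ Suc n) u x = (J y ^^ Suc n) v x"
  using assms(2)
proof (induction n arbitrary: x)
  case 0 then show ?case using J_cong[OF assms(1) _ assms(3)] by simp
next
  case (Suc n)
  have "J y ((J y ^^ Suc n) u) x = J y ((J y ^^ Suc n) v) x"
    using Suc assms(3) by (intro J_cong AE_leb01_I)
  then show ?case by simp
qed

text \<open>Integrating a derivative costs a Taylor monomial with a boundary value.\<close>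
lemma J_iter_of_prim:
  assumes p: "prim u v" and y: "y \<in> {0..1}" and x: "x \<in> {0..1}"
  shows "(J y ^^ Suc n) v x = (J y ^^ n) u x - taylor_monomial y n x *\<^sub>R u y"
proof -
  have Jv: "J y v t = 1 * u t + (-1) * u y" if "t \<in> {0..1}" for t
    using J_prim[OF p that y] by simp
  have "(J y ^^ Suc n) v x = (J y ^^ n) (J y v) x" by (simp add: funpow_swap1)
  also have "\<dots> = (J y ^^ n) (\<lambda>t. 1 * u t + (-1) * u y) x"
    using Jv x J_iter_cong[of "J y v" "\<lambda>t. 1 * u t + (-1) * u y" x y] AE_leb01_I[OF Jv] y by (cases n) auto
  also have "\<dots> = 1 * (J y ^^ n) u x + (-1) * (J y ^^ n) (\<lambda>t. u y) x"
    by (intro J_iter_lincomb integrable_continuous01 prim_continuous[OF p] x y) auto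
  finally show ?thesis by (simp add: J_iter_const[OF y x])
qed

text \<open>By the Leibniz rule and two integrations by parts, \<open>\<partial>\<^sup>2 (f J\<^bsup>n+1\<^esup> u) - f J\<^bsup>n+1\<^esup> \<partial>\<^sup>2 u\<close>: the two terms without a
  derivative of \<open>f\<close> cancel up to the boundary values of \<open>u\<close> and \<open>u'\<close> at \<open>y\<close>.\<close>
definition term_commutator :: "(real \<Rightarrow> real) \<Rightarrow> real \<Rightarrow> nat \<Rightarrow> (real \<Rightarrow> complex) \<Rightarrow> real \<Rightarrow> complex" where
  "term_commutator f y n u x =
     deriv01 (deriv01 f) x *\<^sub>R (J y ^^ Suc n) u x + (deriv01 f x *\<^sub>R (J y ^^ n) u x + deriv01 f x *\<^sub>R (J y ^^ n) u x)
     + (f x * taylor_monomial y n x) *\<^sub>R deriv01 u y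
     + (if n = 0 then 0 else (f x * taylor_monomial y (n - 1) x) *\<^sub>R u y)"

lemma commuting_term:
  assumes y: "y \<in> {0, 1}" and f: "flat_coeff y f"
  shows "commuting (\<lambda>u x. f x *\<^sub>R (J y ^^ Suc n) u x) (term_commutator f y n)"
proof
  have y01: "y \<in> {0..1}" using y by auto
  have sm: "smooth01 f" "smooth01 (deriv01 f)"
    using f flat_coeff_smooth flat_coeff_deriv by blast+
  show "bounded_op Z m (Suc m) (\<lambda>u x. f x *\<^sub>R (J y ^^ Suc n) u x)" for Z m
    by (rule smoothing_coeff_J_iter[OF y f])
  show "f x *\<^sub>R (J y ^^ Suc n) (\<lambda>x. c * u x + d * v x) x
      = c * (f x *\<^sub>R (J y ^^ Suc n) u x) + d * (f x *\<^sub>R (J y ^^ Suc n) v x)"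
    if "u \<in> L2" "v \<in> L2" "x \<in> {0..1}" for u v x c d
    using J_iter_lincomb[OF L2_integrable[OF that(1)] L2_integrable[OF that(2)] that(3) y01, of "Suc n"]
    by (simp add: scaleR_add_right del: funpow.simps)
  show "bounded_op Z m m (term_commutator f y n)" if m: "2 \<le> m" for Z m
  proof -
    have v: "norm (deriv01 u y) \<le> M \<and> (Z \<longrightarrow> deriv01 u y = 0)" "norm (u y) \<le> M \<and> (Z \<longrightarrow> u y = 0)"
      if u: "jet_ball Z m u M" for u M
    proof -
      have u2: "jet_ball Z (Suc (Suc 0)) u M" using jet_ball_le[OF u] m by (simp only: numeral_2_eq_2)
      show "norm (deriv01 u y) \<le> M \<and> (Z \<longrightarrow> deriv01 u y = 0)"
        using jet_ball_deriv(2)[OF u2] y y01 by auto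
      show "norm (u y) \<le> M \<and> (Z \<longrightarrow> u y = 0)" using u2 y y01 by auto
    qed
    have q: "smooth01 (\<lambda>x. f x * taylor_monomial y j x)" for j
      by (intro smooth01_mult sm smooth01_taylor_monomial)
    have "bounded_op Z m m (\<lambda>u x. if n = 0 then 0 else (f x * taylor_monomial y (n - 1) x) *\<^sub>R u y)"
    proof (cases "n = 0")
      case True then show ?thesis using jet_ball_zero by (intro bounded_opI[of 0]) auto
    next
      case False then show ?thesis using bounded_op_boundary[OF q, of Z m "\<lambda>u. u y"] v(2) by simp
    qed
    moreover have "bounded_op Z m m (\<lambda>u x. (f x * taylor_monomial y n x) *\<^sub>R deriv01 u y)"
      using bounded_op_boundary[OF q, of Z m "\<lambda>u. deriv01 u y"] v(1) by blast
    ultimately show ?thesis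
      unfolding term_commutator_def[abs_def]
      by (intro bounded_op_add bounded_op_coeff_J_iter[OF y] flat_coeff_deriv f)
  qed
  show "prim2 (\<lambda>x. f x *\<^sub>R (J y ^^ Suc n) u x) (\<lambda>x. f x *\<^sub>R (J y ^^ Suc n) w x + term_commutator f y n u x)"
    if u: "jet_ball False 2 u M" and w: "w \<in> L2" and p: "prim2 u w" for u w M
  proof -
    have u2: "jet_ball False (Suc (Suc 0)) u M" using u by (simp only: numeral_2_eq_2)
    obtain v where v: "prim u v" "prim v w" using p by (auto simp: prim2_def)
    have ui: "integrable leb01 u" using jet_ball_integrable[OF u] .
    have vy: "deriv01 u y = v y" using prim_deriv(2)[OF v(1) prim_continuous[OF v(2)] y01] .
    have pJ: "prim ((J y ^^ Suc k) u) ((J y ^^ k) u)" for k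
      using prim_J[OF integrable_J_iter[OF ui]] by simp
    \<comment> \<open>The derivative of \<open>J\<^sup>n u\<close>.\<close>
    define g where "g = (if n = 0 then v else (J y ^^ (n - 1)) u)"
    have pg: "prim ((J y ^^ n) u) g" using v(1) pJ[of "n - 1"] by (cases n) (auto simp: g_def)
    have p1: "prim (\<lambda>x. f x *\<^sub>R (J y ^^ Suc n) u x)
        (\<lambda>x. deriv01 f x *\<^sub>R (J y ^^ Suc n) u x + f x *\<^sub>R (J y ^^ n) u x)"
      by (rule prim_scaleR[OF pJ sm(1)])
    have p2: "prim (\<lambda>x. deriv01 f x *\<^sub>R (J y ^^ Suc n) u x + f x *\<^sub>R (J y ^^ n) u x)
        (\<lambda>x. (deriv01 (deriv01 f) x *\<^sub>R (J y ^^ Suc n) u x + deriv01 f x *\<^sub>R (J y ^^ n) u x)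
          + (deriv01 f x *\<^sub>R (J y ^^ n) u x + f x *\<^sub>R g x))"
      by (intro prim_add prim_scaleR pJ pg sm)
    have gw: "g x = (J y ^^ Suc n) w x + taylor_monomial y n x *\<^sub>R v y
        + (if n = 0 then 0 else taylor_monomial y (n - 1) x *\<^sub>R u y)" if x: "x \<in> {0..1}" for x
    proof (cases n)
      case 0 then show ?thesis using J_iter_of_prim[OF v(2) y01 x, of 0] by (simp add: g_def)
    next
      case (Suc k)
      then show ?thesis
        using J_iter_of_prim[OF v(2) y01 x, of n] J_iter_of_prim[OF v(1) y01 x, of k]
        by (simp add: g_def del: funpow.simps)
    qed
    have "prim2 (\<lambda>x. f x *\<^sub>R (J y ^^ Suc n) u x)
       (\<lambda>x. (deriv01 (deriv01 f) x *\<^sub>R (J y ^^ Suc n) u x + deriv01 f x *\<^sub>R (J y ^^ n) u x)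
          + (deriv01 f x *\<^sub>R (J y ^^ n) u x + f x *\<^sub>R g x))"
      unfolding prim2_def using p1 p2 by blast
    then show ?thesis
    proof (rule prim2_cong, goal_cases)
      case 2
      show ?case
      proof (rule AE_leb01_I)
        fix x :: real assume "x \<in> {0..1}"
        from gw[OF this] show "(deriv01 (deriv01 f) x *\<^sub>R (J y ^^ Suc n) u x + deriv01 f x *\<^sub>R (J y ^^ n) u x)
          + (deriv01 f x *\<^sub>R (J y ^^ n) u x + f x *\<^sub>R g x)
          = f x *\<^sub>R (J y ^^ Suc n) w x + term_commutator f y n u x"
          by (simp add: term_commutator_def vy scaleR_add_right del: funpow.simps)
      qed
    qed simp
  qed
qed

lemma commuting_corrector:
  assumes phi_smooth: "\<And>n y. y \<in> {0, 1} \<Longrightarrow> smooth01 (\<phi> n y)"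
    and phi_jet: "\<And>n y z i. y \<in> {0, 1} \<Longrightarrow> z \<in> {0, 1} \<Longrightarrow>
           (deriv01 ^^ i) (\<phi> n y) z = (if z = y \<and> i = n then 1 else 0)"
  shows "\<exists>K. commuting (corrector \<alpha> \<phi> k) K"
proof -
  have t: "commuting (\<lambda>u x. of_real (\<alpha> i n y) * of_real (\<phi> (2*i+1-n) y x) * iter_int n y u x)
      (term_commutator (\<lambda>x. \<alpha> i n y * \<phi> (2*i+1-n) y x) y (n - 1))"
    if y: "y \<in> {0, 1}" and n: "n \<in> {1..2*i+1}" for i n y
  proof (rule smoothing_commuting_cong[OF commuting_term[OF y]])
    have y': "1 - y \<in> {0, 1}" "1 - y \<in> {0..1}" "1 - y \<noteq> y" using y by auto
    show "flat_coeff y (\<lambda>x. \<alpha> i n y * \<phi> (2*i+1-n) y x)"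
      unfolding flat_coeff_def
    proof (intro conjI allI)
      show "smooth01 (\<lambda>x. \<alpha> i n y * \<phi> (2*i+1-n) y x)"
        by (intro smooth01_mult smooth01_const phi_smooth y)
      fix j
      have "(deriv01 ^^ j) (\<lambda>x. \<alpha> i n y *\<^sub>R \<phi> (2*i+1-n) y x + 0 *\<^sub>R \<phi> (2*i+1-n) y x) (1 - y) = 0"
        unfolding deriv01_lincomb[OF phi_smooth[OF y] phi_smooth[OF y] y'(2)]
        using y'(3) phi_jet[OF y y'(1)] by simp
      then show "(deriv01 ^^ j) (\<lambda>x. \<alpha> i n y * \<phi> (2*i+1-n) y x) (1 - y) = 0" by simp
    qed
    fix u :: "real \<Rightarrow> complex" and x :: real assume "u \<in> L2" "x \<in> {0..1}"
    then have "iter_int (Suc (n - 1)) y u x = (J y ^^ Suc (n - 1)) u x"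
      using y by (intro iter_int_eq_J_iter L2_integrable) auto
    moreover have "Suc (n - 1) = n" using n by simp
    ultimately show "of_real (\<alpha> i n y) * of_real (\<phi> (2*i+1-n) y x) * iter_int n y u x
        = (\<alpha> i n y * \<phi> (2*i+1-n) y x) *\<^sub>R (J y ^^ Suc (n - 1)) u x"
      by (simp only: scaleR_conv_of_real of_real_mult)
  qed
  have "commuting (corrector \<alpha> \<phi> k) (\<lambda>u x. \<Sum>y\<in>{0, 1}. \<Sum>i\<in>{1..k-1}. \<Sum>n\<in>{1..2*i+1}.
     term_commutator (\<lambda>x. \<alpha> i n y * \<phi> (2*i+1-n) y x) y (n - 1) u x)"
    unfolding corrector_def[abs_def]
    by (intro commuting_sum finite_atLeastAtMost t) auto
  then show ?thesis by blast
qed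

section \<open>Test functions and the lemma of du Bois-Reymond\<close>

text \<open>The class of functions \<open>p(1/x) e\<^bsup>-1/x\<^esup>\<close> with polynomials \<open>p\<close>, extended by \<open>0\<close> to \<open>x \<le> 0\<close>, is
  closed under differentiation.\<close>
definition exp_recip :: "real poly \<Rightarrow> real \<Rightarrow> real" where
  "exp_recip p x = (if x > 0 then poly p (1 / x) * exp (- (1 / x)) else 0)"

lemma poly_div_exp_tendsto_0: "((\<lambda>t. t ^ k * poly p t / exp t) \<longlongrightarrow> (0::real)) at_top"
proof (induction p arbitrary: k)
  case (pCons a p)
  have "((\<lambda>t. a * (t ^ k / exp t) + t ^ Suc k * poly p t / exp t) \<longlongrightarrow> a * 0 + 0) at_top"
    by (intro tendsto_add tendsto_mult tendsto_const tendsto_power_div_exp_0 pCons.IH)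
  then show ?case by (simp add: algebra_simps add_divide_distrib)
qed simp

text \<open>Away from \<open>0\<close> this is calculus; at \<open>0\<close> the exponential beats every polynomial in \<open>1 / x\<close>.\<close>
lemma exp_recip_deriv:
  "(exp_recip p has_real_derivative exp_recip (pCons 0 (pCons 0 (p - pderiv p))) x) (at x)"
proof (cases x "0 :: real" rule: linorder_cases)
  case less
  have "((\<lambda>x. 0) has_real_derivative 0) (at x)" by simp
  then have "(exp_recip p has_real_derivative 0) (at x)"
    by (rule has_field_derivative_transform_within_open[where S = "{..<0}"])
      (use less in \<open>auto simp: exp_recip_def\<close>)
  then show ?thesis using less by (simp add: exp_recip_def)
next
  case greater
  have "((\<lambda>x. poly p (1 / x) * exp (- (1 / x))) has_real_derivative
      (1 / x) * ((1 / x) * (poly p (1 / x) - poly (pderiv p) (1 / x))) * exp (- (1 / x))) (at x)"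
  proof -
    have r: "((\<lambda>x. 1 / x) has_real_derivative - (1 / x * (1 / x))) (at x)"
      using greater by (auto intro!: derivative_eq_intros)
    have 1: "((\<lambda>x. poly p (1 / x)) has_real_derivative poly (pderiv p) (1 / x) * - (1 / x * (1 / x))) (at x)"
      by (rule DERIV_chain2[OF poly_DERIV r])
    have 2: "((\<lambda>x. exp (- (1 / x))) has_real_derivative exp (- (1 / x)) * - (- (1 / x * (1 / x)))) (at x)"
      by (rule DERIV_chain2[OF DERIV_exp DERIV_minus[OF r]])
    show ?thesis
      using DERIV_mult[OF 1 2] by (simp add: algebra_simps)
  qed
  then have "(exp_recip p has_real_derivative
      (1 / x) * ((1 / x) * (poly p (1 / x) - poly (pderiv p) (1 / x))) * exp (- (1 / x))) (at x)"
    by (rule has_field_derivative_transform_within_open[where S = "{0<..}"])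
      (use greater in \<open>auto simp: exp_recip_def\<close>)
  then show ?thesis using greater by (simp add: exp_recip_def)
next
  case equal
  have "((\<lambda>t. t ^ 1 * poly p t / exp t) \<longlongrightarrow> 0) at_top" by (rule poly_div_exp_tendsto_0)
  then have "((\<lambda>h. (inverse h) ^ 1 * poly p (inverse h) / exp (inverse h)) \<longlongrightarrow> 0) (at_right 0)"
    by (rule filterlim_compose[OF _ filterlim_inverse_at_top_right])
  then have r: "((\<lambda>h. (exp_recip p h - exp_recip p 0) / h) \<longlongrightarrow> 0) (at_right 0)"
    by (rule Lim_transform_eventually)
      (auto simp: exp_recip_def eventually_at_filter exp_minus divide_simps)
  have l: "((\<lambda>h. (exp_recip p h - exp_recip p 0) / h) \<longlongrightarrow> 0) (at_left 0)"
    by (rule Lim_transform_eventually[OF tendsto_const]) (auto simp: exp_recip_def eventually_at_filter)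
  have "((\<lambda>h. (exp_recip p h - exp_recip p 0) / h) \<longlongrightarrow> 0) (at 0)"
    using l r by (simp add: filterlim_split_at)
  then show ?thesis using equal by (simp add: DERIV_def exp_recip_def)
qed

lemma smooth01_exp_recip: "smooth01 (\<lambda>x. exp_recip p (c * x + d))"
proof -
  have "Ck m (\<lambda>x. exp_recip p (c * x + d))" for m
  proof (induction m arbitrary: p)
    case 0
    have "isCont (exp_recip p) x" for x using exp_recip_deriv DERIV_isCont by blast
    then have "continuous_on UNIV (exp_recip p)" by (simp add: continuous_at_imp_continuous_on)
    then show ?case by (auto intro!: continuous_intros continuous_on_compose2[of UNIV "exp_recip p"])
  next
    case (Suc m)
    let ?q = "pCons 0 (pCons 0 (p - pderiv p))"
    have "((\<lambda>x. exp_recip p (c * x + d)) has_vector_derivative c *\<^sub>R exp_recip ?q (c * x + d)) (at x within {0..1})" for x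
    proof -
      have "((\<lambda>x. c * x + d) has_real_derivative c) (at x)" by (auto intro!: derivative_eq_intros)
      from DERIV_chain2[OF exp_recip_deriv this]
      have "((\<lambda>x. exp_recip p (c * x + d)) has_real_derivative exp_recip ?q (c * x + d) * c) (at x)" .
      then show ?thesis
        by (simp add: has_real_derivative_iff_has_vector_derivative has_vector_derivative_at_within mult.commute)
    qed
    moreover have "Ck m (\<lambda>x. c *\<^sub>R exp_recip ?q (c * x + d))" by (intro Ck_scaleR Ck_const Suc)
    ultimately show ?case unfolding Ck.simps by (intro exI[of _ "\<lambda>x. c *\<^sub>R exp_recip ?q (c * x + d)"]) simp
  qed
  then show ?thesis by (simp add: smooth01_iff_Ck)
qed

text \<open>As \<open>n\<close> grows, the flanks steepen and the bump tends to the indicator of the interval \<open>(a, b)\<close>.\<close>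
definition bump :: "real \<Rightarrow> real \<Rightarrow> nat \<Rightarrow> real \<Rightarrow> real" where
  "bump a b n x = exp_recip 1 (real (Suc n) * (x - a)) * exp_recip 1 (real (Suc n) * (b - x))"

lemma smooth01_bump: "smooth01 (bump a b n)"
proof -
  have "smooth01 (\<lambda>x. exp_recip 1 (real (Suc n) * x + - real (Suc n) * a)
      * exp_recip 1 (- real (Suc n) * x + real (Suc n) * b))"
    by (intro smooth01_mult smooth01_exp_recip)
  then show ?thesis by (simp add: bump_def[abs_def] algebra_simps)
qed

lemma test_function_bump: "0 < a \<Longrightarrow> a < b \<Longrightarrow> b < 1 \<Longrightarrow> test_function (bump a b n)"
  unfolding test_function_def
proof (intro conjI exI ballI)
  show "bump a b n x = 0" if "x \<in> {0..1} - {a..b}" for x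
  proof -
    have "x - a \<le> 0 \<or> b - x \<le> 0" using that by auto
    then show ?thesis by (auto simp: bump_def exp_recip_def zero_less_mult_iff)
  qed
qed (auto simp: smooth01_bump)

lemma bump_bounds: "0 \<le> bump a b n x" "bump a b n x \<le> 1"
  by (auto simp: bump_def exp_recip_def intro!: mult_le_one)

lemma bump_pos: "a < x \<Longrightarrow> x < b \<Longrightarrow> 0 < bump a b n x"
  by (simp add: bump_def exp_recip_def)

lemma bump_tendsto: "(\<lambda>n. bump a b n x) \<longlonglongrightarrow> indicator {a<..<b} x"
proof -
  have *: "(\<lambda>n. exp_recip 1 (real (Suc n) * t)) \<longlonglongrightarrow> (if 0 < t then 1 else 0)" for t
  proof (cases "0 < t")
    case True
    have "(\<lambda>n. exp (- (1 / t * inverse (real (Suc n))))) \<longlonglongrightarrow> exp (- (1 / t * 0))"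
      by (intro tendsto_intros LIMSEQ_inverse_real_of_nat)
    then show ?thesis using True by (simp add: exp_recip_def divide_inverse mult.commute)
  next
    case False
    then have "exp_recip 1 (real (Suc n) * t) = 0" for n by (simp add: exp_recip_def zero_less_mult_iff)
    then show ?thesis using False by simp
  qed
  have "(\<lambda>n. bump a b n x) \<longlonglongrightarrow> (if 0 < x - a then 1 else 0) * (if 0 < b - x then 1 else 0)"
    unfolding bump_def by (intro tendsto_mult *)
  then show ?thesis by (auto simp: indicator_def split: if_splits)
qed

lemma test_functionD:
  assumes "test_function \<psi>"
  shows "smooth01 \<psi>" "\<psi> 0 = 0" "\<psi> 1 = 0"
  using assms unfolding test_function_def by auto

text \<open>The smooth bumps converge boundedly to indicators of intervals.\<close>
lemma test_functions_separate:
  assumes w: "integrable leb01 w" and zero: "\<And>\<psi>. test_function \<psi> \<Longrightarrow> (LINT x|leb01. \<psi> x *\<^sub>R w x) = 0"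
  shows "AE x in leb01. (w x :: complex) = 0"
proof (rule zero_integrals_imp_AE_zero[OF w])
  fix a b :: real assume ab: "0 < a" "a < b" "b < 1"
  have "(\<lambda>n. LINT x|leb01. bump a b n x *\<^sub>R w x) \<longlonglongrightarrow> (LINT x|leb01. (indicator {a<..<b} x :: real) *\<^sub>R w x)"
  proof (rule integral_dominated_convergence)
    show "integrable leb01 (\<lambda>x. norm (w x))" using w by simp
    show "(\<lambda>x. (indicator {a<..<b} x :: real) *\<^sub>R w x) \<in> borel_measurable leb01"
      using w by (intro borel_measurable_integrable integrable_mult_indicator) 
        (use ab in \<open>auto simp: sets_restrict_space_iff\<close>)
    show "(\<lambda>x. bump a b n x *\<^sub>R w x) \<in> borel_measurable leb01" for n
      by (intro borel_measurable_integrable integrable_scaleR01 smooth01_continuous smooth01_bump w)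
    show "AE x in leb01. (\<lambda>n. bump a b n x *\<^sub>R w x) \<longlonglongrightarrow> (indicator {a<..<b} x :: real) *\<^sub>R w x"
      by (intro AE_I2 tendsto_scaleR bump_tendsto tendsto_const)
    show "AE x in leb01. norm (bump a b n x *\<^sub>R w x) \<le> norm (w x)" for n
      using bump_bounds by (intro AE_I2) (simp add: mult_left_le_one_le)
  qed
  then have "(LINT x|leb01. (indicator {a<..<b} x :: real) *\<^sub>R w x) = 0"
    using zero[OF test_function_bump[OF ab]] by (simp add: LIMSEQ_const_iff)
  then show "integral {a..b} w = 0"
    using integral_indicator01[OF w, of "{a<..<b}"] ab by (simp add: integral_open_interval_real subset_iff)
qed

lemma test_function_deriv:
  assumes "test_function \<psi>" shows "test_function (deriv01 \<psi>)"
proof -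
  from assms obtain a b where ab: "0 < a" "a \<le> b" "b < 1" "\<And>x. x \<in> {0..1} - {a..b} \<Longrightarrow> \<psi> x = 0" and s: "smooth01 \<psi>"
    unfolding test_function_def by auto
  have "deriv01 \<psi> x = 0" if x: "x \<in> {0..1} - {a..b}" for x
  proof -
    have "((\<lambda>x. 0) has_vector_derivative 0) (at x within {0..1})" by simp
    moreover define d where "d = (if x < a then a - x else x - b)"
    have "0 < d" using x by (auto simp: d_def)
    moreover have "0 = \<psi> t" if "t \<in> {0..1}" "dist t x < d" for t
    proof -
      have "t \<in> {0..1} - {a..b}" using that x by (auto simp: d_def dist_real_def split: if_splits)
      from ab(4)[OF this] show ?thesis by simp
    qed
    ultimately have "(\<psi> has_vector_derivative 0) (at x within {0..1})"
      using x by (intro has_vector_derivative_transform_within[of "\<lambda>x. 0" 0 x "{0..1}" d \<psi>]) auto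
    then show ?thesis using deriv01_eq x by blast
  qed
  then show ?thesis
    unfolding test_function_def using smooth01_deriv(1)[OF s] ab by blast
qed

lemma test_function_iter: "test_function \<psi> \<Longrightarrow> test_function ((deriv01 ^^ n) \<psi>)"
  by (induction n) (auto intro: test_function_deriv)

lemma integral_by_parts01:
  assumes p: "prim u v" and t: "test_function \<psi>"
  shows "(LINT x|leb01. deriv01 \<psi> x *\<^sub>R u x) = - (LINT x|leb01. \<psi> x *\<^sub>R v x)"
proof -
  note s = test_functionD(1)[OF t]
  have q: "prim (\<lambda>x. \<psi> x *\<^sub>R u x) (\<lambda>x. deriv01 \<psi> x *\<^sub>R u x + \<psi> x *\<^sub>R v x)"
    by (rule prim_scaleR[OF p s])
  have i: "integrable leb01 (\<lambda>x. deriv01 \<psi> x *\<^sub>R u x)" "integrable leb01 (\<lambda>x. \<psi> x *\<^sub>R v x)"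
    by (intro integrable_scaleR01 smooth01_continuous smooth01_deriv(1) s integrable_continuous01 prim_continuous[OF p]
        prim_integrable[OF p])+
  have "(LINT x|leb01. deriv01 \<psi> x *\<^sub>R u x) + (LINT x|leb01. \<psi> x *\<^sub>R v x)
      = (LINT x|leb01. deriv01 \<psi> x *\<^sub>R u x + \<psi> x *\<^sub>R v x)"
    using i by simp
  also have "\<dots> = integral {0..1} (\<lambda>x. deriv01 \<psi> x *\<^sub>R u x + \<psi> x *\<^sub>R v x)"
    by (rule lebesgue_integral_eq_integral[OF prim_integrable[OF q]]) simp
  also have "\<dots> = 0" using prim_eq[OF q, of 1] test_functionD(2,3)[OF t] by simp
  finally show ?thesis by (simp add: eq_neg_iff_add_eq_0)
qed

lemma test_function_primitive:
  assumes t: "test_function \<theta>" and z: "integral {0..1} \<theta> = 0"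
  obtains \<Theta> where "test_function \<Theta>" "\<And>x. x \<in> {0..1} \<Longrightarrow> deriv01 \<Theta> x = \<theta> x"
proof
  define \<Theta> where "\<Theta> x = integral {0..x} \<theta>" for x
  from t obtain a b where ab: "0 < a" "a \<le> b" "b < 1" "\<And>x. x \<in> {0..1} - {a..b} \<Longrightarrow> \<theta> x = 0" and s: "smooth01 \<theta>"
    unfolding test_function_def by auto
  have d: "(\<Theta> has_vector_derivative \<theta> x) (at x within {0..1})" if "x \<in> {0..1}" for x
    unfolding \<Theta>_def by (rule integral_has_vector_derivative[OF smooth01_continuous[OF s] that])
  then show "deriv01 \<Theta> x = \<theta> x" if "x \<in> {0..1}" for x using deriv01_eq[OF d that] that by blast
  have "\<Theta> x = 0" if x: "x \<in> {0..1} - {a..b}" for x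
  proof (cases "x < a")
    case True
    then have "integral {0..x} \<theta> = integral {0..x} (\<lambda>_. 0)"
      using ab x by (intro Henstock_Kurzweil_Integration.integral_cong) auto
    then show ?thesis by (simp add: \<Theta>_def)
  next
    case False
    then have "integral {x..1} \<theta> = integral {x..1} (\<lambda>_. 0)"
      using ab x by (intro Henstock_Kurzweil_Integration.integral_cong) auto
    then show ?thesis
      using integral_diff01[OF integrable_continuous01[OF smooth01_continuous[OF s]], of x 1] z x
      by (simp add: \<Theta>_def)
  qed
  moreover have "smooth01 \<Theta>" by (rule smooth01_of_deriv[OF d s])
  ultimately show "test_function \<Theta>" unfolding test_function_def using ab by blast
qed

lemma test_function_lincomb:
  assumes "test_function \<psi>" "test_function \<eta>"
  shows "test_function (\<lambda>x. \<psi> x - c * \<eta> x)"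
proof -
  obtain a b a' b' where ab: "0 < a" "a \<le> b" "b < 1" "\<And>x. x \<in> {0..1} - {a..b} \<Longrightarrow> \<psi> x = 0"
    "0 < a'" "a' \<le> b'" "b' < 1" "\<And>x. x \<in> {0..1} - {a'..b'} \<Longrightarrow> \<eta> x = 0"
    using assms unfolding test_function_def by auto
  have "smooth01 (\<lambda>x. \<psi> x + (- c) * \<eta> x)"
    by (intro smooth01_add smooth01_mult smooth01_const test_functionD(1) assms)
  moreover have "\<psi> x - c * \<eta> x = 0" if "x \<in> {0..1} - {min a a'..max b b'}" for x
  proof -
    have "x \<in> {0..1} - {a..b}" "x \<in> {0..1} - {a'..b'}" using that by auto
    from ab(4)[OF this(1)] ab(8)[OF this(2)] show ?thesis by simp
  qed
  ultimately show ?thesis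
    unfolding test_function_def using ab
    by (intro conjI exI[of _ "min a a'"] exI[of _ "max b b'"] ballI) auto
qed

text \<open>The lemma of du Bois-Reymond: a test function of mean zero is the derivative of a test function.\<close>
lemma weak_deriv_zero_imp_constant:
  assumes w: "integrable leb01 w" and zero: "\<And>\<psi>. test_function \<psi> \<Longrightarrow> (LINT x|leb01. deriv01 \<psi> x *\<^sub>R w x) = 0"
  obtains c :: complex where "AE x in leb01. w x = c"
proof -
  define \<eta> where "\<eta> = bump (1/4) (3/4) 0"
  have \<eta>: "test_function \<eta>" unfolding \<eta>_def by (rule test_function_bump) auto
  define I where "I = integral {0..1} \<eta>"
  have "I \<noteq> 0"
  proof
    assume "I = 0"
    then have "\<forall>x\<in>{0..1}. \<eta> x = 0"
      unfolding I_def using smooth01_continuous[OF test_functionD(1)[OF \<eta>]] bump_bounds(1)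
      by (subst (asm) integral_eq_0_iff) (auto simp: \<eta>_def)
    then show False using bump_pos[of "1/4" "1/2" "3/4" 0] by (auto simp: \<eta>_def dest: bspec[of _ _ "1/2"])
  qed
  define c where "c = (1 / I) *\<^sub>R (LINT x|leb01. \<eta> x *\<^sub>R w x)"
  have i: "integrable leb01 (\<lambda>x. \<psi> x *\<^sub>R w x)" if "test_function \<psi>" for \<psi>
    by (intro integrable_scaleR01 smooth01_continuous test_functionD(1)[OF that] w)
  have "AE x in leb01. w x - c = 0"
  proof (rule test_functions_separate)
    show "integrable leb01 (\<lambda>x. w x - c)" using w by simp
    fix \<psi> assume \<psi>: "test_function \<psi>"
    have ri: "integrable leb01 \<psi>" using smooth01_continuous[OF test_functionD(1)[OF \<psi>]] by (rule integrable_continuous01)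
    have rc: "integrable leb01 \<eta>" using smooth01_continuous[OF test_functionD(1)[OF \<eta>]] by (rule integrable_continuous01)
    define A where "A = integral {0..1} \<psi>"
    have A: "(LINT x|leb01. \<psi> x) = A" unfolding A_def by (rule lebesgue_integral_eq_integral[OF ri]) simp
    let ?\<theta> = "\<lambda>x. \<psi> x - (A / I) * \<eta> x"
    have \<theta>: "test_function ?\<theta>" by (rule test_function_lincomb[OF \<psi> \<eta>])
    have "(?\<theta> has_integral A - (A / I) * I) {0..1}"
      unfolding A_def[symmetric] using integrable_sub01(1)[OF ri, of 0 1] integrable_sub01(1)[OF rc, of 0 1]
      by (intro has_integral_diff has_integral_mult_right) (auto simp: A_def I_def integrable_integral)
    then have "integral {0..1} ?\<theta> = A - (A / I) * I" by (rule integral_unique)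
    then have "integral {0..1} ?\<theta> = 0" using \<open>I \<noteq> 0\<close> by simp
    then obtain \<Theta> where T: "test_function \<Theta>" "\<And>x. x \<in> {0..1} \<Longrightarrow> deriv01 \<Theta> x = ?\<theta> x"
      by (rule test_function_primitive[OF \<theta>]) blast
    have "0 = (LINT x|leb01. deriv01 \<Theta> x *\<^sub>R w x)" using zero[OF T(1)] by simp
    also have "\<dots> = (LINT x|leb01. \<psi> x *\<^sub>R w x - (A / I) *\<^sub>R (\<eta> x *\<^sub>R w x))"
      by (intro Bochner_Integration.integral_cong refl) (simp only: space_lebesgue_on T(2) scaleR_diff_left scaleR_scaleR)
    also have "\<dots> = (LINT x|leb01. \<psi> x *\<^sub>R w x) - (A / I) *\<^sub>R (LINT x|leb01. \<eta> x *\<^sub>R w x)"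
      by (simp only: Bochner_Integration.integral_diff[OF i[OF \<psi>] integrable_scaleR_right[OF i[OF \<eta>]]]
          integral_scaleR_right)
    also have "(A / I) *\<^sub>R (LINT x|leb01. \<eta> x *\<^sub>R w x) = A *\<^sub>R c" by (simp add: c_def)
    finally have "(LINT x|leb01. \<psi> x *\<^sub>R w x) = A *\<^sub>R c" by simp
    moreover have "(LINT x|leb01. \<psi> x *\<^sub>R (w x - c)) = (LINT x|leb01. \<psi> x *\<^sub>R w x) - (LINT x|leb01. \<psi> x *\<^sub>R c)"
      using i[OF \<psi>] ri by (simp add: scaleR_diff_right)
    ultimately show "(LINT x|leb01. \<psi> x *\<^sub>R (w x - c)) = 0"
      using A ri by simp
  qed
  then show ?thesis using that by simp
qed

section \<open>Sobolev spaces and continuous representatives\<close>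

lemma has_weak_deriv_cong:
  assumes h: "has_weak_deriv n u v" and u: "AE x in leb01. u x = u' x" and v: "AE x in leb01. v x = v' x"
  shows "has_weak_deriv n u' v'"
proof -
  have i: "integrable leb01 u" "integrable leb01 v" using h by (auto simp: has_weak_deriv_def)
  have i': "integrable leb01 u'" "integrable leb01 v'" using integrable_AE01[OF i(1) u] integrable_AE01[OF i(2) v] by auto
  have eq: "(LINT x|leb01. \<psi> x *\<^sub>R f x) = (LINT x|leb01. \<psi> x *\<^sub>R g x)"
    if "test_function \<psi>" "AE x in leb01. f x = g x" "integrable leb01 f" "integrable leb01 g"
    for \<psi> and f g :: "real \<Rightarrow> complex"
    using that smooth01_continuous[OF test_functionD(1)[OF that(1)]]
    by (intro integral_cong_AE borel_measurable_integrable integrable_scaleR01) (auto elim: eventually_mono)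
  show ?thesis
    unfolding has_weak_deriv_def
  proof (intro conjI allI impI i')
    fix \<psi> assume t: "test_function \<psi>"
    have "(LINT x|leb01. (deriv01 ^^ n) \<psi> x *\<^sub>R u x) = (-1) ^ n * (LINT x|leb01. \<psi> x *\<^sub>R v x)"
      using h t by (simp add: has_weak_deriv_def)
    then show "(LINT x|leb01. (deriv01 ^^ n) \<psi> x *\<^sub>R u' x) = (-1) ^ n * (LINT x|leb01. \<psi> x *\<^sub>R v' x)"
      using eq[OF test_function_iter[OF t] u i(1) i'(1)] eq[OF t v i(2) i'(2)] by simp
  qed
qed

lemma has_weak_deriv_unique:
  assumes "has_weak_deriv n u v" "has_weak_deriv n u v'" shows "AE x in leb01. v x = v' x"
proof -
  have i: "integrable leb01 v" "integrable leb01 v'" using assms by (auto simp: has_weak_deriv_def)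
  have "AE x in leb01. v x - v' x = 0"
  proof (rule test_functions_separate)
    show "integrable leb01 (\<lambda>x. v x - v' x)" using i by simp
    fix \<psi> assume t: "test_function \<psi>"
    have "(-1) ^ n * (LINT x|leb01. \<psi> x *\<^sub>R v x) = (-1) ^ n * (LINT x|leb01. \<psi> x *\<^sub>R v' x)"
      using assms t by (simp add: has_weak_deriv_def)
    then have "(LINT x|leb01. \<psi> x *\<^sub>R v x) = (LINT x|leb01. \<psi> x *\<^sub>R v' x)" by simp
    moreover have "integrable leb01 (\<lambda>x. \<psi> x *\<^sub>R v x)" "integrable leb01 (\<lambda>x. \<psi> x *\<^sub>R v' x)"
      by (intro integrable_scaleR01 smooth01_continuous test_functionD(1)[OF t] i)+
    ultimately show "(LINT x|leb01. \<psi> x *\<^sub>R (v x - v' x)) = 0"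
      by (simp add: scaleR_diff_right)
  qed
  then show ?thesis by simp
qed

lemma has_weak_deriv_0: "integrable leb01 u \<Longrightarrow> has_weak_deriv 0 u u"
  by (simp add: has_weak_deriv_def)

text \<open>Integration by parts against the \<open>n\<close>-th derivative of the test function.\<close>
lemma has_weak_deriv_prim:
  assumes p: "prim u v" and v: "has_weak_deriv n v w" shows "has_weak_deriv (Suc n) u w"
  unfolding has_weak_deriv_def
proof (intro conjI allI impI)
  show "integrable leb01 u" using integrable_continuous01[OF prim_continuous[OF p]] .
  show "integrable leb01 w" using v by (simp add: has_weak_deriv_def)
  fix \<psi> assume t: "test_function \<psi>"
  have "(LINT x|leb01. (deriv01 ^^ Suc n) \<psi> x *\<^sub>R u x) = - (LINT x|leb01. (deriv01 ^^ n) \<psi> x *\<^sub>R v x)"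
    using integral_by_parts01[OF p test_function_iter[OF t]] by simp
  also have "(LINT x|leb01. (deriv01 ^^ n) \<psi> x *\<^sub>R v x) = (-1) ^ n * (LINT x|leb01. \<psi> x *\<^sub>R w x)"
    using v t by (simp add: has_weak_deriv_def)
  finally show "(LINT x|leb01. (deriv01 ^^ Suc n) \<psi> x *\<^sub>R u x) = (-1) ^ Suc n * (LINT x|leb01. \<psi> x *\<^sub>R w x)"
    by simp
qed

text \<open>The difference of \<open>v\<close> and a primitive of \<open>v'\<close> has weak derivative zero, hence is constant.\<close>
lemma prim_of_weak_derivs:
  assumes v: "has_weak_deriv n u v" and v': "has_weak_deriv (Suc n) u v'"
  obtains w where "prim w v'" "AE x in leb01. v x = w x"
proof -
  have i: "integrable leb01 v" "integrable leb01 v'" using assms by (auto simp: has_weak_deriv_def)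
  let ?F = "J 0 v'"
  have F: "prim ?F v'" by (rule prim_J[OF i(2)])
  have Fi: "integrable leb01 ?F" by (rule integrable_continuous01[OF prim_continuous[OF F]])
  have "(LINT x|leb01. deriv01 \<psi> x *\<^sub>R (v x - ?F x)) = 0" if t: "test_function \<psi>" for \<psi>
  proof -
    have "(LINT x|leb01. (deriv01 ^^ n) (deriv01 \<psi>) x *\<^sub>R u x) = (-1) ^ n * (LINT x|leb01. deriv01 \<psi> x *\<^sub>R v x)"
      using v test_function_deriv[OF t] by (simp add: has_weak_deriv_def)
    moreover have "(LINT x|leb01. (deriv01 ^^ Suc n) \<psi> x *\<^sub>R u x) = (-1) ^ Suc n * (LINT x|leb01. \<psi> x *\<^sub>R v' x)"
      using v' t by (simp add: has_weak_deriv_def)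
    ultimately have "(-1) ^ n * (LINT x|leb01. deriv01 \<psi> x *\<^sub>R v x) = (-1) ^ n * - (LINT x|leb01. \<psi> x *\<^sub>R v' x)"
      by (simp add: funpow_swap1)
    then have "(LINT x|leb01. deriv01 \<psi> x *\<^sub>R v x) = (LINT x|leb01. deriv01 \<psi> x *\<^sub>R ?F x)"
      unfolding integral_by_parts01[OF F t] by (subst (asm) mult_left_cancel) auto
    moreover have "integrable leb01 (\<lambda>x. deriv01 \<psi> x *\<^sub>R v x)" "integrable leb01 (\<lambda>x. deriv01 \<psi> x *\<^sub>R ?F x)"
      by (intro integrable_scaleR01 smooth01_continuous test_functionD(1)[OF test_function_deriv[OF t]] i Fi)+
    ultimately show ?thesis by (simp add: scaleR_diff_right)
  qed
  with i(1) Fi obtain c where c: "AE x in leb01. v x - ?F x = c"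
    by (rule weak_deriv_zero_imp_constant[OF Bochner_Integration.integrable_diff]) blast
  show ?thesis
  proof (rule that[of "\<lambda>x. ?F x + c"])
    show "prim (\<lambda>x. ?F x + c) v'" using prim_add[OF F prim_const[of c]] by simp
    show "AE x in leb01. v x = ?F x + c" using c by (rule eventually_mono) (simp add: algebra_simps)
  qed
qed

lemma Sob_weak_deriv:
  assumes "u \<in> Sob m" "i \<le> m"
  shows "has_weak_deriv i u (weak_deriv i u)" "weak_deriv i u \<in> L2" "L2_norm (weak_deriv i u) \<le> Sob_norm m u"
proof -
  obtain v where v: "v \<in> L2" "has_weak_deriv i u v" using assms by (auto simp: Sob_def)
  show h: "has_weak_deriv i u (weak_deriv i u)" unfolding weak_deriv_def using v(2) by (rule someI[of "has_weak_deriv i u"])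
  show "weak_deriv i u \<in> L2" using L2_AE(1)[OF v(1) has_weak_deriv_unique[OF v(2) h]] .
  have "(L2_norm (weak_deriv i u))\<^sup>2 \<le> (\<Sum>i\<le>m. (L2_norm (weak_deriv i u))\<^sup>2)"
    by (rule member_le_sum) (use assms(2) in auto)
  then show "L2_norm (weak_deriv i u) \<le> Sob_norm m u"
    unfolding Sob_norm_def using real_le_rsqrt by blast
qed

text \<open>The one-dimensional Sobolev embedding, by averaging \<open>u(x) = u(t) + \<integral>\<^sub>t\<^sup>x v\<close> over \<open>t\<close>.\<close>
lemma prim_sup_bound:
  assumes p: "prim u v" and x: "x \<in> {0..1}"
  shows "norm (u x) \<le> (LINT t|leb01. norm (u t)) + (LINT t|leb01. norm (v t))"
proof -
  have ui: "integrable leb01 u" by (rule integrable_continuous01[OF prim_continuous[OF p]])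
  let ?V = "LINT t|leb01. norm (v t)"
  have "norm (u x) \<le> norm (u t) + ?V" if t: "t \<in> {0..1}" for t
  proof -
    have "norm (u x - u t) \<le> ?V"
      using J_bound[OF prim_integrable[OF p] x t] J_prim[OF p x t] by simp
    then show ?thesis using norm_triangle_sub[of "u x" "u t"] by simp
  qed
  then have "(LINT t|leb01. norm (u x)) \<le> (LINT t|leb01. norm (u t) + ?V)"
    using ui by (intro integral_mono) auto
  then show ?thesis using ui by (simp add: measure_leb01)
qed

text \<open>Starting from the weak derivative of top order, each lower one is replaced by the primitive of the next that is
  equal to it almost everywhere; the supremum bound costs the factor \<open>2\<close>.\<close>
lemma Sob_imp_jet_ball:
  assumes u: "u \<in> Sob m"
  obtains w where "AE x in leb01. u x = w x" "jet_ball False m w (2 * Sob_norm m u)"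
proof -
  let ?N = "Sob_norm m u"
  have N: "0 \<le> ?N" by (simp add: Sob_norm_def sum_nonneg)
  have "\<exists>w. (AE x in leb01. weak_deriv (m - j) u x = w x) \<and> jet_ball False j w (2 * ?N)" if "j \<le> m" for j
    using that
  proof (induction j)
    case 0
    show ?case using Sob_weak_deriv[OF u, of m] N by (intro exI[of _ "weak_deriv m u"]) auto
  next
    case (Suc j)
    let ?i = "m - Suc j"
    have i: "Suc ?i = m - j" using Suc.prems by simp
    obtain w where w: "AE x in leb01. weak_deriv (Suc ?i) u x = w x" "jet_ball False j w (2 * ?N)"
      using Suc unfolding i by auto
    obtain g where g: "prim g (weak_deriv (Suc ?i) u)" "AE x in leb01. weak_deriv ?i u x = g x"
      by (rule prim_of_weak_derivs[OF Sob_weak_deriv(1)[OF u] Sob_weak_deriv(1)[OF u], of ?i])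
        (use Suc.prems in auto)
    have gw: "prim g w" using prim_cong[OF g(1) _ w(1), of g] by simp
    have "jet_ball False (Suc j) g (2 * ?N)"
    proof (rule jet_ball_SucI[OF gw w(2)])
      fix x :: real assume x: "x \<in> {0..1}"
      have gL: "g \<in> L2" "L2_norm g \<le> ?N"
        using L2_AE[OF Sob_weak_deriv(2)[OF u] g(2)] Sob_weak_deriv(3)[OF u, of ?i] by auto
      have dL: "weak_deriv (Suc ?i) u \<in> L2" "L2_norm (weak_deriv (Suc ?i) u) \<le> ?N"
        using Sob_weak_deriv(2,3)[OF u, of "Suc ?i"] Suc.prems by auto
      show "norm (g x) \<le> 2 * ?N"
        using prim_sup_bound[OF g(1) x] L1_le_L2[OF gL(1)] L1_le_L2[OF dL(1)] gL(2) dL(2) by linarith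
    qed auto
    with g(2) show ?case by blast
  qed
  from this[of m] obtain w where w: "AE x in leb01. weak_deriv 0 u x = w x" "jet_ball False m w (2 * ?N)" by auto
  have "u \<in> L2" using u by (simp add: Sob_def)
  then have "AE x in leb01. u x = weak_deriv 0 u x"
    using has_weak_deriv_unique[OF has_weak_deriv_0 Sob_weak_deriv(1)[OF u]] L2_integrable by blast
  with w(1) have "AE x in leb01. u x = w x" by eventually_elim simp
  with that w(2) show ?thesis by blast
qed

lemma jet_ball_weak_derivs:
  assumes "jet_ball False m u M" "i \<le> m"
  shows "\<exists>v. has_weak_deriv i u v \<and> v \<in> L2 \<and> L2_norm v \<le> M"
  using assms
proof (induction i arbitrary: m u)
  case 0
  then show ?case using has_weak_deriv_0[OF jet_ball_integrable] jet_ball_L2 by blast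
next
  case (Suc i)
  then obtain m' where m: "m = Suc m'" by (cases m) auto
  obtain v where v: "prim u v" "jet_ball False m' v M" using Suc.prems(1) unfolding m by (rule jet_ball_SucE) blast
  show ?case using Suc.IH[OF v(2)] Suc.prems(2) has_weak_deriv_prim[OF v(1)] unfolding m by blast
qed

lemma weak_deriv_AE:
  assumes h: "has_weak_deriv i w v" and ae: "AE x in leb01. u x = w x"
  shows "AE x in leb01. weak_deriv i u x = v x" "has_weak_deriv i u (weak_deriv i u)"
proof -
  have "AE x in leb01. w x = u x" using ae by (rule eventually_mono) simp
  then have h': "has_weak_deriv i u v" by (rule has_weak_deriv_cong[OF h]) simp
  then show 1: "has_weak_deriv i u (weak_deriv i u)" unfolding weak_deriv_def by (rule someI[of "has_weak_deriv i u"])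
  show "AE x in leb01. weak_deriv i u x = v x" by (rule has_weak_deriv_unique[OF 1 h'])
qed

lemma jet_ball_imp_Sob:
  assumes w: "jet_ball False m w M" and ae: "AE x in leb01. u x = w x"
  shows "u \<in> Sob m" "Sob_norm m u \<le> real (Suc m) * M"
proof -
  have ae': "AE x in leb01. w x = u x" using ae by (rule eventually_mono) simp
  have d: "\<exists>v\<in>L2. has_weak_deriv i u v \<and> L2_norm v \<le> M" if i: "i \<le> m" for i
  proof -
    obtain v where v: "has_weak_deriv i w v" "v \<in> L2" "L2_norm v \<le> M" using jet_ball_weak_derivs[OF w i] by blast
    have "has_weak_deriv i u v" by (rule has_weak_deriv_cong[OF v(1) ae']) simp
    with v show ?thesis by blast
  qed
  show "u \<in> Sob m"
    unfolding Sob_def using L2_AE(1)[OF _ ae'] jet_ball_L2[OF w] d by auto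
  have M: "0 \<le> M" using jet_ball_nonneg[OF w] .
  have "L2_norm (weak_deriv i u) \<le> M" if i: "i \<le> m" for i
  proof -
    obtain v where v: "has_weak_deriv i w v" "v \<in> L2" "L2_norm v \<le> M" using jet_ball_weak_derivs[OF w i] by blast
    have "AE x in leb01. v x = weak_deriv i u x"
      using weak_deriv_AE(1)[OF v(1) ae] by (rule eventually_mono) simp
    from L2_AE(2)[OF v(2) this] v(3) show ?thesis by simp
  qed
  then have "(\<Sum>i\<le>m. (L2_norm (weak_deriv i u))\<^sup>2) \<le> (\<Sum>i\<le>m. M\<^sup>2)"
    by (intro sum_mono power_mono L2_norm_nonneg) auto
  also have "\<dots> \<le> (real (Suc m) * M)\<^sup>2"
    using M by (simp add: power_mult_distrib power2_eq_square mult_right_mono algebra_simps)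
  finally show "Sob_norm m u \<le> real (Suc m) * M"
    unfolding Sob_norm_def using M by (intro real_le_lsqrt) (auto simp: sum_nonneg)
qed

lemma jet_ball_jets:
  assumes "jet_ball Z m u M" "i < m"
  shows "jet_ball Z (m - i) ((deriv01 ^^ i) u) M"
  using assms(2)
proof (induction i)
  case (Suc i)
  then have "m - i = Suc (Suc (m - Suc (Suc i)))" "m - Suc i = Suc (m - Suc (Suc i))" by auto
  with Suc jet_ball_deriv(2)[of Z "m - Suc (Suc i)" "(deriv01 ^^ i) u" M] show ?case by simp
qed (use assms in simp)

lemma has_weak_deriv_jets:
  assumes "jet_ball Z m u M" "i < m" shows "has_weak_deriv i u ((deriv01 ^^ i) u)"
  using assms
proof (induction i arbitrary: m u)
  case 0 then show ?case using has_weak_deriv_0[OF jet_ball_integrable] by simp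
next
  case (Suc i)
  then obtain n where m: "m = Suc (Suc n)" by (metis Suc_lessE less_imp_Suc_add)
  note d = jet_ball_deriv[OF Suc.prems(1)[unfolded m]]
  have "has_weak_deriv i (deriv01 u) ((deriv01 ^^ i) (deriv01 u))"
    using Suc.IH[OF d(2)] Suc.prems(2) m by simp
  from has_weak_deriv_prim[OF d(1) this] show ?case by (simp add: funpow_swap1)
qed

lemma weak_deriv_prim2:
  assumes "prim2 w v" "AE x in leb01. u x = w x" shows "AE x in leb01. weak_deriv 2 u x = v x"
proof -
  obtain g where g: "prim w g" "prim g v" using assms(1) by (auto simp: prim2_def)
  have "has_weak_deriv (Suc (Suc 0)) w v"
    by (intro has_weak_deriv_prim[OF g(1)] has_weak_deriv_prim[OF g(2)] has_weak_deriv_0 prim_integrable[OF g(2)])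
  then have "has_weak_deriv 2 w v" by (simp only: numeral_2_eq_2)
  from weak_deriv_AE(1)[OF this assms(2)] show ?thesis .
qed

lemma has_value_at_iff:
  assumes g: "continuous_on {0..1} g" and ae: "AE x in leb01. u x = g x" and z: "z \<in> {0..1}"
  shows "has_value_at u z c \<longleftrightarrow> g z = c"
proof
  assume "has_value_at u z c"
  then obtain h where h: "continuous_on {0..1} h" "AE x in leb01. u x = h x" "h z = c"
    by (auto simp: has_value_at_def)
  from ae h(2) have "AE x in leb01. g x = h x" by eventually_elim simp
  from AE_eq_continuous01[OF g h(1) this z] h(3) show "g z = c" by simp
qed (use assms in \<open>auto simp: has_value_at_def\<close>)

section \<open>Jets at the end points\<close>

declare jet_ball.simps(2) [simp del]

lemma jets_lincomb:
  assumes u: "jet_ball False m u M" and v: "jet_ball False m v N" and i: "i < m" and x: "x \<in> {0..1}"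
  shows "(deriv01 ^^ i) (\<lambda>x. c * u x + d * v x) x = c * (deriv01 ^^ i) u x + d * (deriv01 ^^ i) v x"
  using i x
proof (induction i arbitrary: x)
  case (Suc i)
  let ?f = "(deriv01 ^^ i) u" and ?g = "(deriv01 ^^ i) v"
  have e: "m - i = Suc (Suc (m - Suc (Suc i)))" using Suc.prems by simp
  have f: "jet_ball False (Suc (Suc (m - Suc (Suc i)))) ?f M" "jet_ball False (Suc (Suc (m - Suc (Suc i)))) ?g N"
    using jet_ball_jets[OF u, of i] jet_ball_jets[OF v, of i] Suc.prems unfolding e by simp_all
  have "deriv01 ((deriv01 ^^ i) (\<lambda>x. c * u x + d * v x)) x = deriv01 (\<lambda>x. c * ?f x + d * ?g x) x"
    by (rule deriv01_cong) (use Suc in auto)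
  also have "\<dots> = c * deriv01 ?f x + d * deriv01 ?g x"
    by (rule prim_deriv(2)[OF prim_lincomb[OF jet_ball_deriv(1)[OF f(1)] jet_ball_deriv(1)[OF f(2)]] _ Suc.prems(2)])
      (intro continuous_intros jet_ball_continuous[OF jet_ball_deriv(2)[OF f(1)]]
        jet_ball_continuous[OF jet_ball_deriv(2)[OF f(2)]] zero_less_Suc)
  finally show ?case by simp
qed simp

lemma flat_jets:
  assumes "jet_ball True m u M" "i < m" "z \<in> {0, 1}" shows "(deriv01 ^^ i) u z = 0"
proof -
  have "m - i = Suc (m - Suc i)" using assms(2) by simp
  with jet_ball_jets[OF assms(1,2)] assms(3) show ?thesis by (auto simp: jet_ball.simps)
qed

text \<open>The flag of \<^const>\<open>jet_ball\<close> can be read off from the jets, because the representatives are continuous.\<close>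
lemma jet_ball_flatI:
  assumes "jet_ball False m u M" "\<And>i z. i < m \<Longrightarrow> z \<in> {0, 1} \<Longrightarrow> (deriv01 ^^ i) u z = 0"
  shows "jet_ball True m u M"
  using assms
proof (induction m arbitrary: u)
  case (Suc m)
  obtain v where v: "prim u v" "jet_ball False m v M" "\<And>x. x \<in> {0..1} \<Longrightarrow> norm (u x) \<le> M"
    using Suc.prems(1) by (rule jet_ball_SucE) blast
  have "jet_ball True m v M"
  proof (rule Suc.IH[OF v(2)])
    fix i and z :: real assume i: "i < m" and z: "z \<in> {0, 1}"
    then have z': "z \<in> {0..1}" by auto
    have "deriv01 u t = v t" if "t \<in> {0..1}" for t
      using prim_deriv(2)[OF v(1) jet_ball_continuous[OF v(2)] that] i by simp
    from deriv01_iter_cong[OF this z'] have "(deriv01 ^^ i) v z = (deriv01 ^^ Suc i) u z"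
      by (simp add: funpow_swap1)
    then show "(deriv01 ^^ i) v z = 0" using Suc.prems(2)[of "Suc i" z] i z by simp
  qed
  then show ?case
    using v Suc.prems(2)[of 0] by (intro jet_ball_SucI[OF v(1)]) auto
qed simp

lemma jets_of_real:
  assumes "smooth01 f" "x \<in> {0..1}"
  shows "(deriv01 ^^ n) (\<lambda>x. c * complex_of_real (f x)) x = c * complex_of_real ((deriv01 ^^ n) f x)"
  using assms
proof (induction n arbitrary: f x)
  case (Suc n)
  have "deriv01 (\<lambda>x. c * complex_of_real (f x)) t = c * complex_of_real (deriv01 f t)" if t: "t \<in> {0..1}" for t
    using deriv01_eq[OF has_vector_derivative_mult_right[OF has_vector_derivative_of_real[OF
          smooth01_deriv(2)[OF Suc.prems(1) t, folded has_real_derivative_iff_has_vector_derivative]]] t] .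
  from deriv01_iter_cong[OF this Suc.prems(2)]
  have "(deriv01 ^^ Suc n) (\<lambda>x. c * complex_of_real (f x)) x = (deriv01 ^^ n) (\<lambda>x. c * complex_of_real (deriv01 f x)) x"
    by (simp add: funpow_swap1)
  also have "\<dots> = c * complex_of_real ((deriv01 ^^ n) (deriv01 f) x)"
    by (rule Suc.IH[OF smooth01_deriv(1)[OF Suc.prems(1)] Suc.prems(2)])
  finally show ?case by (simp add: funpow_swap1)
qed simp

lemma jets_sum:
  assumes "finite I" "\<And>i. i \<in> I \<Longrightarrow> jet_ball False m (u i) (M i)" "n < m" "x \<in> {0..1}"
  shows "(deriv01 ^^ n) (\<lambda>x. \<Sum>i\<in>I. u i x) x = (\<Sum>i\<in>I. (deriv01 ^^ n) (u i) x)"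
  using assms(1,2)
proof (induction I rule: finite_induct)
  case empty
  show ?case
    using jets_lincomb[OF jet_ball_zero[of False m] jet_ball_zero[of False m] assms(3,4), of 0 0] by simp
next
  case (insert i I)
  have "jet_ball False m (\<lambda>x. \<Sum>i\<in>I. u i x) (\<Sum>i\<in>I. M i)"
    using insert by (intro jet_ball_sum) auto
  from jets_lincomb[OF insert.prems[of i] this assms(3,4), of 1 1] show ?case
    using insert by simp
qed

text \<open>The classical counterpart of \<^const>\<open>schr\<close>.\<close>
definition classical_schr :: "(real \<Rightarrow> real) \<Rightarrow> (real \<Rightarrow> complex) \<Rightarrow> real \<Rightarrow> complex" where
  "classical_schr V u x = (deriv01 ^^ 2) u x + V x *\<^sub>R u x"

lemma classical_schr_cong:
  assumes "\<And>t. t \<in> {0..1} \<Longrightarrow> u t = v t" "x \<in> {0..1}"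
  shows "classical_schr V u x = classical_schr V v x"
  using deriv01_iter_cong[OF assms] assms by (simp add: classical_schr_def)

lemma classical_schr_iter_cong:
  assumes "\<And>t. t \<in> {0..1} \<Longrightarrow> u t = v t" "x \<in> {0..1}"
  shows "(classical_schr V ^^ l) u x = (classical_schr V ^^ l) v x"
  using assms(2)
proof (induction l arbitrary: x)
  case (Suc l) then show ?case using classical_schr_cong[of "(classical_schr V ^^ l) u"] by simp
qed (use assms in simp)

lemma jet_ball_classical_schr:
  assumes V: "smooth01 V" and u: "jet_ball Z (m + 2) u M" and m: "0 < m"
  shows "\<exists>M'. jet_ball Z m (classical_schr V u) M'"
proof -
  obtain c where c: "\<And>u M. jet_ball Z m u M \<Longrightarrow> jet_ball Z m (\<lambda>x. V x *\<^sub>R u x) (c * M)"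
    using bounded_op_scaleR[OF V] by (rule bounded_opE) blast
  have "jet_ball Z m ((deriv01 ^^ 2) u) M" using jet_ball_jets[OF u, of 2] m by simp
  from jet_ball_add[OF this c[OF jet_ball_le[OF u]]] show ?thesis
    unfolding classical_schr_def[abs_def] by auto
qed

lemma jet_ball_classical_schr_iter:
  assumes V: "smooth01 V" and u: "jet_ball Z m u M" and l: "2 * l < m"
  shows "\<exists>M'. jet_ball Z (m - 2 * l) ((classical_schr V ^^ l) u) M'"
  using l
proof (induction l)
  case (Suc l)
  then obtain M' where "jet_ball Z (m - 2 * l) ((classical_schr V ^^ l) u) M'" by auto
  moreover have "m - 2 * l = (m - 2 * Suc l) + 2" using Suc.prems by simp
  ultimately have "jet_ball Z ((m - 2 * Suc l) + 2) ((classical_schr V ^^ l) u) M'" by (simp only:)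
  from jet_ball_classical_schr[OF V this] Suc.prems show ?case by simp
qed (use u in auto)

lemma schr_iter_AE:
  assumes V: "smooth01 V" and w: "jet_ball False m w M" and ae: "AE x in leb01. u x = w x" and l: "2 * l < m"
  shows "AE x in leb01. (schr V ^^ l) u x = (classical_schr V ^^ l) w x"
  using l
proof (induction l)
  case (Suc l)
  let ?g = "(classical_schr V ^^ l) w"
  obtain M' where "jet_ball False (m - 2 * l) ?g M'"
    using jet_ball_classical_schr_iter[OF V w] Suc.prems by force
  then have "has_weak_deriv 2 ?g ((deriv01 ^^ 2) ?g)"
    using Suc.prems by (intro has_weak_deriv_jets) auto
  moreover have ih: "AE x in leb01. (schr V ^^ l) u x = ?g x" using Suc by simp
  ultimately have "AE x in leb01. weak_deriv 2 ((schr V ^^ l) u) x = (deriv01 ^^ 2) ?g x"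
    by (rule weak_deriv_AE(1))
  with ih show ?case
    by eventually_elim
      (simp add: schr_def[of V "(schr V ^^ l) u"] classical_schr_def[of V ?g] scaleR_conv_of_real)
qed (use ae in simp)

lemma classical_schr_iter_add:
  assumes V: "smooth01 V" and u: "jet_ball False m u M" and v: "jet_ball False m v N"
    and l: "2 * l < m" and x: "x \<in> {0..1}"
  shows "(classical_schr V ^^ l) (\<lambda>x. u x + v x) x = (classical_schr V ^^ l) u x + (classical_schr V ^^ l) v x"
  using l x
proof (induction l arbitrary: x)
  case (Suc l)
  let ?f = "(classical_schr V ^^ l) u" and ?g = "(classical_schr V ^^ l) v"
  have l2: "2 * l < m" "2 < m - 2 * l" using Suc.prems by auto
  obtain A B where AB: "jet_ball False (m - 2 * l) ?f A" "jet_ball False (m - 2 * l) ?g B"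
    using jet_ball_classical_schr_iter[OF V u l2(1)] jet_ball_classical_schr_iter[OF V v l2(1)] by blast
  have "classical_schr V ((classical_schr V ^^ l) (\<lambda>x. u x + v x)) x = classical_schr V (\<lambda>x. ?f x + ?g x) x"
    using Suc by (intro classical_schr_cong) auto
  also have "\<dots> = classical_schr V ?f x + classical_schr V ?g x"
    using jets_lincomb[OF AB l2(2) Suc.prems(2), of 1 1]
    by (simp add: classical_schr_def[of V "\<lambda>x. ?f x + ?g x"] classical_schr_def[of V ?f]
        classical_schr_def[of V ?g] scaleR_add_right)
  finally show ?case by simp
qed simp

lemma classical_schr_iter_flat:
  assumes "smooth01 V" "jet_ball True m u M" "2 * l < m" "z \<in> {0, 1}"
  shows "(classical_schr V ^^ l) u z = 0"
proof -
  obtain M' where "jet_ball True (m - 2 * l) ((classical_schr V ^^ l) u) M'"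
    using jet_ball_classical_schr_iter[OF assms(1-3)] by blast
  from flat_jets[OF this, of 0 z] assms show ?thesis by simp
qed

text \<open>On a jet that vanishes below order \<open>2 l\<close>, only the leading term of \<open>(\<partial>\<^sup>2 + V)\<^sup>l\<close> contributes.\<close>
lemma classical_schr_iter_leading:
  assumes V: "smooth01 V" and z: "z \<in> {0, 1}"
    and "jet_ball True (2 * l) u M" "jet_ball False (2 * l + 1) u N"
  shows "(classical_schr V ^^ l) u z = (deriv01 ^^ (2 * l)) u z"
  using assms(3,4)
proof (induction l arbitrary: u M N)
  case (Suc l)
  have z': "z \<in> {0..1}" using z by auto
  let ?s = "classical_schr V u"
  obtain c where c: "\<And>u M. jet_ball True (2 * l + 1) u M \<Longrightarrow> jet_ball True (2 * l + 1) (\<lambda>x. V x *\<^sub>R u x) (c * M)"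
    using bounded_op_scaleR[OF V] by (rule bounded_opE) blast
  have Vu: "jet_ball True (2 * l + 1) (\<lambda>x. V x *\<^sub>R u x) (c * M)"
    by (rule c[OF jet_ball_le[OF Suc.prems(1)]]) simp
  have d: "jet_ball False (2 * l + 1) ((deriv01 ^^ 2) u) N"
    using jet_ball_jets[OF Suc.prems(2), of 2] by simp
  have s1: "\<exists>A. jet_ball True (2 * l) ?s A"
  proof (cases "l = 0")
    case True
    have "jet_ball False 1 ?s (N + c * M)"
      using jet_ball_add[OF d jet_ball_forget[OF Vu]] True by (simp add: classical_schr_def[abs_def] del: jet_ball.simps)
    from jet_ball_L2[OF this] show ?thesis using True by auto
  next
    case False
    have "jet_ball True (2 * l + 2) u M" using Suc.prems(1) by simp
    from jet_ball_classical_schr[OF V this] False show ?thesis by simp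
  qed
  have "jet_ball False ((2 * l + 1) + 2) u N" using Suc.prems(2) by (simp add: numeral_eq_Suc del: jet_ball.simps)
  from jet_ball_classical_schr[OF V this] have s2: "\<exists>A. jet_ball False (2 * l + 1) ?s A" by simp
  have "(classical_schr V ^^ Suc l) u z = (classical_schr V ^^ l) ?s z" by (simp add: funpow_swap1)
  also have "\<dots> = (deriv01 ^^ (2 * l)) ?s z" using Suc.IH s1 s2 by blast
  also have "\<dots> = (deriv01 ^^ (2 * l)) ((deriv01 ^^ 2) u) z + (deriv01 ^^ (2 * l)) (\<lambda>x. V x *\<^sub>R u x) z"
    using jets_lincomb[OF d jet_ball_forget[OF Vu] _ z', of "2 * l" 1 1] by (simp add: classical_schr_def[abs_def])
  also have "(deriv01 ^^ (2 * l)) (\<lambda>x. V x *\<^sub>R u x) z = 0" by (rule flat_jets[OF Vu _ z]) simp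
  also have "(deriv01 ^^ (2 * l)) ((deriv01 ^^ 2) u) z = (deriv01 ^^ (2 * l + 2)) u z"
    by (simp only: funpow_add comp_apply)
  finally show ?case by simp
qed simp

text \<open>Almost everywhere defined powers of \<open>\<partial>\<^sup>2 + V\<close> have the classical ones as continuous representatives as long as
  at least one derivative is left over.\<close>
lemma Sob_V_iff:
  assumes V: "smooth01 V" and w: "jet_ball False (2 * a) w M" and ae: "AE x in leb01. u x = w x"
  shows "u \<in> Sob_V V a \<longleftrightarrow> (\<forall>l<a. \<forall>z\<in>{0, 1}. (classical_schr V ^^ l) w z = 0)"
proof -
  have "has_value_at ((schr V ^^ l) u) z 0 \<longleftrightarrow> (classical_schr V ^^ l) w z = 0"
    if l: "l < a" and z: "z \<in> {0, 1}" for l z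
  proof (rule has_value_at_iff)
    obtain M' where "jet_ball False (2 * a - 2 * l) ((classical_schr V ^^ l) w) M'"
      using jet_ball_classical_schr_iter[OF V w, of l] l by auto
    then show "continuous_on {0..1} ((classical_schr V ^^ l) w)" using l by (intro jet_ball_continuous) auto
    show "AE x in leb01. (schr V ^^ l) u x = (classical_schr V ^^ l) w x"
      using schr_iter_AE[OF V w ae] l by simp
  qed (use z in auto)
  then show ?thesis using jet_ball_imp_Sob(1)[OF w ae] unfolding Sob_V_def by blast
qed

lemma Sob_Dir_iff:
  assumes w: "jet_ball False (2 * a) w M" and ae: "AE x in leb01. u x = w x"
  shows "u \<in> Sob_Dir a \<longleftrightarrow> (\<forall>l<a. \<forall>z\<in>{0, 1}. (deriv01 ^^ (2 * l)) w z = 0)"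
proof -
  have "has_value_at (weak_deriv (2 * l) u) z 0 \<longleftrightarrow> (deriv01 ^^ (2 * l)) w z = 0"
    if l: "l < a" and z: "z \<in> {0, 1}" for l z
  proof (rule has_value_at_iff)
    have "jet_ball False (2 * a - 2 * l) ((deriv01 ^^ (2 * l)) w) M"
      using jet_ball_jets[OF w, of "2 * l"] l by simp
    then show "continuous_on {0..1} ((deriv01 ^^ (2 * l)) w)" using l by (intro jet_ball_continuous) auto
    show "AE x in leb01. weak_deriv (2 * l) u x = (deriv01 ^^ (2 * l)) w x"
      using weak_deriv_AE(1)[OF has_weak_deriv_jets[OF w] ae] l by simp
  qed (use z in auto)
  then show ?thesis using jet_ball_imp_Sob(1)[OF w ae] unfolding Sob_Dir_def by blast
qed

section \<open>The conjugated operator\<close>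

locale conjugation = commuting T K for T K +
  fixes V :: "real \<Rightarrow> real"
  assumes V_smooth: "smooth01 V"
begin

abbreviation "E \<equiv> exp_series T"
abbreviation "E' \<equiv> exp_series (\<lambda>u x. - T u x)"

sublocale neg: smoothing "\<lambda>u x. - T u x" by (rule uminus)

definition conj_op :: "(real \<Rightarrow> complex) \<Rightarrow> real \<Rightarrow> complex" where
  "conj_op u = (\<lambda>x. op_exp (\<lambda>w x. - T w x) (schr V (op_exp T u)) x - weak_deriv 2 u x)"

text \<open>Since \<open>\<partial>\<^sup>2 e\<^sup>T = e\<^sup>T \<partial>\<^sup>2 + [\<partial>\<^sup>2, e\<^sup>T]\<close>, the conjugated operator is \<open>e\<^bsup>-T\<^esup> ([\<partial>\<^sup>2, e\<^sup>T] + V e\<^sup>T)\<close>, in which no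
  derivative of \<open>u\<close> is left.\<close>
definition conj_rep :: "(real \<Rightarrow> complex) \<Rightarrow> real \<Rightarrow> complex" where
  "conj_rep u = E' (\<lambda>x. exp_commutator u x + V x *\<^sub>R E u x)"

lemma conj_rep_bounded: "2 \<le> m \<Longrightarrow> bounded_op Z m m conj_rep"
  unfolding conj_rep_def[abs_def]
  by (intro bounded_op_compose[OF bounded_op_add[OF exp_commutator_bounded
        bounded_op_compose[OF exp_bounded bounded_op_scaleR[OF V_smooth]]] neg.exp_bounded])

lemma jet_ball_prim2_ex:
  assumes "jet_ball False 2 w M" obtains v where "prim2 w v" "v \<in> L2"
proof -
  have "jet_ball False (Suc (Suc 0)) w M" using assms by (simp only: numeral_2_eq_2)
  then obtain g where g: "prim w g" "jet_ball False (Suc 0) g M" by (rule jet_ball_SucE) blast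
  obtain v where v: "prim g v" "jet_ball False 0 v M" using g(2) by (rule jet_ball_SucE) blast
  show ?thesis using that[of v] g v by (auto simp: prim2_def)
qed

lemma exp_AE:
  assumes "w \<in> L2" "AE x in leb01. u x = w x"
  shows "AE x in leb01. op_exp T u x = E w x"
proof -
  have ae': "AE x in leb01. w x = u x" using assms(2) by (rule eventually_mono) simp
  have u: "u \<in> L2" using L2_AE(1)[OF assms(1) ae'] .
  from op_exp_eq(2)[OF u] exp_cong[OF u assms(2)] show ?thesis by eventually_elim simp
qed

text \<open>The conjugated operator may be computed from any second derivative \<open>r\<close> of \<open>e\<^sup>T w\<close>.\<close>
lemma conj_op_AE:
  assumes w: "w \<in> L2" and ae: "AE x in leb01. u x = w x" and v: "prim2 w v"
    and r: "prim2 (E w) r" "r \<in> L2"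
  shows "AE x in leb01. conj_op u x = E' (\<lambda>x. r x + V x *\<^sub>R E w x) x - v x"
proof -
  let ?q = "\<lambda>x. r x + V x *\<^sub>R E w x"
  have VE: "(\<lambda>x. V x *\<^sub>R E w x) \<in> L2"
    using bounded_op_L2[OF bounded_op_compose[OF exp_bounded bounded_op_scaleR[OF V_smooth]], of False 0 w "L2_norm w"] w
    by simp
  have q: "?q \<in> L2" by (rule L2_add(1)[OF r(2) VE])
  have e: "AE x in leb01. op_exp T u x = E w x" by (rule exp_AE[OF w ae])
  have s: "AE x in leb01. ?q x = schr V (op_exp T u) x"
    using weak_deriv_prim2[OF r(1) e] e by eventually_elim (simp add: schr_def scaleR_conv_of_real)
  have sL: "schr V (op_exp T u) \<in> L2" by (rule L2_AE(1)[OF q s])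
  have "AE x in leb01. weak_deriv 2 u x = v x" by (rule weak_deriv_prim2[OF v ae])
  with neg.op_exp_eq(2)[OF sL] neg.exp_cong[OF q s] show ?thesis
    by eventually_elim (simp add: conj_op_def)
qed

lemma conj_op_AE_rep:
  assumes w: "jet_ball False 2 w M" and ae: "AE x in leb01. u x = w x"
  shows "AE x in leb01. conj_op u x = conj_rep w x"
proof -
  obtain v where v: "prim2 w v" "v \<in> L2" by (rule jet_ball_prim2_ex[OF w])
  have wL: "w \<in> L2" using jet_ball_L2[OF w] by simp
  let ?R = "exp_commutator w" and ?VE = "\<lambda>x. V x *\<^sub>R E w x"
  have RL: "(\<lambda>x. ?R x + ?VE x) \<in> L2"
    using bounded_op_L2[OF bounded_op_add[OF exp_commutator_bounded
          bounded_op_compose[OF exp_bounded bounded_op_scaleR[OF V_smooth]]] w] by simp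
  have rL: "(\<lambda>x. E v x + ?R x) \<in> L2" using L2_add(1)[OF exp_L2[OF v(2)] bounded_op_L2[OF exp_commutator_bounded w]] by simp
  have "AE x in leb01. conj_op u x = E' (\<lambda>x. (E v x + ?R x) + ?VE x) x - v x"
    by (rule conj_op_AE[OF wL ae v(1) prim2_exp[OF w v(2,1)] rL])
  moreover have "AE x in leb01. E' (\<lambda>x. (E v x + ?R x) + ?VE x) x = v x + conj_rep w x"
  proof (rule AE_leb01_I)
    fix x :: real assume x: "x \<in> {0..1}"
    have "E' (\<lambda>x. 1 * E v x + 1 * (?R x + ?VE x)) x = 1 * E' (E v) x + 1 * E' (\<lambda>x. ?R x + ?VE x) x"
      by (rule neg.exp_lincomb[OF exp_L2[OF v(2)] RL x])
    then show "E' (\<lambda>x. (E v x + ?R x) + ?VE x) x = v x + conj_rep w x"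
      using exp_inverse[OF v(2) x] by (simp add: conj_rep_def add.assoc)
  qed
  ultimately show ?thesis by eventually_elim simp
qed

text \<open>Linearity is read off from the expression with second derivatives, in which every operation is linear.\<close>
lemma conj_op_lincomb:
  assumes u: "jet_ball False 2 u M" and u': "jet_ball False 2 u' M'"
    and ae: "AE x in leb01. f x = u x" and ae': "AE x in leb01. f' x = u' x"
  shows "AE x in leb01. conj_op (\<lambda>x. c * f x + d * f' x) x = c * conj_op f x + d * conj_op f' x"
proof -
  have L: "u \<in> L2" "u' \<in> L2" using jet_ball_L2[OF u] jet_ball_L2[OF u'] by auto
  obtain v where v: "prim2 u v" "v \<in> L2" by (rule jet_ball_prim2_ex[OF u])
  obtain v' where v': "prim2 u' v'" "v' \<in> L2" by (rule jet_ball_prim2_ex[OF u'])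
  obtain e where e: "\<And>u M. jet_ball False 2 u M \<Longrightarrow> jet_ball False 2 (E u) (e * M)"
    using exp_bounded[of False 2] by (rule bounded_opE) blast
  obtain r where r: "prim2 (E u) r" "r \<in> L2" by (rule jet_ball_prim2_ex[OF e[OF u]])
  obtain r' where r': "prim2 (E u') r'" "r' \<in> L2" by (rule jet_ball_prim2_ex[OF e[OF u']])
  let ?w = "\<lambda>x. c * u x + d * u' x"
  have aew: "AE x in leb01. c * f x + d * f' x = ?w x" using ae ae' by eventually_elim simp
  have Ew: "E ?w x = c * E u x + d * E u' x" if "x \<in> {0..1}" for x by (rule exp_lincomb[OF L that])
  have rw: "prim2 (E ?w) (\<lambda>x. c * r x + d * r' x)"
    by (rule prim2_cong[OF prim2_lincomb[OF r(1) r'(1), of c d]]) (auto simp: Ew)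
  have 0: "AE x in leb01. conj_op (\<lambda>x. c * f x + d * f' x) x
      = E' (\<lambda>x. (c * r x + d * r' x) + V x *\<^sub>R E ?w x) x - (c * v x + d * v' x)"
    by (rule conj_op_AE[OF L2_lincomb[OF L] aew prim2_lincomb[OF v(1) v'(1)] rw L2_lincomb[OF r(2) r'(2)]])
  have VE: "(\<lambda>x. V x *\<^sub>R E g x) \<in> L2" if "jet_ball False 2 g N" for g N
    by (rule bounded_op_L2[OF bounded_op_compose[OF exp_bounded bounded_op_scaleR[OF V_smooth]] that])
  have q: "(\<lambda>x. r x + V x *\<^sub>R E u x) \<in> L2" "(\<lambda>x. r' x + V x *\<^sub>R E u' x) \<in> L2"
    by (intro L2_add(1) r(2) r'(2) VE[OF u] VE[OF u'])+
  have "AE x in leb01. c * (r x + V x *\<^sub>R E u x) + d * (r' x + V x *\<^sub>R E u' x)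
      = (c * r x + d * r' x) + V x *\<^sub>R E ?w x"
    by (rule AE_leb01_I) (simp add: Ew algebra_simps)
  from neg.exp_cong[OF L2_lincomb[OF q] this]
  have 1: "AE x in leb01. E' (\<lambda>x. (c * r x + d * r' x) + V x *\<^sub>R E ?w x) x
      = E' (\<lambda>x. c * (r x + V x *\<^sub>R E u x) + d * (r' x + V x *\<^sub>R E u' x)) x"
    by (rule eventually_mono) simp
  have 2: "AE x in leb01. E' (\<lambda>x. c * (r x + V x *\<^sub>R E u x) + d * (r' x + V x *\<^sub>R E u' x)) x
      = c * E' (\<lambda>x. r x + V x *\<^sub>R E u x) x + d * E' (\<lambda>x. r' x + V x *\<^sub>R E u' x) x"
    by (rule AE_leb01_I) (rule neg.exp_lincomb[OF q])
  from 0 1 2 conj_op_AE[OF L(1) ae v(1) r] conj_op_AE[OF L(2) ae' v'(1) r'] show ?thesis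
    by eventually_elim (simp only: right_diff_distrib add_diff_add)
qed

lemma conj_op_bounded:
  assumes m: "2 \<le> m" shows "bounded_on_Sob m conj_op"
  unfolding bounded_on_Sob_def
proof (intro conjI ballI allI)
  obtain c where c: "0 \<le> c" "\<And>u M. jet_ball False m u M \<Longrightarrow> jet_ball False m (conj_rep u) (c * M)"
    using conj_rep_bounded[OF m] by (rule bounded_opE) blast
  have *: "conj_op u \<in> Sob m" "Sob_norm m (conj_op u) \<le> (real (Suc m) * c * 2) * Sob_norm m u" if u: "u \<in> Sob m" for u
  proof -
    obtain w where w: "AE x in leb01. u x = w x" "jet_ball False m w (2 * Sob_norm m u)"
      by (rule Sob_imp_jet_ball[OF u])
    from jet_ball_imp_Sob[OF c(2)[OF w(2)] conj_op_AE_rep[OF jet_ball_le[OF w(2) m] w(1)]]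
    show "conj_op u \<in> Sob m" "Sob_norm m (conj_op u) \<le> (real (Suc m) * c * 2) * Sob_norm m u"
      by (auto simp: mult.assoc)
  qed
  show "conj_op ` Sob m \<subseteq> Sob m" using *(1) by blast
  show "\<exists>B. \<forall>u\<in>Sob m. Sob_norm m (conj_op u) \<le> B * Sob_norm m u" using *(2) by blast
  fix f f' and c d assume f: "f \<in> Sob m" "f' \<in> Sob m"
  obtain u where u: "AE x in leb01. f x = u x" "jet_ball False m u (2 * Sob_norm m f)"
    by (rule Sob_imp_jet_ball[OF f(1)])
  obtain u' where u': "AE x in leb01. f' x = u' x" "jet_ball False m u' (2 * Sob_norm m f')"
    by (rule Sob_imp_jet_ball[OF f(2)])
  show "AE x in leb01. conj_op (\<lambda>x. c * f x + d * f' x) x = c * conj_op f x + d * conj_op f' x"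
    by (rule conj_op_lincomb[OF jet_ball_le[OF u(2) m] jet_ball_le[OF u'(2) m] u(1) u'(1)])
qed

end

section \<open>Transport of the boundary conditions\<close>

locale boundary_transport = conjugation T K V for T K V +
  fixes \<phi> :: "nat \<Rightarrow> real \<Rightarrow> real \<Rightarrow> real" and k :: nat
  assumes phi_smooth: "y \<in> {0, 1} \<Longrightarrow> smooth01 (\<phi> n y)"
    and phi_jet: "y \<in> {0, 1} \<Longrightarrow> z \<in> {0, 1} \<Longrightarrow>
           (deriv01 ^^ i) (\<phi> n y) z = (if z = y \<and> i = n then 1 else 0)"
    and exp_Dir: "op_exp T ` Sob_Dir (k + 1) \<subseteq> Sob_V V (k + 1)"
begin

text \<open>A smooth function with prescribed jets of order below \<open>N\<close> at both end points.\<close>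
definition interpolant :: "nat \<Rightarrow> (nat \<Rightarrow> real \<Rightarrow> complex) \<Rightarrow> real \<Rightarrow> complex" where
  "interpolant N a x = (\<Sum>(y, n)\<in>{0, 1} \<times> {..<N}. a n y * complex_of_real (\<phi> n y x))"

lemma interpolant_term:
  assumes "p \<in> {0, 1} \<times> {..<N}"
  shows "\<exists>M. jet_ball False m (\<lambda>x. a (snd p) (fst p) * complex_of_real (\<phi> (snd p) (fst p) x)) M"
proof -
  have "smooth01 (\<phi> (snd p) (fst p))" using assms phi_smooth by auto
  then show ?thesis using jet_ball_smooth jet_ball_scale by blast
qed

lemma interpolant_jet_ball: "\<exists>M. jet_ball False m (interpolant N a) M"
proof -
  have "\<forall>p\<in>{0, 1} \<times> {..<N}. \<exists>M. jet_ball False m (\<lambda>x. a (snd p) (fst p) * complex_of_real (\<phi> (snd p) (fst p) x)) M"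
    by (intro ballI interpolant_term)
  then obtain M where M: "\<And>p. p \<in> {0, 1} \<times> {..<N} \<Longrightarrow>
      jet_ball False m (\<lambda>x. a (snd p) (fst p) * complex_of_real (\<phi> (snd p) (fst p) x)) (M p)"
    by metis
  have "jet_ball False m (\<lambda>x. \<Sum>p\<in>{0, 1} \<times> {..<N}. a (snd p) (fst p) * complex_of_real (\<phi> (snd p) (fst p) x))
      (\<Sum>p\<in>{0, 1} \<times> {..<N}. M p)"
    by (rule jet_ball_sum[OF _ M]) auto
  then show ?thesis unfolding interpolant_def[abs_def] by (auto simp: case_prod_beta)
qed

lemma interpolant_jets:
  assumes z: "z \<in> {0, 1}"
  shows "(deriv01 ^^ n) (interpolant N a) z = (if n < N then a n z else 0)"
proof -
  have z': "z \<in> {0..1}" using z by auto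
  have "\<forall>p\<in>{0, 1} \<times> {..<N}. \<exists>M. jet_ball False (Suc n) (\<lambda>x. a (snd p) (fst p) * complex_of_real (\<phi> (snd p) (fst p) x)) M"
    by (intro ballI interpolant_term)
  then obtain M where M: "\<And>p. p \<in> {0, 1} \<times> {..<N} \<Longrightarrow>
      jet_ball False (Suc n) (\<lambda>x. a (snd p) (fst p) * complex_of_real (\<phi> (snd p) (fst p) x)) (M p)"
    by metis
  have "(deriv01 ^^ n) (interpolant N a) z
      = (\<Sum>p\<in>{0, 1} \<times> {..<N}. (deriv01 ^^ n) (\<lambda>x. a (snd p) (fst p) * complex_of_real (\<phi> (snd p) (fst p) x)) z)"
    unfolding interpolant_def[abs_def] case_prod_beta by (rule jets_sum[OF _ M _ z']) auto
  also have "\<dots> = (\<Sum>p\<in>{0, 1} \<times> {..<N}. if p = (z, n) then a n z else 0)"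
  proof (rule sum.cong[OF refl])
    fix p assume p: "p \<in> {0 :: real, 1} \<times> {..<N}"
    then have y: "fst p \<in> {0, 1}" by auto
    show "(deriv01 ^^ n) (\<lambda>x. a (snd p) (fst p) * complex_of_real (\<phi> (snd p) (fst p) x)) z
      = (if p = (z, n) then a n z else 0)"
      unfolding jets_of_real[OF phi_smooth[OF y] z'] phi_jet[OF y z] by (auto simp: prod_eq_iff)
  qed
  also have "\<dots> = (if n < N then a n z else 0)" using z by (auto simp: sum.delta)
  finally show ?thesis .
qed

text \<open>The inverse \<open>e\<^bsup>-T\<^esup>\<close> takes \<open>H\<^sub>V\<^bsup>2j\<^esup>\<close> to \<open>H\<^sub>D\<^sub>i\<^sub>r\<^bsup>2j\<^esup>\<close>, although the hypothesis on \<open>e\<^sup>T\<close> concerns the single order \<open>2 k + 2\<close> and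
  the opposite inclusion. By induction on \<open>l\<close> the jet of order \<open>2 l\<close> vanishes: \<open>u\<close> is, up to a flat function, the sum of
  a smooth \<open>p\<close> with odd jets only, for which \<open>e\<^sup>T p\<close> satisfies the boundary conditions by hypothesis, and a smooth \<open>q\<close>
  that is flat to order \<open>2 l\<close>, for which \<open>(\<partial>\<^sup>2 + V)\<^sup>l e\<^sup>T q\<close> at an end point is just the jet of order \<open>2 l\<close>.\<close>
lemma even_jets_zero:
  assumes j: "j \<le> k + 1" and u: "jet_ball False (2 * j) u M"
    and zero: "\<And>l z. l < j \<Longrightarrow> z \<in> {0, 1} \<Longrightarrow> (classical_schr V ^^ l) (E u) z = 0"
  shows "l < j \<Longrightarrow> z \<in> {0, 1} \<Longrightarrow> (deriv01 ^^ (2 * l)) u z = 0"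
proof (induction l arbitrary: z rule: less_induct)
  case (less l)
  let ?m = "2 * j"
  have z': "z \<in> {0..1}" using less.prems by auto
  have l: "2 * l < ?m" using less.prems by simp
  define a where "a n y = (deriv01 ^^ n) u y" for n y
  define p where "p = interpolant ?m (\<lambda>n y. if odd n then a n y else 0)"
  define q where "q = interpolant ?m (\<lambda>n y. if even n then a n y else 0)"
  obtain P where P: "jet_ball False (2 * (k + 1)) p P" using interpolant_jet_ball unfolding p_def by blast
  have P': "jet_ball False ?m p P" using jet_ball_le[OF P] j by simp
  obtain Q where Q: "jet_ball False (?m + 1) q Q" using interpolant_jet_ball unfolding q_def by blast
  have Q': "jet_ball False ?m q Q" using jet_ball_le[OF Q] by simp
  have pj: "(deriv01 ^^ n) p y = (if n < ?m then if odd n then a n y else 0 else 0)" if "y \<in> {0, 1}" for n y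
    unfolding p_def interpolant_jets[OF that] ..
  have qj: "(deriv01 ^^ n) q y = (if n < ?m then if even n then a n y else 0 else 0)" if "y \<in> {0, 1}" for n y
    unfolding q_def interpolant_jets[OF that] ..
  obtain e where e: "0 \<le> e" "\<And>u M. jet_ball False ?m u M \<Longrightarrow> jet_ball False ?m (E u) (e * M)"
    using exp_bounded by (rule bounded_opE) blast
  define r where "r x = 1 * u x + (-1) * (1 * p x + 1 * q x)" for x
  have pq: "jet_ball False ?m (\<lambda>x. 1 * p x + 1 * q x) (P + Q)" using jet_ball_add[OF P' Q'] by simp
  have rb: "jet_ball False ?m r (M + (P + Q))"
    using jet_ball_add[OF jet_ball_scale[OF u, of 1] jet_ball_scale[OF pq, of "-1"]]
    unfolding r_def[abs_def] by (simp only: norm_one norm_minus_cancel mult_1_left)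
  have rt: "jet_ball True ?m r (M + (P + Q))"
  proof (rule jet_ball_flatI[OF rb])
    fix i and y :: real assume i: "i < ?m" and y: "y \<in> {0, 1}"
    then have y': "y \<in> {0..1}" by auto
    show "(deriv01 ^^ i) r y = 0"
      unfolding r_def[abs_def] jets_lincomb[OF u pq i y'] jets_lincomb[OF P' Q' i y'] pj[OF y] qj[OF y]
      using i by (simp add: a_def)
  qed
  have ul: "u \<in> L2" "p \<in> L2" "q \<in> L2" "r \<in> L2"
    using jet_ball_L2[OF u] jet_ball_L2[OF P'] jet_ball_L2[OF Q'] jet_ball_L2[OF rb] by auto
  let ?S = "classical_schr V ^^ l"
  have Eu: "E u x = (E p x + E q x) + E r x" if x: "x \<in> {0..1}" for x
  proof -
    have "u = (\<lambda>x. 1 * (1 * p x + 1 * q x) + 1 * r x)" by (auto simp: r_def)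
    then have "E u x = E (\<lambda>x. 1 * (1 * p x + 1 * q x) + 1 * r x) x" by simp
    also have "\<dots> = 1 * E (\<lambda>x. 1 * p x + 1 * q x) x + 1 * E r x"
      by (rule exp_lincomb[OF L2_lincomb[OF ul(2,3)] ul(4) x])
    also have "E (\<lambda>x. 1 * p x + 1 * q x) x = 1 * E p x + 1 * E q x"
      by (rule exp_lincomb[OF ul(2,3) x])
    finally show ?thesis by simp
  qed
  have "0 = ?S (E u) z" using zero[OF less.prems] by simp
  also have "\<dots> = ?S (\<lambda>x. (E p x + E q x) + E r x) z"
    by (rule classical_schr_iter_cong[OF Eu z'])
  also have "\<dots> = ?S (\<lambda>x. E p x + E q x) z + ?S (E r) z"
    by (rule classical_schr_iter_add[OF V_smooth jet_ball_add[OF e(2)[OF P'] e(2)[OF Q']] e(2)[OF rb] l z'])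
  also have "?S (\<lambda>x. E p x + E q x) z = ?S (E p) z + ?S (E q) z"
    by (rule classical_schr_iter_add[OF V_smooth e(2)[OF P'] e(2)[OF Q'] l z'])
  also have "?S (E r) z = 0"
  proof -
    obtain R where "jet_ball True ?m (E r) R"
      using bounded_op_image[OF exp_bounded rt] by blast
    from classical_schr_iter_flat[OF V_smooth this l less.prems(2)] show ?thesis .
  qed
  also have "?S (E p) z = 0"
  proof -
    have "p \<in> Sob_Dir (k + 1)"
      using Sob_Dir_iff[OF P, of p] pj by simp
    then have "op_exp T p \<in> Sob_V V (k + 1)" using exp_Dir by blast
    moreover obtain R where R: "jet_ball False (2 * (k + 1)) (E p) R"
      using bounded_op_image[OF exp_bounded P] by blast
    from Sob_V_iff[OF V_smooth R exp_AE[OF ul(2)], of p]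
    have "op_exp T p \<in> Sob_V V (k + 1) \<longleftrightarrow> (\<forall>l<k + 1. \<forall>z\<in>{0, 1}. (classical_schr V ^^ l) (E p) z = 0)" by simp
    ultimately show ?thesis using less.prems j by auto
  qed
  also have "?S (E q) z = a (2 * l) z"
  proof -
    have ql: "jet_ball True (2 * l) q Q"
    proof (rule jet_ball_flatI[OF jet_ball_le[OF Q]])
      fix i and y :: real assume i: "i < 2 * l" and y: "y \<in> {0, 1}"
      show "(deriv01 ^^ i) q y = 0"
      proof (cases "even i")
        case True
        then obtain h where "i = 2 * h" by blast
        with less.IH[of h y] i y less.prems show ?thesis by (simp add: qj[OF y] a_def)
      qed (simp add: qj[OF y])
    qed (use l in simp)
    obtain D where d: "jet_ball True (Suc (2 * l)) (\<lambda>x. E q x - q x) D"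
      using bounded_op_image[OF exp_minus_id_gain ql] by blast
    have q1: "jet_ball False (Suc (2 * l)) q Q" using jet_ball_le[OF Q] l by simp
    have "?S (E q) z = ?S (\<lambda>x. q x + (E q x - q x)) z" by (rule classical_schr_iter_cong[OF _ z']) simp
    also have "\<dots> = ?S q z + ?S (\<lambda>x. E q x - q x) z"
      by (rule classical_schr_iter_add[OF V_smooth q1 jet_ball_forget[OF d] _ z']) simp
    also have "?S (\<lambda>x. E q x - q x) z = 0"
      by (rule classical_schr_iter_flat[OF V_smooth d _ less.prems(2)]) simp
    also have "?S q z = (deriv01 ^^ (2 * l)) q z"
      using classical_schr_iter_leading[OF V_smooth less.prems(2) ql] q1 by simp
    finally show ?thesis using l by (simp add: qj[OF less.prems(2)])
  qed
  finally show ?case by (simp add: a_def)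
qed

text \<open>Subtract from \<open>u\<close> the smooth function \<open>s\<close> with the same jets of order below \<open>2 j\<close>. The rest is flat, and is mapped to a
  flat function. As \<open>s\<close> has odd jets only, \<open>e\<^sup>T s\<close> lies in \<open>H\<^sub>V\<^bsup>2k+2\<^esup>\<close>, hence \<open>(\<partial>\<^sup>2 + V) e\<^sup>T s\<close> in \<open>H\<^sub>V\<^bsup>2k\<^esup>\<close>, and
  \<open>e\<^bsup>-T\<^esup>\<close> takes it to a function with vanishing even jets; so does \<open>\<partial>\<^sup>2\<close> with \<open>s\<close>.\<close>
lemma conj_op_Dir:
  assumes j: "1 \<le> j" "j \<le> k" and u: "u \<in> Sob_Dir j"
  shows "conj_op u \<in> Sob_Dir j"
proof -
  have m: "2 \<le> 2 * j" using j by simp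
  have "u \<in> Sob (2 * j)" using u by (simp add: Sob_Dir_def)
  then obtain w M where w: "AE x in leb01. u x = w x" "jet_ball False (2 * j) w M"
    by (rule Sob_imp_jet_ball) blast
  have wD: "(deriv01 ^^ (2 * l)) w z = 0" if "l < j" "z \<in> {0, 1}" for l z
    using Sob_Dir_iff[OF w(2,1)] u that by blast
  define s where "s = interpolant (2 * j) (\<lambda>n y. (deriv01 ^^ n) w y)"
  have sb: "\<exists>S. jet_ball False m s S" for m unfolding s_def by (rule interpolant_jet_ball)
  have sj: "(deriv01 ^^ n) s z = (if n < 2 * j then (deriv01 ^^ n) w z else 0)" if "z \<in> {0, 1}" for n z
    unfolding s_def by (rule interpolant_jets[OF that])
  have s_even: "(deriv01 ^^ (2 * l)) s z = 0" if "z \<in> {0, 1}" for l z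
    using sj[OF that, of "2 * l"] wD[of l z] that by auto
  obtain S where S: "jet_ball False (2 * j) s S" using sb by blast
  define f where "f x = 1 * w x + (-1) * s x" for x
  have fb: "jet_ball False (2 * j) f (M + S)" using jet_ball_diff[OF w(2) S] by (simp add: f_def[abs_def])
  have ft: "jet_ball True (2 * j) f (M + S)"
  proof (rule jet_ball_flatI[OF fb])
    fix i and y :: real assume i: "i < 2 * j" and y: "y \<in> {0, 1}"
    then have y': "y \<in> {0..1}" by auto
    show "(deriv01 ^^ i) f y = 0"
      unfolding f_def[abs_def] jets_lincomb[OF w(2) S i y'] sj[OF y] using i by simp
  qed
  obtain C where F: "jet_ball True (2 * j) (conj_rep f) C"
    using bounded_op_image[OF conj_rep_bounded[OF m] ft] by blast
  obtain S1 where S1: "jet_ball False (2 * (k + 1)) s S1" using sb by blast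
  obtain S2 where Es: "jet_ball False (2 * (k + 1)) (E s) S2"
    using bounded_op_image[OF exp_bounded S1] by blast
  have sL: "s \<in> L2" using jet_ball_L2[OF S] by simp
  have "s \<in> Sob_Dir (k + 1)" using Sob_Dir_iff[OF S1, of s] s_even by simp
  then have "op_exp T s \<in> Sob_V V (k + 1)" using exp_Dir by blast
  then have "\<forall>l<k + 1. \<forall>z\<in>{0, 1}. (classical_schr V ^^ l) (E s) z = 0"
    using Sob_V_iff[OF V_smooth Es exp_AE[OF sL], of s] by simp
  then have EV: "(classical_schr V ^^ l) (E s) z = 0" if "l < k + 1" "z \<in> {0, 1}" for l z
    using that by blast
  let ?g = "classical_schr V (E s)"
  have "jet_ball False (2 * k + 2) (E s) S2" using Es by (simp add: algebra_simps)
  from jet_ball_classical_schr[OF V_smooth this] obtain G where G: "jet_ball False (2 * k) ?g G"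
    using j by auto
  have gL: "?g \<in> L2" using jet_ball_L2[OF G] by simp
  define t where "t = E' ?g"
  obtain R where tb: "jet_ball False (2 * k) t R"
    unfolding t_def using bounded_op_image[OF neg.exp_bounded G] by blast
  have tD: "(deriv01 ^^ (2 * l)) t z = 0" if "l < k" "z \<in> {0, 1}" for l z
  proof (rule even_jets_zero[OF _ tb _ that])
    fix h and y :: real assume h: "h < k" and y: "y \<in> {0, 1}"
    then have y': "y \<in> {0..1}" by auto
    have "(classical_schr V ^^ h) (E t) y = (classical_schr V ^^ h) ?g y"
      by (rule classical_schr_iter_cong[OF _ y']) (simp add: t_def exp_inverse'[OF gL])
    also have "\<dots> = (classical_schr V ^^ Suc h) (E s) y" by (simp add: funpow_swap1)
    also have "\<dots> = 0" by (rule EV) (use h y in auto)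
    finally show "(classical_schr V ^^ h) (E t) y = 0" .
  qed simp
  have s2b: "jet_ball False (2 * k) ((deriv01 ^^ 2) s) S1" using jet_ball_jets[OF S1, of 2] j by simp
  have conj_s: "AE x in leb01. conj_op s x = t x - (deriv01 ^^ 2) s x"
  proof -
    have "AE x in leb01. ?g x = schr V (op_exp T s) x"
      using schr_iter_AE[OF V_smooth Es exp_AE[OF sL], of s 1] j by simp (rule eventually_mono, auto)
    note ae = this
    have sL': "schr V (op_exp T s) \<in> L2" by (rule L2_AE(1)[OF gL ae])
    have "AE x in leb01. weak_deriv 2 s x = (deriv01 ^^ 2) s x"
      by (rule weak_deriv_AE(1)[OF has_weak_deriv_jets[OF S1]]) (use j in auto)
    with neg.op_exp_eq(2)[OF sL'] neg.exp_cong[OF gL ae] show ?thesis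
      by eventually_elim (simp add: conj_op_def t_def)
  qed
  have w2: "jet_ball False 2 f (M + S)" "jet_ball False 2 s S"
    using jet_ball_le[OF fb m] jet_ball_le[OF S m] .
  have "AE x in leb01. u x = 1 * f x + 1 * s x" using w(1) by (rule eventually_mono) (simp add: f_def)
  have "AE x in leb01. conj_op u x = conj_rep w x" by (rule conj_op_AE_rep[OF jet_ball_le[OF w(2) m] w(1)])
  moreover have "AE x in leb01. conj_op (\<lambda>x. 1 * f x + 1 * s x) x = conj_rep w x"
    by (rule conj_op_AE_rep[OF jet_ball_le[OF w(2) m]]) (simp add: f_def)
  moreover have "AE x in leb01. conj_op (\<lambda>x. 1 * f x + 1 * s x) x = 1 * conj_op f x + 1 * conj_op s x"
    by (rule conj_op_lincomb[OF w2]) auto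
  moreover have "AE x in leb01. conj_op f x = conj_rep f x" by (rule conj_op_AE_rep[OF w2(1)]) simp
  ultimately have ae: "AE x in leb01. conj_op u x = 1 * conj_rep f x + 1 * (1 * t x + (-1) * (deriv01 ^^ 2) s x)"
    using conj_s by eventually_elim simp
  have b1: "jet_ball False (2 * j) t R" "jet_ball False (2 * j) ((deriv01 ^^ 2) s) S1"
    using jet_ball_le[OF tb] jet_ball_le[OF s2b] j by auto
  have b2: "jet_ball False (2 * j) (\<lambda>x. 1 * t x + (-1) * (deriv01 ^^ 2) s x) (R + S1)"
    using jet_ball_diff[OF b1] by simp
  have b3: "jet_ball False (2 * j) (\<lambda>x. 1 * conj_rep f x + 1 * (1 * t x + (-1) * (deriv01 ^^ 2) s x)) (C + (R + S1))"
    using jet_ball_add[OF jet_ball_forget[OF F] b2] by simp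
  have "(deriv01 ^^ (2 * l)) (\<lambda>x. 1 * conj_rep f x + 1 * (1 * t x + (-1) * (deriv01 ^^ 2) s x)) z = 0"
    if l: "l < j" and z: "z \<in> {0, 1}" for l z
  proof -
    have z': "z \<in> {0..1}" and l': "2 * l < 2 * j" using l z by auto
    have "(deriv01 ^^ (2 * l)) ((deriv01 ^^ 2) s) z = (deriv01 ^^ (2 * (l + 1))) s z"
      by (simp only: distrib_left mult_1_right funpow_add comp_apply)
    also have "\<dots> = 0" by (rule s_even[OF z])
    finally show ?thesis
      unfolding jets_lincomb[OF jet_ball_forget[OF F] b2 l' z'] jets_lincomb[OF b1 l' z']
      using flat_jets[OF F l' z] tD[OF _ z, of l] l j by simp
  qed
  then show ?thesis using Sob_Dir_iff[OF b3 ae] by blast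
qed

end

section \<open>The corrected potential\<close>

theorem theorem2p11:
  fixes V :: "real \<Rightarrow> real"
    and \<phi> :: "nat \<Rightarrow> real \<Rightarrow> real \<Rightarrow> real"
    and \<alpha> :: "nat \<Rightarrow> nat \<Rightarrow> real \<Rightarrow> real"
    and k :: nat
  assumes V_smooth: "smooth01 V"
    and phi_smooth: "\<And>n y. y \<in> {0, 1} \<Longrightarrow> smooth01 (\<phi> n y)"
    and phi_jet: "\<And>n y z i. y \<in> {0, 1} \<Longrightarrow> z \<in> {0, 1} \<Longrightarrow>
           (deriv01 ^^ i) (\<phi> n y) z = (if z = y \<and> i = n then 1 else 0)"
    and alpha: "\<And>m. m \<ge> 1 \<Longrightarrow> op_exp (corrector \<alpha> \<phi> m) ` Sob_Dir (m + 1) \<subseteq> Sob_V V (m + 1)"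
    and k: "k \<ge> 1"
  shows "\<forall>j\<in>{1..k}. bounded_on_Sob (2 * j) (V_cor V \<alpha> \<phi> k) \<and>
           V_cor V \<alpha> \<phi> k ` Sob_Dir j \<subseteq> Sob_Dir j"
proof -
  obtain K where K: "commuting (corrector \<alpha> \<phi> k) K"
    using commuting_corrector[OF phi_smooth phi_jet] by blast
  interpret commuting "corrector \<alpha> \<phi> k" K by (rule K)
  interpret boundary_transport "corrector \<alpha> \<phi> k" K V \<phi> k
    by unfold_locales (fact V_smooth, fact phi_smooth, fact phi_jet, rule alpha[OF k])
  have "V_cor V \<alpha> \<phi> k = conj_op"
    by (simp add: V_cor_def[abs_def] conj_op_def[abs_def])
  then show ?thesis using conj_op_bounded conj_op_Dir by auto
qed

end
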